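(* Let $R$ be a lax symmetric monoidal partition functor and let $K$ be a commutative ring. Suppose that for every partition $\Lambda$ there is a homomorphism of abelian groups $\epsilon_\Lambda\colon R(\Lambda)\to C^K(\Lambda)=K$ such that the maps $\epsilon_\Lambda$ commute with transfers and with the lax symmetric monoidal structure maps. Then one can construct, canonically from this data, homomorphisms of abelian groups $$\widetilde\epsilon_\Lambda\colon\mathrm{PD}(R)(\Lambda)\to\mathrm{PD}(C^K)(\Lambda)\cong C_K(\Lambda)=K$$ that are compatible with transfer maps, with the lax symmetric monoidal structures, and with the units of the monad $\mathrm{PD}$, the last meaning that $$\widetilde\epsilon_\Lambda\circ\eta_\Lambda=|\Sigma_\Lambda|\,\epsilon_\Lambda\quad\text{for every partition }\Lambda .$$
   Context: Partitions. A partition $\Lambda=(X,\sim_\Lambda)$ is a finite set $X$ with an equivalence relation; its classes are called blocks. A morphism $f\colon\Lambda\to\Omega=(Y,\sim_\Omega)$ is a bijection $f\colon X\to Y$ with $x\sim_\Lambda x'\Rightarrow f(x)\sim_\Omega f(x')$. There is a (unique) 2-isomorphism $f\Rightarrow g$ between morphisms $f,g\colon\Lambda\to\Omega$ exactly when $f(x)\sim_\Omega g(x)$ for all $x$. This defines a $(2,1)$-category $\mathcal P$; functors from $\mathcal P$ to an ordinary category identify 2-isomorphic morphisms. Write $\Lambda\le\Omega$ if $X=Y$ and the identity is a morphism $\Lambda\to\Omega$; $\Lambda<\Omega$ if moreover $\Lambda\ne\Omega$. $\Lambda\cap\Gamma$ is the coarsest common refinement; $\Lambda\sqcup\Omega$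 the disjoint union; $\underline0$ the empty partition. $\Sigma_\Lambda$ is the group of bijections of $X$ preserving every block. For $f\colon\Lambda\to\Omega$ and $\Gamma\le\Lambda$, $f\Gamma$ is the transported partition and $f_\Gamma\colon\Gamma\to f\Gamma$ the induced isomorphism. Partition functors. A partition functor $M$ consists of abelian groups $M(\Lambda)$, a contravariant functor $M^*$ (restrictions) and a covariant functor $M_*$ (transfers) from $\mathcal P$ to abelian groups with common values $M(\Lambda)$, with $M_*(f)=M^*(f^{-1})$ for isomorphisms $f$, and for $\Gamma,\Lambda\le\Omega$ $$M^*(\Gamma\le\Omega)M_*(\Lambda\le\Omega)=\sum_{[\sigma]\in\Sigma_\Gamma\backslash\Sigma_\Omega/\Sigma_\Lambda}M_*(\Gamma\cap\sigma\Lambda\le\Gamma)\,M_*(\sigma)\,M^*(\sigma^{-1}\Gamma\cap\Lambda\le\Lambda).$$ It is lax symmetric monoidal if equipped with a unit $\mathbb Z\to M(\underline0)$ and external products $M(\Lambda)\otimes M(\Omega)\to M(\Lambda\sqcup\Omega)$, $x\otimes y\mapsto x\boxtimes y$, natural in pairs of restrictions and pairs of transfers, associative, unital, symmetric. Constant functors. The constant partition functor $C_K$ has $C_K(\Lambda)=K$, identity restrictions, and transfer along $f\colon\Lambda\to\Omega$ equal to multiplication by $|\Sigma_\Omega/\Sigma_{f\Lambda}|$. The dual constant partition functor $C^K$ has $C^K(\Lambda)=K$, identity transfers, and restriction along $f\colon\Lambda\to\Omega$ equal to multiplication by $|\Sigma_\Omega/\Sigma_{f\Lambda}|$. Both are lax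 symmetric monoidal via the multiplication and unit of $K$. One has $\mathrm{PD}(C^K)\cong C_K$, and the unit $C^K(\Lambda)\to\mathrm{PD}(C^K)(\Lambda)\cong C_K(\Lambda)$ is multiplication by $|\Sigma_\Lambda|$. Thus the hypotheses on $\epsilon$ say: $\epsilon_\Omega R_*(f)=\epsilon_\Lambda$ for every $f\colon\Lambda\to\Omega$; $\epsilon_{\Lambda\sqcup\Omega}(x\boxtimes y)=\epsilon_\Lambda(x)\epsilon_\Omega(y)$; $\epsilon_{\underline 0}(1)=1$. Compatibility of $\widetilde\epsilon$ with transfers means $\widetilde\epsilon_\Omega\,\mathrm{PD}(R)_*(f)=|\Sigma_\Omega/\Sigma_{f\Lambda}|\,\widetilde\epsilon_\Lambda$ for $f\colon\Lambda\to\Omega$, and compatibility with the lax symmetric monoidal structure means $\widetilde\epsilon_{\Lambda\sqcup\Omega}(u\boxtimes v)=\widetilde\epsilon_\Lambda(u)\widetilde\epsilon_\Omega(v)$ and $\widetilde\epsilon_{\underline0}(1)=1$. $\mathrm{PD}$. $I_\Gamma\subseteq R(\Gamma)$ is the sum of images of $R_*(\Omega<\Gamma)$ over $\Omega<\Gamma$; $\bar R(\Gamma)=R(\Gamma)/I_\Gamma$ with quotient map $q_\Gamma$; for isomorphisms $f$, $\bar R_*(f)$ is induced by $R_*(f)$; external products descend to $\bar R$. $\mathrm{PD}(R)(\Lambda)=(\bigoplus_{\Gamma\le\Lambda}\bar R(\Gamma))^{\Sigma_\Lambda}$ with action $(\sigma x)_\Gamma=\bar R_*(\sigma)(x_{\sigma^{-1}\Gamma})$.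 It is a lax symmetric monoidal partition functor with restriction $(\mathrm{PD}(R)^*(f)x)_\Gamma=\bar R_*(f_\Gamma)^{-1}(x_{f\Gamma})$, transfer along $f\colon\Psi\to\Lambda$ given by $(\mathrm{PD}(R)_*(f)x)_\Gamma=\sum\bar R_*(\sigma f)(x_{(\sigma f)^{-1}\Gamma})$, the sum over $[\sigma]\in\Sigma_\Gamma\backslash\Sigma_\Lambda/\Sigma_{f\Psi}$ with $\Gamma\le\sigma f\Psi$, and external product $(x\boxtimes y)_{\Gamma\sqcup\Theta}=x_\Gamma\boxtimes y_\Theta$. The unit is $\eta_\Lambda(z)=(q_\Gamma R^*(\Gamma\le\Lambda)z)_{\Gamma\le\Lambda}$. *)

theory Defs
  imports "HOL-Algebra.Coset" "HOL-Algebra.Generated_Groups" "HOL-Algebra.Product_Groups"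
    "HOL-Algebra.RingHom" "HOL-Combinatorics.Permutations"
begin

section \<open>Partitions\<close>

datatype 'x partn = Partn (pts: "'x set") (eqv: "('x \<times> 'x) set")

definition is_partition :: "'x partn \<Rightarrow> bool" where
  "is_partition \<Lambda> \<longleftrightarrow> finite (pts \<Lambda>) \<and> equiv (pts \<Lambda>) (eqv \<Lambda>)"

text \<open>A morphism is represented by a total function, of which only the values on the points of
  the source matter; partition functors are required below not to see the other values.\<close>

definition morphism :: "'x partn \<Rightarrow> 'x partn \<Rightarrow> ('x \<Rightarrow> 'x) \<Rightarrow> bool" where
  "morphism \<Lambda> \<Omega> f \<longleftrightarrow> is_partition \<Lambda> \<and> is_partition \<Omega> \<and> bij_betw f (pts \<Lambda>) (pts \<Omega>) \<and>
     (\<forall>x x'. (x, x') \<in> eqv \<Lambda> \<longrightarrow> (f x, f x') \<in> eqv \<Omega>)"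

definition two_isomorphic :: "'x partn \<Rightarrow> 'x partn \<Rightarrow> ('x \<Rightarrow> 'x) \<Rightarrow> ('x \<Rightarrow> 'x) \<Rightarrow> bool" where
  "two_isomorphic \<Lambda> \<Omega> f g \<longleftrightarrow> (\<forall>x \<in> pts \<Lambda>. (f x, g x) \<in> eqv \<Omega>)"

definition isomorphism :: "'x partn \<Rightarrow> 'x partn \<Rightarrow> ('x \<Rightarrow> 'x) \<Rightarrow> bool" where
  "isomorphism \<Lambda> \<Omega> f \<longleftrightarrow> morphism \<Lambda> \<Omega> f \<and> morphism \<Omega> \<Lambda> (inv_into (pts \<Lambda>) f)"

definition refines :: "'x partn \<Rightarrow> 'x partn \<Rightarrow> bool" where
  "refines \<Lambda> \<Omega> \<longleftrightarrow> pts \<Lambda> = pts \<Omega> \<and> morphism \<Lambda> \<Omega> id"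

definition strictly_refines :: "'x partn \<Rightarrow> 'x partn \<Rightarrow> bool" where
  "strictly_refines \<Lambda> \<Omega> \<longleftrightarrow> refines \<Lambda> \<Omega> \<and> \<Lambda> \<noteq> \<Omega>"

definition refinements :: "'x partn \<Rightarrow> 'x partn set" where
  "refinements \<Lambda> = {\<Gamma>. refines \<Gamma> \<Lambda>}"

text \<open>Coarsest common refinement of two partitions of the same set.\<close>

definition common_refinement :: "'x partn \<Rightarrow> 'x partn \<Rightarrow> 'x partn" where
  "common_refinement \<Lambda> \<Gamma> = Partn (pts \<Lambda> \<inter> pts \<Gamma>) (eqv \<Lambda> \<inter> eqv \<Gamma>)"

definition transport :: "('x \<Rightarrow> 'x) \<Rightarrow> 'x partn \<Rightarrow> 'x partn" where
  "transport f \<Gamma> = Partn (f ` pts \<Gamma>) (map_prod f f ` eqv \<Gamma>)"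

text \<open>\<open>f\<^sup>-\<^sup>1 \<Gamma>\<close> for a bijection \<open>f\<close> from \<open>A\<close> onto the points of \<open>\<Gamma>\<close>.\<close>

definition transport_back :: "'x set \<Rightarrow> ('x \<Rightarrow> 'x) \<Rightarrow> 'x partn \<Rightarrow> 'x partn" where
  "transport_back A f \<Gamma> = transport (inv_into A f) \<Gamma>"

definition empty_partn :: "'x partn" where
  "empty_partn = Partn {} {}"

text \<open>\<open>\<Sigma>\<^sub>\<Lambda>\<close>; its elements are extended by the identity outside the points of \<open>\<Lambda>\<close>.\<close>

definition block_perms :: "'x partn \<Rightarrow> ('x \<Rightarrow> 'x) set" where
  "block_perms \<Lambda> = {\<sigma>. \<sigma> permutes pts \<Lambda> \<and> (\<forall>x \<in> pts \<Lambda>. (\<sigma> x, x) \<in> eqv \<Lambda>)}"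

text \<open>\<open>\<Sigma>\<^sub>\<Omega> / \<Sigma>\<^sub>\<Lambda>\<close> and \<open>\<Sigma>\<^sub>\<Gamma> \ \<Sigma>\<^sub>\<Omega> / \<Sigma>\<^sub>\<Lambda>\<close> for \<open>\<Gamma>, \<Lambda> \<le> \<Omega>\<close>.\<close>

definition perm_cosets :: "'x partn \<Rightarrow> 'x partn \<Rightarrow> ('x \<Rightarrow> 'x) set set" where
  "perm_cosets \<Omega> \<Lambda> = (\<lambda>\<sigma>. {\<sigma> \<circ> \<tau> | \<tau>. \<tau> \<in> block_perms \<Lambda>}) ` block_perms \<Omega>"

definition double_cosets :: "'x partn \<Rightarrow> 'x partn \<Rightarrow> 'x partn \<Rightarrow> ('x \<Rightarrow> 'x) set set" where
  "double_cosets \<Gamma> \<Omega> \<Lambda> =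
     (\<lambda>\<sigma>. {\<rho> \<circ> \<sigma> \<circ> \<tau> | \<rho> \<tau>. \<rho> \<in> block_perms \<Gamma> \<and> \<tau> \<in> block_perms \<Lambda>}) ` block_perms \<Omega>"

text \<open>All sums over double cosets below are independent of the chosen representatives.\<close>

definition representative :: "('x \<Rightarrow> 'x) set \<Rightarrow> 'x \<Rightarrow> 'x" where
  "representative D = (SOME \<sigma>. \<sigma> \<in> D)"

section \<open>Disjoint unions\<close>

text \<open>Points are taken from a type closed under formal left and right tagging, so that the finite
  subsets of this type contain a copy of every finite set of atoms and have disjoint unions.\<close>

datatype 'u point = Atom 'u | InL "'u point" | InR "'u point"

definition disj_union :: "'u point partn \<Rightarrow> 'u point partn \<Rightarrow> 'u point partn" (infixr \<open>\<squnion>\<^sub>P\<close> 65) where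
  "\<Lambda> \<squnion>\<^sub>P \<Omega> = Partn (InL ` pts \<Lambda> \<union> InR ` pts \<Omega>)
     (map_prod InL InL ` eqv \<Lambda> \<union> map_prod InR InR ` eqv \<Omega>)"

text \<open>The functions in this section act as the evident bijections on disjoint unions; the values
  elsewhere are irrelevant.\<close>

fun map_disj_union :: "('u point \<Rightarrow> 'u point) \<Rightarrow> ('u point \<Rightarrow> 'u point) \<Rightarrow> 'u point \<Rightarrow> 'u point" where
  "map_disj_union f g (InL a) = InL (f a)"
| "map_disj_union f g (InR b) = InR (g b)"
| "map_disj_union f g (Atom u) = Atom u"

fun assoc_map :: "'u point \<Rightarrow> 'u point" where
  "assoc_map (InL (InL a)) = InL a"
| "assoc_map (InL (InR b)) = InR (InL b)"
| "assoc_map (InR c) = InR (InR c)"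
| "assoc_map p = p"

fun swap_map :: "'u point \<Rightarrow> 'u point" where
  "swap_map (InL a) = InR a"
| "swap_map (InR b) = InL b"
| "swap_map (Atom u) = Atom u"

fun untag :: "'u point \<Rightarrow> 'u point" where
  "untag (InL a) = a"
| "untag (InR b) = b"
| "untag (Atom u) = Atom u"

text \<open>A refinement of \<open>\<Lambda> \<squnion>\<^sub>P \<Omega>\<close> is uniquely of the form \<open>\<Gamma> \<squnion>\<^sub>P \<Theta>\<close>; these recover \<open>\<Gamma>\<close> and \<open>\<Theta>\<close>.\<close>

definition left_part :: "'u point partn \<Rightarrow> 'u point partn" where
  "left_part \<Delta> = Partn {a. InL a \<in> pts \<Delta>} {(a, a'). (InL a, InL a') \<in> eqv \<Delta>}"

definition right_part :: "'u point partn \<Rightarrow> 'u point partn" where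
  "right_part \<Delta> = Partn {b. InR b \<in> pts \<Delta>} {(b, b'). (InR b, InR b') \<in> eqv \<Delta>}"

section \<open>Partition functors\<close>

text \<open>Abelian groups are written multiplicatively, as everywhere in the group theory of the
  library: \<open>finprod\<close> is a finite sum and \<open>\<one>\<close> is zero.  The underlying sets of all the groups
  \<open>obj M \<Lambda>\<close> are subsets of one type, but may vary with \<open>\<Lambda>\<close>.
  \<open>res M \<Lambda> \<Omega> f\<close> and \<open>tr M \<Lambda> \<Omega> f\<close> are \<open>M\<^sup>*(f)\<close> and \<open>M\<^sub>*(f)\<close> for \<open>f : \<Lambda> \<rightarrow> \<Omega>\<close>; \<open>unt M\<close> is the image
  of 1 under the unit from the integers and \<open>ext M \<Lambda> \<Omega> x y\<close> is the external product of \<open>x\<close> and \<open>y\<close>.\<close>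

record ('u, 'a) pfunctor =
  obj :: "'u point partn \<Rightarrow> 'a monoid"
  res :: "'u point partn \<Rightarrow> 'u point partn \<Rightarrow> ('u point \<Rightarrow> 'u point) \<Rightarrow> 'a \<Rightarrow> 'a"
  tr :: "'u point partn \<Rightarrow> 'u point partn \<Rightarrow> ('u point \<Rightarrow> 'u point) \<Rightarrow> 'a \<Rightarrow> 'a"
  unt :: "'a"
  ext :: "'u point partn \<Rightarrow> 'u point partn \<Rightarrow> 'a \<Rightarrow> 'a \<Rightarrow> 'a"

locale partition_functor =
  fixes M :: "('u, 'a) pfunctor"
  assumes obj_comm_group: "is_partition \<Lambda> \<Longrightarrow> comm_group (obj M \<Lambda>)"
    and res_hom: "morphism \<Lambda> \<Omega> f \<Longrightarrow> res M \<Lambda> \<Omega> f \<in> hom (obj M \<Omega>) (obj M \<Lambda>)"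
    and tr_hom: "morphism \<Lambda> \<Omega> f \<Longrightarrow> tr M \<Lambda> \<Omega> f \<in> hom (obj M \<Lambda>) (obj M \<Omega>)"
    and res_id: "is_partition \<Lambda> \<Longrightarrow> x \<in> carrier (obj M \<Lambda>) \<Longrightarrow> res M \<Lambda> \<Lambda> id x = x"
    and tr_id: "is_partition \<Lambda> \<Longrightarrow> x \<in> carrier (obj M \<Lambda>) \<Longrightarrow> tr M \<Lambda> \<Lambda> id x = x"
    and res_comp: "morphism \<Lambda> \<Omega> f \<Longrightarrow> morphism \<Omega> \<Psi> g \<Longrightarrow> x \<in> carrier (obj M \<Psi>) \<Longrightarrow>
          res M \<Lambda> \<Psi> (g \<circ> f) x = res M \<Lambda> \<Omega> f (res M \<Omega> \<Psi> g x)"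
    and tr_comp: "morphism \<Lambda> \<Omega> f \<Longrightarrow> morphism \<Omega> \<Psi> g \<Longrightarrow> x \<in> carrier (obj M \<Lambda>) \<Longrightarrow>
          tr M \<Lambda> \<Psi> (g \<circ> f) x = tr M \<Omega> \<Psi> g (tr M \<Lambda> \<Omega> f x)"
    and res_two_iso: "morphism \<Lambda> \<Omega> f \<Longrightarrow> morphism \<Lambda> \<Omega> g \<Longrightarrow> two_isomorphic \<Lambda> \<Omega> f g \<Longrightarrow>
          x \<in> carrier (obj M \<Omega>) \<Longrightarrow> res M \<Lambda> \<Omega> f x = res M \<Lambda> \<Omega> g x"
    and tr_two_iso: "morphism \<Lambda> \<Omega> f \<Longrightarrow> morphism \<Lambda> \<Omega> g \<Longrightarrow> two_isomorphic \<Lambda> \<Omega> f g \<Longrightarrow>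
          x \<in> carrier (obj M \<Lambda>) \<Longrightarrow> tr M \<Lambda> \<Omega> f x = tr M \<Lambda> \<Omega> g x"
    and tr_iso: "isomorphism \<Lambda> \<Omega> f \<Longrightarrow> x \<in> carrier (obj M \<Lambda>) \<Longrightarrow>
          tr M \<Lambda> \<Omega> f x = res M \<Omega> \<Lambda> (inv_into (pts \<Lambda>) f) x"
    and double_coset_formula:
      "refines \<Gamma> \<Omega> \<Longrightarrow> refines \<Lambda> \<Omega> \<Longrightarrow> x \<in> carrier (obj M \<Lambda>) \<Longrightarrow>
          res M \<Gamma> \<Omega> id (tr M \<Lambda> \<Omega> id x) =
          finprod (obj M \<Gamma>)
            (\<lambda>D. let \<sigma> = representative D;
                     \<Gamma>\<^sub>1 = common_refinement \<Gamma> (transport \<sigma> \<Lambda>);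
                     \<Lambda>\<^sub>1 = common_refinement (transport_back (pts \<Omega>) \<sigma> \<Gamma>) \<Lambda>
                 in tr M \<Gamma>\<^sub>1 \<Gamma> id (tr M \<Lambda>\<^sub>1 \<Gamma>\<^sub>1 \<sigma> (res M \<Lambda>\<^sub>1 \<Lambda> id x)))
            (double_cosets \<Gamma> \<Omega> \<Lambda>)"

locale lax_symmetric_monoidal = partition_functor +
  assumes unt_closed: "unt M \<in> carrier (obj M empty_partn)"
    and ext_left_hom: "is_partition \<Lambda> \<Longrightarrow> is_partition \<Omega> \<Longrightarrow> y \<in> carrier (obj M \<Omega>) \<Longrightarrow>
          (\<lambda>x. ext M \<Lambda> \<Omega> x y) \<in> hom (obj M \<Lambda>) (obj M (\<Lambda> \<squnion>\<^sub>P \<Omega>))"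
    and ext_right_hom: "is_partition \<Lambda> \<Longrightarrow> is_partition \<Omega> \<Longrightarrow> x \<in> carrier (obj M \<Lambda>) \<Longrightarrow>
          (\<lambda>y. ext M \<Lambda> \<Omega> x y) \<in> hom (obj M \<Omega>) (obj M (\<Lambda> \<squnion>\<^sub>P \<Omega>))"
    and ext_res: "morphism \<Lambda> \<Lambda>' f \<Longrightarrow> morphism \<Omega> \<Omega>' g \<Longrightarrow>
          x \<in> carrier (obj M \<Lambda>') \<Longrightarrow> y \<in> carrier (obj M \<Omega>') \<Longrightarrow>
          ext M \<Lambda> \<Omega> (res M \<Lambda> \<Lambda>' f x) (res M \<Omega> \<Omega>' g y) =
          res M (\<Lambda> \<squnion>\<^sub>P \<Omega>) (\<Lambda>' \<squnion>\<^sub>P \<Omega>') (map_disj_union f g) (ext M \<Lambda>' \<Omega>' x y)"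
    and ext_tr: "morphism \<Lambda> \<Lambda>' f \<Longrightarrow> morphism \<Omega> \<Omega>' g \<Longrightarrow>
          x \<in> carrier (obj M \<Lambda>) \<Longrightarrow> y \<in> carrier (obj M \<Omega>) \<Longrightarrow>
          ext M \<Lambda>' \<Omega>' (tr M \<Lambda> \<Lambda>' f x) (tr M \<Omega> \<Omega>' g y) =
          tr M (\<Lambda> \<squnion>\<^sub>P \<Omega>) (\<Lambda>' \<squnion>\<^sub>P \<Omega>') (map_disj_union f g) (ext M \<Lambda> \<Omega> x y)"
    and ext_assoc: "is_partition \<Lambda> \<Longrightarrow> is_partition \<Omega> \<Longrightarrow> is_partition \<Psi> \<Longrightarrow>
          x \<in> carrier (obj M \<Lambda>) \<Longrightarrow> y \<in> carrier (obj M \<Omega>) \<Longrightarrow> z \<in> carrier (obj M \<Psi>) \<Longrightarrow>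
          tr M ((\<Lambda> \<squnion>\<^sub>P \<Omega>) \<squnion>\<^sub>P \<Psi>) (\<Lambda> \<squnion>\<^sub>P (\<Omega> \<squnion>\<^sub>P \<Psi>)) assoc_map
            (ext M (\<Lambda> \<squnion>\<^sub>P \<Omega>) \<Psi> (ext M \<Lambda> \<Omega> x y) z) =
          ext M \<Lambda> (\<Omega> \<squnion>\<^sub>P \<Psi>) x (ext M \<Omega> \<Psi> y z)"
    and ext_unit_left: "is_partition \<Lambda> \<Longrightarrow> x \<in> carrier (obj M \<Lambda>) \<Longrightarrow>
          tr M (empty_partn \<squnion>\<^sub>P \<Lambda>) \<Lambda> untag (ext M empty_partn \<Lambda> (unt M) x) = x"
    and ext_unit_right: "is_partition \<Lambda> \<Longrightarrow> x \<in> carrier (obj M \<Lambda>) \<Longrightarrow>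
          tr M (\<Lambda> \<squnion>\<^sub>P empty_partn) \<Lambda> untag (ext M \<Lambda> empty_partn x (unt M)) = x"
    and ext_sym: "is_partition \<Lambda> \<Longrightarrow> is_partition \<Omega> \<Longrightarrow>
          x \<in> carrier (obj M \<Lambda>) \<Longrightarrow> y \<in> carrier (obj M \<Omega>) \<Longrightarrow>
          tr M (\<Lambda> \<squnion>\<^sub>P \<Omega>) (\<Omega> \<squnion>\<^sub>P \<Lambda>) swap_map (ext M \<Lambda> \<Omega> x y) = ext M \<Omega> \<Lambda> y x"

text \<open>Families of group homomorphisms commuting with transfers and with the lax symmetric monoidal
  structure maps, but not necessarily with restrictions.\<close>

definition transfer_monoidal_map ::
  "('u, 'a) pfunctor \<Rightarrow> ('u, 'b) pfunctor \<Rightarrow> ('u point partn \<Rightarrow> 'a \<Rightarrow> 'b) \<Rightarrow> bool" where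
  "transfer_monoidal_map M N \<phi> \<longleftrightarrow>
     (\<forall>\<Lambda>. is_partition \<Lambda> \<longrightarrow> \<phi> \<Lambda> \<in> hom (obj M \<Lambda>) (obj N \<Lambda>)) \<and>
     (\<forall>\<Lambda> \<Omega> f x. morphism \<Lambda> \<Omega> f \<longrightarrow> x \<in> carrier (obj M \<Lambda>) \<longrightarrow>
        \<phi> \<Omega> (tr M \<Lambda> \<Omega> f x) = tr N \<Lambda> \<Omega> f (\<phi> \<Lambda> x)) \<and>
     (\<forall>\<Lambda> \<Omega> x y. is_partition \<Lambda> \<longrightarrow> is_partition \<Omega> \<longrightarrow>
        x \<in> carrier (obj M \<Lambda>) \<longrightarrow> y \<in> carrier (obj M \<Omega>) \<longrightarrow>
        \<phi> (\<Lambda> \<squnion>\<^sub>P \<Omega>) (ext M \<Lambda> \<Omega> x y) = ext N \<Lambda> \<Omega> (\<phi> \<Lambda> x) (\<phi> \<Omega> y)) \<and>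
     \<phi> empty_partn (unt M) = unt N"

definition lsm_pfunctor_map ::
  "('u, 'a) pfunctor \<Rightarrow> ('u, 'b) pfunctor \<Rightarrow> ('u point partn \<Rightarrow> 'a \<Rightarrow> 'b) \<Rightarrow> bool" where
  "lsm_pfunctor_map M N \<phi> \<longleftrightarrow> transfer_monoidal_map M N \<phi> \<and>
     (\<forall>\<Lambda> \<Omega> f x. morphism \<Lambda> \<Omega> f \<longrightarrow> x \<in> carrier (obj M \<Omega>) \<longrightarrow>
        \<phi> \<Lambda> (res M \<Lambda> \<Omega> f x) = res N \<Lambda> \<Omega> f (\<phi> \<Omega> x))"

section \<open>Constant functors\<close>

definition perm_index :: "'x partn \<Rightarrow> 'x partn \<Rightarrow> ('x \<Rightarrow> 'x) \<Rightarrow> nat" where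
  "perm_index \<Lambda> \<Omega> f = card (perm_cosets \<Omega> (transport f \<Lambda>))"

definition const_pf :: "'k ring \<Rightarrow> ('u, 'k) pfunctor" where
  "const_pf K = \<lparr>
     obj = (\<lambda>\<Lambda>. add_monoid K),
     res = (\<lambda>\<Lambda> \<Omega> f x. x),
     tr = (\<lambda>\<Lambda> \<Omega> f x. [perm_index \<Lambda> \<Omega> f] \<cdot>\<^bsub>K\<^esub> x),
     unt = \<one>\<^bsub>K\<^esub>,
     ext = (\<lambda>\<Lambda> \<Omega> x y. x \<otimes>\<^bsub>K\<^esub> y)\<rparr>"

definition dual_const_pf :: "'k ring \<Rightarrow> ('u, 'k) pfunctor" where
  "dual_const_pf K = \<lparr>
     obj = (\<lambda>\<Lambda>. add_monoid K),
     res = (\<lambda>\<Lambda> \<Omega> f x. [perm_index \<Lambda> \<Omega> f] \<cdot>\<^bsub>K\<^esub> x),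
     tr = (\<lambda>\<Lambda> \<Omega> f x. x),
     unt = \<one>\<^bsub>K\<^esub>,
     ext = (\<lambda>\<Lambda> \<Omega> x y. x \<otimes>\<^bsub>K\<^esub> y)\<rparr>"

section \<open>The construction PD\<close>

definition tr_ideal :: "('u, 'a) pfunctor \<Rightarrow> 'u point partn \<Rightarrow> 'a set" where
  "tr_ideal R \<Gamma> = generate (obj R \<Gamma>)
     (\<Union>\<Omega> \<in> {\<Omega>. strictly_refines \<Omega> \<Gamma>}. tr R \<Omega> \<Gamma> id ` carrier (obj R \<Omega>))"

definition bar :: "('u, 'a) pfunctor \<Rightarrow> 'u point partn \<Rightarrow> 'a set monoid" where
  "bar R \<Gamma> = obj R \<Gamma> Mod tr_ideal R \<Gamma>"

definition bar_proj :: "('u, 'a) pfunctor \<Rightarrow> 'u point partn \<Rightarrow> 'a \<Rightarrow> 'a set" where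
  "bar_proj R \<Gamma> a = tr_ideal R \<Gamma> #>\<^bsub>obj R \<Gamma>\<^esub> a"

text \<open>The maps induced on quotients are written as unions over all representatives; whenever the
  original map descends, all sets in the union coincide.\<close>

definition bar_tr ::
  "('u, 'a) pfunctor \<Rightarrow> 'u point partn \<Rightarrow> 'u point partn \<Rightarrow> ('u point \<Rightarrow> 'u point) \<Rightarrow> 'a set \<Rightarrow> 'a set" where
  "bar_tr R \<Gamma> \<Delta> f A = (\<Union>a \<in> A. bar_proj R \<Delta> (tr R \<Gamma> \<Delta> f a))"

definition bar_ext ::
  "('u, 'a) pfunctor \<Rightarrow> 'u point partn \<Rightarrow> 'u point partn \<Rightarrow> 'a set \<Rightarrow> 'a set \<Rightarrow> 'a set" where
  "bar_ext R \<Gamma> \<Theta> A B = (\<Union>a \<in> A. \<Union>b \<in> B. bar_proj R (\<Gamma> \<squnion>\<^sub>P \<Theta>) (ext R \<Gamma> \<Theta> a b))"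

text \<open>A partition has only finitely many refinements, so the direct sum over them is the product.
  Families indexed by the refinements are extensional functions, as in \<open>product_group\<close>.\<close>

definition PD_sum :: "('u, 'a) pfunctor \<Rightarrow> 'u point partn \<Rightarrow> ('u point partn \<Rightarrow> 'a set) monoid" where
  "PD_sum R \<Lambda> = product_group (refinements \<Lambda>) (bar R)"

definition PD_act ::
  "('u, 'a) pfunctor \<Rightarrow> 'u point partn \<Rightarrow> ('u point \<Rightarrow> 'u point) \<Rightarrow>
   ('u point partn \<Rightarrow> 'a set) \<Rightarrow> 'u point partn \<Rightarrow> 'a set" where
  "PD_act R \<Lambda> \<sigma> x = (\<lambda>\<Gamma> \<in> refinements \<Lambda>.
     let \<Gamma>' = transport_back (pts \<Lambda>) \<sigma> \<Gamma> in bar_tr R \<Gamma>' \<Gamma> \<sigma> (x \<Gamma>'))"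

definition PD_obj :: "('u, 'a) pfunctor \<Rightarrow> 'u point partn \<Rightarrow> ('u point partn \<Rightarrow> 'a set) monoid" where
  "PD_obj R \<Lambda> = (PD_sum R \<Lambda>)\<lparr>carrier :=
     {x \<in> carrier (PD_sum R \<Lambda>). \<forall>\<sigma> \<in> block_perms \<Lambda>. PD_act R \<Lambda> \<sigma> x = x}\<rparr>"

definition PD_res ::
  "('u, 'a) pfunctor \<Rightarrow> 'u point partn \<Rightarrow> 'u point partn \<Rightarrow> ('u point \<Rightarrow> 'u point) \<Rightarrow>
   ('u point partn \<Rightarrow> 'a set) \<Rightarrow> 'u point partn \<Rightarrow> 'a set" where
  "PD_res R \<Lambda> \<Omega> f x = (\<lambda>\<Gamma> \<in> refinements \<Lambda>.
     inv_into (carrier (bar R \<Gamma>)) (bar_tr R \<Gamma> (transport f \<Gamma>) f) (x (transport f \<Gamma>)))"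

definition PD_tr ::
  "('u, 'a) pfunctor \<Rightarrow> 'u point partn \<Rightarrow> 'u point partn \<Rightarrow> ('u point \<Rightarrow> 'u point) \<Rightarrow>
   ('u point partn \<Rightarrow> 'a set) \<Rightarrow> 'u point partn \<Rightarrow> 'a set" where
  "PD_tr R \<Psi> \<Lambda> f x = (\<lambda>\<Gamma> \<in> refinements \<Lambda>.
     finprod (bar R \<Gamma>)
       (\<lambda>D. let h = representative D \<circ> f; \<Gamma>' = transport_back (pts \<Psi>) h \<Gamma>
            in bar_tr R \<Gamma>' \<Gamma> h (x \<Gamma>'))
       {D \<in> double_cosets \<Gamma> \<Lambda> (transport f \<Psi>). refines \<Gamma> (transport (representative D \<circ> f) \<Psi>)})"

definition PD_unit :: "('u, 'a) pfunctor \<Rightarrow> 'u point partn \<Rightarrow> 'a \<Rightarrow> 'u point partn \<Rightarrow> 'a set" where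
  "PD_unit R \<Lambda> z = (\<lambda>\<Gamma> \<in> refinements \<Lambda>. bar_proj R \<Gamma> (res R \<Gamma> \<Lambda> id z))"

definition PD_ext ::
  "('u, 'a) pfunctor \<Rightarrow> 'u point partn \<Rightarrow> 'u point partn \<Rightarrow>
   ('u point partn \<Rightarrow> 'a set) \<Rightarrow> ('u point partn \<Rightarrow> 'a set) \<Rightarrow> 'u point partn \<Rightarrow> 'a set" where
  "PD_ext R \<Lambda> \<Omega> x y = (\<lambda>\<Delta> \<in> refinements (\<Lambda> \<squnion>\<^sub>P \<Omega>).
     bar_ext R (left_part \<Delta>) (right_part \<Delta>) (x (left_part \<Delta>)) (y (right_part \<Delta>)))"

definition PD :: "('u, 'a) pfunctor \<Rightarrow> ('u, 'u point partn \<Rightarrow> 'a set) pfunctor" where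
  "PD R = \<lparr>
     obj = PD_obj R,
     res = PD_res R,
     tr = PD_tr R,
     unt = PD_unit R empty_partn (unt R),
     ext = PD_ext R\<rparr>"

text \<open>The map \<open>PD(\<phi>)\<close> induced by a morphism \<open>\<phi>\<close> of partition functors with values in \<open>R'\<close>.\<close>

definition PD_map ::
  "('u, 'a) pfunctor \<Rightarrow> ('u point partn \<Rightarrow> 'b \<Rightarrow> 'a) \<Rightarrow> 'u point partn \<Rightarrow>
   ('u point partn \<Rightarrow> 'b set) \<Rightarrow> 'u point partn \<Rightarrow> 'a set" where
  "PD_map R' \<phi> \<Lambda> x = (\<lambda>\<Gamma> \<in> refinements \<Lambda>. \<Union>a \<in> x \<Gamma>. bar_proj R' \<Gamma> (\<phi> \<Gamma> a))"

end

theory Submission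
  imports Defs
begin

text \<open>
  A map \<open>PD(R)(\<Lambda>) \<rightarrow> K\<close> compatible with the unit up to the factor \<open>|\<Sigma>\<^sub>\<Lambda>|\<close> is obtained by Moebius
  inversion over the lattice of refinements.  Define \<open>d\<^sub>\<Gamma> : R(\<Gamma>) \<rightarrow> K\<close> recursively by
  \<open>\<Sum>\<^bsub>\<Delta> \<le> \<Gamma>\<^esub> d\<^sub>\<Delta>(R\<^sup>*(\<Delta> \<le> \<Gamma>) a) = |\<Sigma>\<^sub>\<Gamma>| \<epsilon>\<^sub>\<Gamma>(a)\<close>.
  A double coset \<open>\<Sigma>\<^sub>\<Gamma> \<sigma> \<Sigma>\<^sub>\<Phi>\<close> with \<open>\<Gamma> \<le> \<sigma>\<Phi>\<close> is just the left coset \<open>\<sigma> \<Sigma>\<^sub>\<Phi>\<close>, so the double coset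
  formula and induction show that \<open>d\<^sub>\<Gamma>\<close> vanishes on all proper transfers and hence descends to
  \<open>R(\<Gamma>) / I\<^sub>\<Gamma>\<close>.  The map is \<open>x \<mapsto> \<Sum>\<^bsub>\<Gamma> \<le> \<Lambda>\<^esub> d\<^sub>\<Gamma>(x\<^sub>\<Gamma>)\<close>: compatibility with the unit is the
  defining equation of \<open>d\<close>, compatibility with transfers is the same count of cosets, and
  multiplicativity of \<open>d\<close> follows from the product decomposition of the refinements of
  \<open>\<Lambda> \<squnion> \<Omega>\<close> and of \<open>\<Sigma>\<^bsub>\<Lambda> \<squnion> \<Omega>\<^esub>\<close>.
\<close>

section \<open>Refinements and transported partitions\<close>

text \<open>The obvious candidate fails. As \<epsilon> commutes with transfers, it induces maps on
  the quotients R(\<Gamma>) / I_\<Gamma>; but transfers in the dual constant functor are identities,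
  so its quotients vanish except at discrete partitions. Only the component of x at the discrete
  refinement would survive, and on units this gives \<epsilon> of a restriction, which need not be
  |\<Sigma>_\<Lambda>| \<epsilon>_\<Lambda>: nothing relates \<epsilon> to restrictions. The maps
  d_\<Gamma> for nondiscrete \<Gamma> are the correction terms; they are zero whenever \<epsilon>
  does respect restrictions. If the map is to be a sum of functions of single components that do not
  depend on \<Lambda>, the unit equation forces their recursion. The factor |\<Sigma>_\<Gamma>| is
  also what makes d_\<Gamma> vanish on proper transfers. For \<Omega> < \<Gamma> one has
  |\<Sigma>_\<Gamma> / \<Sigma>_\<Omega>| |\<Sigma>_\<Omega>| = |\<Sigma>_\<Gamma>|, and \<epsilon>
  is unchanged by transfer, so at a transferred element the strict part of the recursion already
  exhausts the right-hand side.\<close>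

lemma is_partition_eqv:
  assumes "is_partition \<Lambda>"
  shows "eqv \<Lambda> \<subseteq> pts \<Lambda> \<times> pts \<Lambda>" "finite (eqv \<Lambda>)" "finite (pts \<Lambda>)"
proof -
  show 1: "eqv \<Lambda> \<subseteq> pts \<Lambda> \<times> pts \<Lambda>" and 2: "finite (pts \<Lambda>)"
    using assms by (auto simp: is_partition_def equiv_def refl_on_def)
  show "finite (eqv \<Lambda>)"
    using 1 2 finite_subset by blast
qed

lemma partition_refl: "is_partition \<Lambda> \<Longrightarrow> x \<in> pts \<Lambda> \<Longrightarrow> (x, x) \<in> eqv \<Lambda>"
  by (auto simp: is_partition_def equiv_def refl_on_def)

lemma partition_sym: "is_partition \<Lambda> \<Longrightarrow> (x, y) \<in> eqv \<Lambda> \<Longrightarrow> (y, x) \<in> eqv \<Lambda>"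
  by (auto simp: is_partition_def equiv_def dest: symD)

lemma partition_trans:
  "is_partition \<Lambda> \<Longrightarrow> (x, y) \<in> eqv \<Lambda> \<Longrightarrow> (y, z) \<in> eqv \<Lambda> \<Longrightarrow> (x, z) \<in> eqv \<Lambda>"
  unfolding is_partition_def equiv_def by (metis transD)

lemma is_partitionI:
  assumes "finite (pts \<Lambda>)" "eqv \<Lambda> \<subseteq> pts \<Lambda> \<times> pts \<Lambda>"
    and "\<And>x. x \<in> pts \<Lambda> \<Longrightarrow> (x, x) \<in> eqv \<Lambda>"
    and "\<And>x y. (x, y) \<in> eqv \<Lambda> \<Longrightarrow> (y, x) \<in> eqv \<Lambda>"
    and "\<And>x y z. (x, y) \<in> eqv \<Lambda> \<Longrightarrow> (y, z) \<in> eqv \<Lambda> \<Longrightarrow> (x, z) \<in> eqv \<Lambda>"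
  shows "is_partition \<Lambda>"
proof -
  have "refl_on (pts \<Lambda>) (eqv \<Lambda>)" "sym (eqv \<Lambda>)" "trans (eqv \<Lambda>)"
    using assms(3) assms(4) assms(5) unfolding refl_on_def sym_def trans_def by blast+
  then show ?thesis
    using assms(1,2) by (simp add: is_partition_def equiv_def)
qed

lemma refines_iff:
  "refines \<Gamma> \<Lambda> \<longleftrightarrow>
     is_partition \<Gamma> \<and> is_partition \<Lambda> \<and> pts \<Gamma> = pts \<Lambda> \<and> eqv \<Gamma> \<subseteq> eqv \<Lambda>"
  by (auto simp: refines_def morphism_def)

lemma refines_refl: "is_partition \<Lambda> \<Longrightarrow> refines \<Lambda> \<Lambda>"
  by (simp add: refines_iff)

lemma refines_trans: "refines \<Gamma> \<Lambda> \<Longrightarrow> refines \<Lambda> \<Omega> \<Longrightarrow> refines \<Gamma> \<Omega>"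
  by (auto simp: refines_iff)

lemma refines_morphism: "refines \<Gamma> \<Lambda> \<Longrightarrow> morphism \<Gamma> \<Lambda> id"
  by (simp add: refines_def)

text \<open>A refinement keeps the points, so it is determined by its relation, a subset of a finite
  one. A \<Lambda> that is not a partition has no refinements, which makes the statement
  unconditional.\<close>

lemma finite_refinements: "finite (refinements \<Lambda>)"
proof (cases "is_partition \<Lambda>")
  case True
  have "refinements \<Lambda> \<subseteq> Partn (pts \<Lambda>) ` Pow (eqv \<Lambda>)"
  proof
    fix \<Gamma> assume "\<Gamma> \<in> refinements \<Lambda>"
    then have "pts \<Gamma> = pts \<Lambda>" "eqv \<Gamma> \<in> Pow (eqv \<Lambda>)"
      by (auto simp: refinements_def refines_iff)
    then show "\<Gamma> \<in> Partn (pts \<Lambda>) ` Pow (eqv \<Lambda>)"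
      by (metis imageI partn.collapse)
  qed
  then show ?thesis
    using True finite_subset is_partition_eqv(2) by blast
next
  case False
  then have "refinements \<Lambda> = {}"
    by (auto simp: refinements_def refines_iff)
  then show ?thesis by simp
qed

text \<open>The number of related pairs is the measure behind both the induction over strict
  refinements and the termination of \<open>moebius_aug\<close>.\<close>

lemma strictly_refines_card:
  assumes "strictly_refines \<Gamma> \<Lambda>"
  shows "card (eqv \<Gamma>) < card (eqv \<Lambda>)"
proof -
  have "eqv \<Gamma> \<noteq> eqv \<Lambda>"
    using assms partn.expand unfolding strictly_refines_def refines_iff by metis
  then show ?thesis
    using assms psubset_card_mono[of "eqv \<Lambda>" "eqv \<Gamma>"] is_partition_eqv(2)
    by (auto simp: strictly_refines_def refines_iff)
qed

lemma strict_refinement_induct: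
  assumes "\<And>\<Gamma>. (\<And>\<Delta>. strictly_refines \<Delta> \<Gamma> \<Longrightarrow> P \<Delta>) \<Longrightarrow> P \<Gamma>"
  shows "P \<Gamma>"
  by (induction \<Gamma> rule: measure_induct_rule[where f = "\<lambda>\<Gamma>. card (eqv \<Gamma>)"])
    (use assms strictly_refines_card in blast)

lemma strictly_refines_imp: "strictly_refines \<Delta> \<Gamma> \<Longrightarrow> refines \<Delta> \<Gamma>"
  by (simp add: strictly_refines_def)

lemma refines_is_partition: "refines \<Delta> \<Gamma> \<Longrightarrow> is_partition \<Delta>" "refines \<Delta> \<Gamma> \<Longrightarrow> is_partition \<Gamma>"
  by (simp_all add: refines_iff)

lemma refinements_eq:
  "is_partition \<Lambda> \<Longrightarrow> refinements \<Lambda> = insert \<Lambda> {\<Gamma>. strictly_refines \<Gamma> \<Lambda>}"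
  by (auto simp: refinements_def strictly_refines_def refines_refl)

lemma finite_strict_refinements: "finite {\<Gamma>. strictly_refines \<Gamma> \<Lambda>}"
  by (rule finite_subset[OF _ finite_refinements[of \<Lambda>]])
    (auto simp: refinements_def strictly_refines_def)

section \<open>Transport of partitions along injective maps\<close>

lemma pts_transport [simp]: "pts (transport f \<Gamma>) = f ` pts \<Gamma>"
  and eqv_transport: "eqv (transport f \<Gamma>) = map_prod f f ` eqv \<Gamma>"
  by (simp_all add: transport_def)

lemma transport_transport: "transport g (transport f \<Gamma>) = transport (g \<circ> f) \<Gamma>"
  by (simp add: transport_def image_comp map_prod_compose)

text \<open>Bijections are represented by total functions; this is the rule that makes the values
  off the points irrelevant for transport.\<close>

lemma transport_cong:
  assumes "is_partition \<Gamma>" "\<And>x. x \<in> pts \<Gamma> \<Longrightarrow> f x = g x"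
  shows "transport f \<Gamma> = transport g \<Gamma>"
proof -
  have "map_prod f f p = map_prod g g p" if "p \<in> eqv \<Gamma>" for p
    using that is_partition_eqv(1)[OF assms(1)] assms(2) by (cases p) auto
  then show ?thesis
    using assms(2) by (auto simp: transport_def image_iff)
qed

lemma transport_id: "transport id \<Gamma> = \<Gamma>"
  by (simp add: transport_def map_prod.id)

lemma transport_inv_into:
  assumes "is_partition \<Gamma>" "pts \<Gamma> \<subseteq> A" "inj_on f A"
  shows "transport (inv_into A f) (transport f \<Gamma>) = \<Gamma>"
proof -
  have "transport (inv_into A f) (transport f \<Gamma>) = transport id \<Gamma>"
    unfolding transport_transport using assms by (intro transport_cong) auto
  then show ?thesis by (simp add: transport_id)
qed

lemma transport_transport_back:
  assumes "is_partition \<Gamma>" "pts \<Gamma> \<subseteq> f ` A"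
  shows "transport f (transport_back A f \<Gamma>) = \<Gamma>"
proof -
  have "transport f (transport_back A f \<Gamma>) = transport id \<Gamma>"
    unfolding transport_transport transport_back_def using assms
    by (intro transport_cong) (auto simp: f_inv_into_f)
  then show ?thesis by (simp add: transport_id)
qed

lemma is_partition_transport:
  assumes "is_partition \<Gamma>" "inj_on f (pts \<Gamma>)"
  shows "is_partition (transport f \<Gamma>)"
proof (rule is_partitionI)
  note P = is_partition_eqv(1)[OF assms(1)]
  show "finite (pts (transport f \<Gamma>))"
    using assms by (simp add: is_partition_eqv)
  show "eqv (transport f \<Gamma>) \<subseteq> pts (transport f \<Gamma>) \<times> pts (transport f \<Gamma>)"
    using P by (auto simp: eqv_transport)
  show "(x, x) \<in> eqv (transport f \<Gamma>)" if "x \<in> pts (transport f \<Gamma>)" for x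
    using that partition_refl[OF assms(1)] by (force simp: eqv_transport)
  show "(y, x) \<in> eqv (transport f \<Gamma>)" if "(x, y) \<in> eqv (transport f \<Gamma>)" for x y
    using that partition_sym[OF assms(1)] by (force simp: eqv_transport)
  show "(x, z) \<in> eqv (transport f \<Gamma>)"
    if xy: "(x, y) \<in> eqv (transport f \<Gamma>)" and yz: "(y, z) \<in> eqv (transport f \<Gamma>)" for x y z
  proof -
    obtain a b where a: "(a, b) \<in> eqv \<Gamma>" "x = f a" "y = f b"
      using xy by (auto simp: eqv_transport)
    obtain b' c where b: "(b', c) \<in> eqv \<Gamma>" "y = f b'" "z = f c"
      using yz by (auto simp: eqv_transport)
    have "b = b'"
      using a b P assms(2) by (metis inj_onD SigmaD1 SigmaD2 subsetD)
    then show ?thesis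
      using a b partition_trans[OF assms(1)] by (force simp: eqv_transport)
  qed
qed

lemma isomorphism_transport:
  assumes "is_partition \<Gamma>" "inj_on f (pts \<Gamma>)"
  shows "isomorphism \<Gamma> (transport f \<Gamma>) f"
proof -
  note P = is_partition_eqv(1)[OF assms(1)]
  have "morphism \<Gamma> (transport f \<Gamma>) f"
    using assms is_partition_transport[OF assms]
    by (auto simp: morphism_def bij_betw_def eqv_transport)
  moreover have "morphism (transport f \<Gamma>) \<Gamma> (inv_into (pts \<Gamma>) f)"
    unfolding morphism_def
  proof (intro conjI allI impI)
    show "bij_betw (inv_into (pts \<Gamma>) f) (pts (transport f \<Gamma>)) (pts \<Gamma>)"
      using assms(2) by (simp add: bij_betw_inv_into inj_on_imp_bij_betw)
    show "(inv_into (pts \<Gamma>) f x, inv_into (pts \<Gamma>) f y) \<in> eqv \<Gamma>"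
      if "(x, y) \<in> eqv (transport f \<Gamma>)" for x y
    proof -
      obtain a b where ab: "(a, b) \<in> eqv \<Gamma>" "x = f a" "y = f b"
        using \<open>(x, y) \<in> eqv (transport f \<Gamma>)\<close> by (auto simp: eqv_transport)
      moreover have "a \<in> pts \<Gamma>" "b \<in> pts \<Gamma>"
        using ab P by auto
      ultimately show ?thesis
        using assms(2) by simp
    qed
  qed (use assms is_partition_transport in auto)
  ultimately show ?thesis
    by (simp add: isomorphism_def)
qed

lemma morphism_inj_on: "morphism \<Lambda> \<Omega> f \<Longrightarrow> inj_on f (pts \<Lambda>)"
  by (auto simp: morphism_def bij_betw_def)

text \<open>A morphism factors as an isomorphism \<Lambda> \<rightarrow> f\<Lambda> followed by the
  refinement f\<Lambda> \<le> \<Omega>. The index of f is that of this refinement.\<close>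

lemma morphism_refines_transport:
  assumes "morphism \<Lambda> \<Omega> f"
  shows "refines (transport f \<Lambda>) \<Omega>"
  using assms is_partition_transport[of \<Lambda> f]
  by (auto simp: morphism_def refines_iff eqv_transport bij_betw_def)

text \<open>For a mere morphism only f\<Lambda> \<le> \<Omega> holds; that the inverse is a morphism
  too supplies the opposite inclusion of relations.\<close>

lemma isomorphism_imp_transport:
  assumes "isomorphism \<Lambda> \<Omega> f"
  shows "\<Omega> = transport f \<Lambda>"
proof -
  have m: "morphism \<Lambda> \<Omega> f" and m': "morphism \<Omega> \<Lambda> (inv_into (pts \<Lambda>) f)"
    using assms by (auto simp: isomorphism_def)
  have "eqv \<Omega> \<subseteq> eqv (transport f \<Lambda>)"
  proof (rule subrelI)
    fix x y assume xy: "(x, y) \<in> eqv \<Omega>"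
    then have "(inv_into (pts \<Lambda>) f x, inv_into (pts \<Lambda>) f y) \<in> eqv \<Lambda>"
      using m' by (auto simp: morphism_def)
    moreover have "x \<in> f ` pts \<Lambda>" "y \<in> f ` pts \<Lambda>"
      using xy m is_partition_eqv(1)[of \<Omega>] by (auto simp: morphism_def bij_betw_def)
    ultimately show "(x, y) \<in> eqv (transport f \<Lambda>)"
      unfolding eqv_transport by (metis f_inv_into_f map_prod_imageI)
  qed
  then show ?thesis
    using morphism_refines_transport[OF m] by (intro partn.expand) (auto simp: refines_iff)
qed

lemma isomorphism_inv:
  assumes "isomorphism \<Lambda> \<Omega> f"
  shows "isomorphism \<Omega> \<Lambda> (inv_into (pts \<Lambda>) f)"
proof -
  have m: "morphism \<Lambda> \<Omega> f"
    using assms by (simp add: isomorphism_def)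
  have "isomorphism \<Omega> (transport (inv_into (pts \<Lambda>) f) \<Omega>) (inv_into (pts \<Lambda>) f)"
    using assms by (intro isomorphism_transport)
      (auto simp: isomorphism_def morphism_inj_on morphism_def[of \<Omega>])
  moreover have "transport (inv_into (pts \<Lambda>) f) \<Omega> = \<Lambda>"
    using m unfolding isomorphism_imp_transport[OF assms]
    by (intro transport_inv_into) (auto simp: morphism_def bij_betw_def)
  ultimately show ?thesis by simp
qed

lemma refines_transport:
  assumes "refines \<Gamma> \<Lambda>" "inj_on f (pts \<Lambda>)"
  shows "refines (transport f \<Gamma>) (transport f \<Lambda>)"
  using assms is_partition_transport[of \<Gamma> f] is_partition_transport[of \<Lambda> f]
  by (auto simp: refines_iff eqv_transport image_mono)

text \<open>The reindexing behind the isomorphism invariance of d and behind the count of cosets in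
  \<open>finprod_double_cosets\<close>.\<close>

lemma bij_betw_refinements_transport:
  assumes "is_partition \<Psi>" "inj_on h (pts \<Psi>)"
  shows "bij_betw (transport h) (refinements \<Psi>) (refinements (transport h \<Psi>))"
proof (rule bij_betw_byWitness[where f' = "transport_back (pts \<Psi>) h"])
  show "\<forall>\<Gamma>\<in>refinements \<Psi>. transport_back (pts \<Psi>) h (transport h \<Gamma>) = \<Gamma>"
    using assms by (auto simp: refinements_def refines_iff transport_back_def transport_inv_into)
  show "\<forall>\<Gamma>\<in>refinements (transport h \<Psi>). transport h (transport_back (pts \<Psi>) h \<Gamma>) = \<Gamma>"
    by (auto simp: refinements_def refines_iff transport_transport_back)
  show "transport h ` refinements \<Psi> \<subseteq> refinements (transport h \<Psi>)"
    using assms by (auto simp: refinements_def refines_transport)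
  show "transport_back (pts \<Psi>) h ` refinements (transport h \<Psi>) \<subseteq> refinements \<Psi>"
  proof clarify
    fix \<Gamma> assume "\<Gamma> \<in> refinements (transport h \<Psi>)"
    then have "refines (transport (inv_into (pts \<Psi>) h) \<Gamma>)
        (transport (inv_into (pts \<Psi>) h) (transport h \<Psi>))"
      by (intro refines_transport) (auto simp: refinements_def inj_on_inv_into)
    then show "transport_back (pts \<Psi>) h \<Gamma> \<in> refinements \<Psi>"
      using assms by (simp add: refinements_def transport_back_def transport_inv_into)
  qed
qed

section \<open>Common refinements\<close>

lemma is_partition_common_refinement:
  assumes "is_partition \<Lambda>" "is_partition \<Gamma>"
  shows "is_partition (common_refinement \<Lambda> \<Gamma>)"
proof (rule is_partitionI)
  show "finite (pts (common_refinement \<Lambda> \<Gamma>))"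
    "eqv (common_refinement \<Lambda> \<Gamma>) \<subseteq> pts (common_refinement \<Lambda> \<Gamma>) \<times> pts (common_refinement \<Lambda> \<Gamma>)"
    using is_partition_eqv[OF assms(1)] is_partition_eqv[OF assms(2)]
    by (auto simp: common_refinement_def)
  show "(x, x) \<in> eqv (common_refinement \<Lambda> \<Gamma>)"
    if "x \<in> pts (common_refinement \<Lambda> \<Gamma>)" for x
    using that assms by (simp add: common_refinement_def partition_refl)
  show "(y, x) \<in> eqv (common_refinement \<Lambda> \<Gamma>)"
    if "(x, y) \<in> eqv (common_refinement \<Lambda> \<Gamma>)" for x y
    using that partition_sym[OF assms(1)] partition_sym[OF assms(2)]
    by (simp add: common_refinement_def)
  show "(x, z) \<in> eqv (common_refinement \<Lambda> \<Gamma>)"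
    if "(x, y) \<in> eqv (common_refinement \<Lambda> \<Gamma>)" "(y, z) \<in> eqv (common_refinement \<Lambda> \<Gamma>)"
    for x y z
    using that partition_trans[OF assms(1), of x y z] partition_trans[OF assms(2), of x y z]
    by (simp add: common_refinement_def)
qed

lemma refines_common_refinement:
  assumes "is_partition \<Lambda>" "is_partition \<Gamma>" "pts \<Lambda> = pts \<Gamma>"
  shows "refines (common_refinement \<Lambda> \<Gamma>) \<Lambda>" "refines (common_refinement \<Lambda> \<Gamma>) \<Gamma>"
  using assms is_partition_common_refinement[OF assms(1,2)]
  by (auto simp: refines_iff common_refinement_def)

text \<open>With its converse \<open>common_refinement_eq_imp\<close>, this sorts the terms of the
  double coset formula: the outer transfer along \<Gamma> \<inter> \<sigma>\<Lambda> \<le> \<Gamma>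
  is the identity if \<Gamma> \<le> \<sigma>\<Lambda>, and a proper transfer otherwise.\<close>

lemma common_refinement_absorb:
  assumes "refines \<Gamma> \<Lambda>"
  shows "common_refinement \<Gamma> \<Lambda> = \<Gamma>"
  using assms by (intro partn.expand) (auto simp: refines_iff common_refinement_def)

lemma common_refinement_eq_imp:
  assumes "is_partition \<Lambda>" "is_partition \<Gamma>" "pts \<Lambda> = pts \<Gamma>" "common_refinement \<Lambda> \<Gamma> = \<Lambda>"
  shows "refines \<Lambda> \<Gamma>"
  using refines_common_refinement(2)[OF assms(1-3)] assms(4) by simp

text \<open>Images commute with intersections because f is injective. Applied to \<sigma>^-1
  \<Delta> and \<Omega>, this relates the two common refinements that occur in the double coset
  formula.\<close>

lemma transport_common_refinement:
  assumes "is_partition \<Lambda>" "is_partition \<Gamma>" "pts \<Lambda> = pts \<Gamma>" "inj_on f (pts \<Lambda>)"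
  shows "transport f (common_refinement \<Lambda> \<Gamma>) =
    common_refinement (transport f \<Lambda>) (transport f \<Gamma>)"
proof -
  have inj: "inj_on (map_prod f f) (pts \<Lambda> \<times> pts \<Lambda>)"
    using assms(4) by (auto simp: inj_on_def)
  have "eqv \<Lambda> \<subseteq> pts \<Lambda> \<times> pts \<Lambda>" "eqv \<Gamma> \<subseteq> pts \<Lambda> \<times> pts \<Lambda>"
    using assms is_partition_eqv(1) by metis+
  then show ?thesis
    using assms inj_on_image_Int[OF inj, of "eqv \<Lambda>" "eqv \<Gamma>"]
    by (simp add: common_refinement_def transport_def)
qed

abbreviation inv' :: "('a \<Rightarrow> 'b) \<Rightarrow> 'b \<Rightarrow> 'a" where
  "inv' f \<equiv> inv_into UNIV f"

section \<open>Block-preserving permutations and their cosets\<close>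

lemma block_perms_permutes: "\<sigma> \<in> block_perms \<Lambda> \<Longrightarrow> \<sigma> permutes pts \<Lambda>"
  by (simp add: block_perms_def)

lemma block_perms_eqv: "\<sigma> \<in> block_perms \<Lambda> \<Longrightarrow> x \<in> pts \<Lambda> \<Longrightarrow> (\<sigma> x, x) \<in> eqv \<Lambda>"
  by (simp add: block_perms_def)

lemma finite_block_perms: "is_partition \<Lambda> \<Longrightarrow> finite (block_perms \<Lambda>)"
  unfolding block_perms_def is_partition_def
  by (auto intro: finite_subset[OF _ finite_permutations])

lemma id_in_block_perms: "is_partition \<Lambda> \<Longrightarrow> id \<in> block_perms \<Lambda>"
  by (simp add: block_perms_def partition_refl)

lemma block_perms_comp:
  assumes "is_partition \<Lambda>" "\<sigma> \<in> block_perms \<Lambda>" "\<tau> \<in> block_perms \<Lambda>"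
  shows "\<sigma> \<circ> \<tau> \<in> block_perms \<Lambda>"
proof -
  have "(\<sigma> (\<tau> x), x) \<in> eqv \<Lambda>" if "x \<in> pts \<Lambda>" for x
    using that assms block_perms_eqv partition_trans[OF assms(1)]
    by (metis block_perms_permutes permutes_in_image)
  then show ?thesis
    using assms by (simp add: block_perms_def permutes_compose)
qed

lemma block_perms_inv:
  assumes "is_partition \<Lambda>" "\<sigma> \<in> block_perms \<Lambda>"
  shows "inv' \<sigma> \<in> block_perms \<Lambda>"
proof -
  have "(inv' \<sigma> x, x) \<in> eqv \<Lambda>" if "x \<in> pts \<Lambda>" for x
  proof -
    have "inv' \<sigma> x \<in> pts \<Lambda>"
      using that assms(2) by (metis block_perms_permutes permutes_in_image permutes_inv)
    then have "(\<sigma> (inv' \<sigma> x), inv' \<sigma> x) \<in> eqv \<Lambda>"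
      by (rule block_perms_eqv[OF assms(2)])
    then show ?thesis
      using assms partition_sym by (metis block_perms_permutes permutes_inverses(1))
  qed
  then show ?thesis
    using assms by (simp add: block_perms_def permutes_inv)
qed

lemma block_perms_mono: "refines \<Gamma> \<Lambda> \<Longrightarrow> block_perms \<Gamma> \<subseteq> block_perms \<Lambda>"
  by (auto simp: refines_iff block_perms_def)

lemma block_perms_inj_on: "\<sigma> \<in> block_perms \<Lambda> \<Longrightarrow> inj_on \<sigma> A"
  using block_perms_permutes permutes_inj_on by blast

lemma block_perms_morphism:
  assumes "is_partition \<Lambda>" "\<sigma> \<in> block_perms \<Lambda>"
  shows "morphism \<Lambda> \<Lambda> \<sigma>"
proof -
  have "(\<sigma> x, \<sigma> y) \<in> eqv \<Lambda>" if "(x, y) \<in> eqv \<Lambda>" for x y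
  proof -
    have "x \<in> pts \<Lambda>" "y \<in> pts \<Lambda>"
      using that is_partition_eqv(1)[OF assms(1)] by auto
    then have "(\<sigma> x, x) \<in> eqv \<Lambda>" "(y, \<sigma> y) \<in> eqv \<Lambda>"
      using block_perms_eqv[OF assms(2)] partition_sym[OF assms(1)] by auto
    then show ?thesis
      using that partition_trans[OF assms(1)] by blast
  qed
  then show ?thesis
    using assms permutes_imp_bij[OF block_perms_permutes[OF assms(2)]] by (simp add: morphism_def)
qed

lemma block_perms_transport_refines:
  assumes "refines \<Phi> \<Lambda>" "\<sigma> \<in> block_perms \<Lambda>"
  shows "refines (transport \<sigma> \<Phi>) \<Lambda>"
proof -
  have "refines (transport \<sigma> \<Lambda>) \<Lambda>"
    using assms by (intro morphism_refines_transport block_perms_morphism) (simp_all add: refines_iff)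
  then show ?thesis
    using assms refines_transport[OF assms(1)] block_perms_inj_on refines_trans by metis
qed

text \<open>\<Gamma> \<le> \<sigma>\<Phi> says that every block of \<Gamma> lies in the
  \<sigma>-image of a block of \<Phi>. Hence \<Sigma>_\<Gamma> is contained in \<sigma>
  \<Sigma>_\<Phi> \<sigma>^-1.\<close>

lemma block_perms_conj:
  assumes "refines \<Gamma> (transport \<sigma> \<Phi>)" "\<sigma> permutes pts \<Phi>" "is_partition \<Phi>" "\<rho> \<in> block_perms \<Gamma>"
  shows "inv' \<sigma> \<circ> \<rho> \<circ> \<sigma> \<in> block_perms \<Phi>"
proof -
  have P: "pts \<Gamma> = pts \<Phi>" "eqv \<Gamma> \<subseteq> map_prod \<sigma> \<sigma> ` eqv \<Phi>"
    using assms(1,2) by (auto simp: refines_iff eqv_transport permutes_image)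
  have "(inv' \<sigma> (\<rho> (\<sigma> x)), x) \<in> eqv \<Phi>" if "x \<in> pts \<Phi>" for x
  proof -
    have "(\<rho> (\<sigma> x), \<sigma> x) \<in> eqv \<Gamma>"
      using that assms P by (intro block_perms_eqv) (auto simp: permutes_in_image)
    then obtain a b where ab: "(a, b) \<in> eqv \<Phi>" "\<rho> (\<sigma> x) = \<sigma> a" "\<sigma> x = \<sigma> b"
      using P by auto
    then show ?thesis
      using assms(2) by (metis permutes_inverses(2))
  qed
  then show ?thesis
    using assms P block_perms_permutes[OF assms(4)]
    by (simp add: block_perms_def permutes_compose permutes_inv)
qed

text \<open>Conjugation by f embeds one group into the other; the conjugate is the identity off the
  points of \<Omega>, since permutations are total functions. Applied to f and to its inverse, the
  inequality becomes the equality used in \<open>moebius_tr_iso\<close>.\<close>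

lemma card_block_perms_isomorphism_le:
  assumes f: "isomorphism \<Lambda> \<Omega> f"
  shows "card (block_perms \<Lambda>) \<le> card (block_perms \<Omega>)"
proof (rule card_inj_on_le)
  have m: "morphism \<Lambda> \<Omega> f" and P: "is_partition \<Lambda>" "is_partition \<Omega>" and b: "bij_betw f (pts \<Lambda>) (pts \<Omega>)"
    using f by (auto simp: isomorphism_def morphism_def)
  let ?c = "\<lambda>\<sigma> x. if x \<in> pts \<Omega> then f (\<sigma> (inv_into (pts \<Lambda>) f x)) else x"
  have c: "bij_betw ?c {\<sigma>. \<sigma> permutes pts \<Lambda>} {\<sigma>. \<sigma> permutes pts \<Omega>}"
    using bij_betw_permutations[OF b] .
  show "inj_on ?c (block_perms \<Lambda>)"
    using c by (auto simp: bij_betw_def block_perms_def intro: inj_on_subset)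
  show "?c ` block_perms \<Lambda> \<subseteq> block_perms \<Omega>"
  proof clarify
    fix \<sigma> assume \<sigma>: "\<sigma> \<in> block_perms \<Lambda>"
    have "?c \<sigma> permutes pts \<Omega>"
      using bij_betwE[OF c] \<sigma> by (auto simp: block_perms_def)
    moreover have "(?c \<sigma> x, x) \<in> eqv \<Omega>" if x: "x \<in> pts \<Omega>" for x
    proof -
      obtain y where y: "y \<in> pts \<Lambda>" "x = f y"
        using x b by (auto simp: bij_betw_def)
      have "(f (\<sigma> y), f y) \<in> eqv \<Omega>"
        using m block_perms_eqv[OF \<sigma> y(1)] by (auto simp: morphism_def)
      then show ?thesis
        using x y b by (simp add: bij_betw_def)
    qed
    ultimately show "?c \<sigma> \<in> block_perms \<Omega>"
      by (simp add: block_perms_def)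
  qed
  show "finite (block_perms \<Omega>)"
    using P(2) by (rule finite_block_perms)
qed

section \<open>Single cosets and double cosets, and their representatives\<close>

definition perm_coset :: "'x partn \<Rightarrow> ('x \<Rightarrow> 'x) \<Rightarrow> ('x \<Rightarrow> 'x) set" where
  "perm_coset \<Phi> \<sigma> = {\<sigma> \<circ> \<tau> | \<tau>. \<tau> \<in> block_perms \<Phi>}"

definition perm_double_coset ::
  "'x partn \<Rightarrow> 'x partn \<Rightarrow> ('x \<Rightarrow> 'x) \<Rightarrow> ('x \<Rightarrow> 'x) set" where
  "perm_double_coset \<Gamma> \<Phi> \<sigma> =
     {\<rho> \<circ> \<sigma> \<circ> \<tau> | \<rho> \<tau>. \<rho> \<in> block_perms \<Gamma> \<and> \<tau> \<in> block_perms \<Phi>}"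

lemma perm_cosets_eq: "perm_cosets \<Lambda> \<Phi> = perm_coset \<Phi> ` block_perms \<Lambda>"
  by (simp add: perm_cosets_def perm_coset_def)

lemma double_cosets_eq: "double_cosets \<Gamma> \<Lambda> \<Phi> = perm_double_coset \<Gamma> \<Phi> ` block_perms \<Lambda>"
  by (simp add: double_cosets_def perm_double_coset_def)

lemma perm_coset_self: "is_partition \<Phi> \<Longrightarrow> \<sigma> \<in> perm_coset \<Phi> \<sigma>"
  unfolding perm_coset_def by (rule CollectI, rule exI[of _ id]) (simp add: id_in_block_perms)

lemma perm_coset_eq:
  assumes "is_partition \<Phi>" "\<rho> \<in> perm_coset \<Phi> \<sigma>"
  shows "perm_coset \<Phi> \<rho> = perm_coset \<Phi> \<sigma>"
proof -
  obtain \<tau> where \<tau>: "\<tau> \<in> block_perms \<Phi>" "\<rho> = \<sigma> \<circ> \<tau>"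
    using assms by (auto simp: perm_coset_def)
  have "\<sigma> \<circ> \<tau>' = \<rho> \<circ> (inv' \<tau> \<circ> \<tau>')" for \<tau>'
    using permutes_inverses(1)[OF block_perms_permutes[OF \<tau>(1)]] \<tau>(2) by (simp add: fun_eq_iff)
  then have "perm_coset \<Phi> \<sigma> \<subseteq> perm_coset \<Phi> \<rho>"
    using block_perms_comp[OF assms(1)] block_perms_inv[OF assms(1) \<tau>(1)]
    unfolding perm_coset_def by blast
  moreover have "\<rho> \<circ> \<tau>' = \<sigma> \<circ> (\<tau> \<circ> \<tau>')" for \<tau>'
    by (simp add: \<tau>(2) comp_assoc)
  then have "perm_coset \<Phi> \<rho> \<subseteq> perm_coset \<Phi> \<sigma>"
    using block_perms_comp[OF assms(1) \<tau>(1)] unfolding perm_coset_def by blast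
  ultimately show ?thesis by blast
qed

lemma perm_double_coset_self:
  "is_partition \<Gamma> \<Longrightarrow> is_partition \<Phi> \<Longrightarrow> \<sigma> \<in> perm_double_coset \<Gamma> \<Phi> \<sigma>"
  unfolding perm_double_coset_def
  by (rule CollectI, rule exI[of _ id], rule exI[of _ id]) (simp add: id_in_block_perms)

lemma perm_double_coset_eq:
  assumes "is_partition \<Gamma>" "is_partition \<Phi>" "\<sigma>' \<in> perm_double_coset \<Gamma> \<Phi> \<sigma>"
  shows "perm_double_coset \<Gamma> \<Phi> \<sigma>' = perm_double_coset \<Gamma> \<Phi> \<sigma>"
proof -
  obtain \<rho> \<tau> where \<rho>: "\<rho> \<in> block_perms \<Gamma>" and \<tau>: "\<tau> \<in> block_perms \<Phi>" and eq: "\<sigma>' = \<rho> \<circ> \<sigma> \<circ> \<tau>"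
    using assms by (auto simp: perm_double_coset_def)
  have "\<rho>' \<circ> \<sigma> \<circ> \<tau>' = (\<rho>' \<circ> inv' \<rho>) \<circ> \<sigma>' \<circ> (inv' \<tau> \<circ> \<tau>')" for \<rho>' \<tau>'
    using permutes_inverses[OF block_perms_permutes[OF \<rho>]]
      permutes_inverses[OF block_perms_permutes[OF \<tau>]] eq by (simp add: fun_eq_iff)
  then have "perm_double_coset \<Gamma> \<Phi> \<sigma> \<subseteq> perm_double_coset \<Gamma> \<Phi> \<sigma>'"
    using block_perms_comp[OF assms(2)] block_perms_inv[OF assms(2) \<tau>]
      block_perms_comp[OF assms(1)] block_perms_inv[OF assms(1) \<rho>]
    unfolding perm_double_coset_def by blast
  moreover have "\<rho>' \<circ> \<sigma>' \<circ> \<tau>' = (\<rho>' \<circ> \<rho>) \<circ> \<sigma> \<circ> (\<tau> \<circ> \<tau>')" for \<rho>' \<tau>'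
    by (simp add: eq comp_assoc)
  then have "perm_double_coset \<Gamma> \<Phi> \<sigma>' \<subseteq> perm_double_coset \<Gamma> \<Phi> \<sigma>"
    using block_perms_comp[OF assms(1) _ \<rho>] block_perms_comp[OF assms(2) \<tau>]
    unfolding perm_double_coset_def by blast
  ultimately show ?thesis by blast
qed

text \<open>The left factor moves across \<sigma>: \<rho>\<sigma>\<tau> = \<sigma> (\<sigma>^-1
  \<rho> \<sigma>) \<tau>, and the conjugate lies in \<Sigma>_\<Phi> by
  \<open>block_perms_conj\<close>.\<close>

lemma perm_double_coset_eq_perm_coset:
  assumes "refines \<Gamma> (transport \<sigma> \<Phi>)" "\<sigma> permutes pts \<Phi>" "is_partition \<Phi>"
  shows "perm_double_coset \<Gamma> \<Phi> \<sigma> = perm_coset \<Phi> \<sigma>"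
proof
  show "perm_coset \<Phi> \<sigma> \<subseteq> perm_double_coset \<Gamma> \<Phi> \<sigma>"
  proof
    fix x assume "x \<in> perm_coset \<Phi> \<sigma>"
    then obtain \<tau> where "\<tau> \<in> block_perms \<Phi>" "x = id \<circ> \<sigma> \<circ> \<tau>"
      by (auto simp: perm_coset_def)
    then show "x \<in> perm_double_coset \<Gamma> \<Phi> \<sigma>"
      using id_in_block_perms[of \<Gamma>] assms(1)
      unfolding perm_double_coset_def refines_iff by blast
  qed
  show "perm_double_coset \<Gamma> \<Phi> \<sigma> \<subseteq> perm_coset \<Phi> \<sigma>"
  proof
    fix x assume "x \<in> perm_double_coset \<Gamma> \<Phi> \<sigma>"
    then obtain \<rho> \<tau> where *: "\<rho> \<in> block_perms \<Gamma>" "\<tau> \<in> block_perms \<Phi>" "x = \<rho> \<circ> \<sigma> \<circ> \<tau>"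
      by (auto simp: perm_double_coset_def)
    have "x = \<sigma> \<circ> ((inv' \<sigma> \<circ> \<rho> \<circ> \<sigma>) \<circ> \<tau>)"
      using *(3) permutes_inverses(1)[OF assms(2)] by (simp add: fun_eq_iff)
    then show "x \<in> perm_coset \<Phi> \<sigma>"
      using block_perms_comp[OF assms(3) block_perms_conj[OF assms *(1)] *(2)]
      unfolding perm_coset_def by blast
  qed
qed

lemma representative_in: "\<sigma> \<in> D \<Longrightarrow> representative D \<in> D"
  unfolding representative_def by (rule someI[of "\<lambda>\<sigma>. \<sigma> \<in> D"])

lemma perm_coset_subset:
  "refines \<Phi> \<Lambda> \<Longrightarrow> \<sigma> \<in> block_perms \<Lambda> \<Longrightarrow> perm_coset \<Phi> \<sigma> \<subseteq> block_perms \<Lambda>"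
  using block_perms_comp[of \<Lambda>] block_perms_mono[of \<Phi> \<Lambda>]
  by (auto simp: perm_coset_def refines_iff)

lemma perm_double_coset_subset:
  assumes "refines \<Gamma> \<Lambda>" "refines \<Phi> \<Lambda>" "\<sigma> \<in> block_perms \<Lambda>"
  shows "perm_double_coset \<Gamma> \<Phi> \<sigma> \<subseteq> block_perms \<Lambda>"
proof -
  have "is_partition \<Lambda>" using assms by (simp add: refines_iff)
  then show ?thesis
    using assms block_perms_comp[of \<Lambda>] block_perms_mono[of \<Phi> \<Lambda>] block_perms_mono[of \<Gamma> \<Lambda>]
    unfolding perm_double_coset_def by blast
qed

text \<open>Choice guarantees only membership in C. Since cosets with a common element coincide,
  this is enough to recover C from its representative.\<close>

lemma representative_perm_cosets:
  assumes "refines \<Phi> \<Lambda>" "C \<in> perm_cosets \<Lambda> \<Phi>"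
  shows "representative C \<in> block_perms \<Lambda>" "perm_coset \<Phi> (representative C) = C"
proof -
  obtain \<sigma> where \<sigma>: "\<sigma> \<in> block_perms \<Lambda>" "C = perm_coset \<Phi> \<sigma>"
    using assms by (auto simp: perm_cosets_eq)
  have \<Phi>: "is_partition \<Phi>" using assms by (simp add: refines_iff)
  have r: "representative C \<in> perm_coset \<Phi> \<sigma>"
    using representative_in perm_coset_self[OF \<Phi>] \<sigma>(2) by metis
  then show "representative C \<in> block_perms \<Lambda>"
    using perm_coset_subset[OF assms(1) \<sigma>(1)] by blast
  show "perm_coset \<Phi> (representative C) = C"
    using perm_coset_eq[OF \<Phi> r] \<sigma>(2) by simp
qed

lemma representative_double_cosets:
  assumes "refines \<Gamma> \<Lambda>" "refines \<Phi> \<Lambda>" "D \<in> double_cosets \<Gamma> \<Lambda> \<Phi>"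
  shows "representative D \<in> block_perms \<Lambda>" "perm_double_coset \<Gamma> \<Phi> (representative D) = D"
proof -
  obtain \<sigma> where \<sigma>: "\<sigma> \<in> block_perms \<Lambda>" "D = perm_double_coset \<Gamma> \<Phi> \<sigma>"
    using assms by (auto simp: double_cosets_eq)
  have P: "is_partition \<Phi>" "is_partition \<Gamma>" using assms by (simp_all add: refines_iff)
  have r: "representative D \<in> perm_double_coset \<Gamma> \<Phi> \<sigma>"
    using representative_in perm_double_coset_self[OF P(2,1)] \<sigma>(2) by metis
  then show "representative D \<in> block_perms \<Lambda>"
    using perm_double_coset_subset[OF assms(1,2) \<sigma>(1)] by blast
  show "perm_double_coset \<Gamma> \<Phi> (representative D) = D"
    using perm_double_coset_eq[OF P(2,1) r] \<sigma>(2) by simp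
qed

text \<open>An equality of sets of classes, not just a bijection: \<open>representative\<close> then
  picks the same permutation on both sides, so sums over the two index sets agree term by
  term.\<close>

lemma double_cosets_refining_eq_perm_cosets:
  assumes "refines \<Gamma> \<Lambda>" "refines \<Phi> \<Lambda>"
  shows "{D \<in> double_cosets \<Gamma> \<Lambda> \<Phi>. refines \<Gamma> (transport (representative D) \<Phi>)} =
    {C \<in> perm_cosets \<Lambda> \<Phi>. refines \<Gamma> (transport (representative C) \<Phi>)}"
proof -
  have \<Phi>: "is_partition \<Phi>" "pts \<Phi> = pts \<Lambda>" using assms by (simp_all add: refines_iff)
  have eq: "perm_double_coset \<Gamma> \<Phi> \<sigma> = perm_coset \<Phi> \<sigma>"
    if "refines \<Gamma> (transport \<sigma> \<Phi>)" "\<sigma> \<in> block_perms \<Lambda>" for \<sigma>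
    using perm_double_coset_eq_perm_coset[OF that(1) _ \<Phi>(1)] block_perms_permutes[OF that(2)] \<Phi>(2)
    by simp
  show ?thesis
    using eq representative_perm_cosets[OF assms(2)] representative_double_cosets[OF assms]
    unfolding perm_cosets_eq double_cosets_eq by (auto simp del: image_iff) (metis imageI)+
qed

lemma finite_perm_cosets: "is_partition \<Lambda> \<Longrightarrow> finite (perm_cosets \<Lambda> \<Phi>)"
  by (simp add: perm_cosets_def finite_block_perms)

lemma finite_double_cosets: "is_partition \<Lambda> \<Longrightarrow> finite (double_cosets \<Gamma> \<Lambda> \<Phi>)"
  by (simp add: double_cosets_def finite_block_perms)

text \<open>Lagrange: distinct cosets are disjoint, and composing with the injective \<sigma> on the
  left maps \<Sigma>_\<Phi> bijectively onto its coset. This turns an index times |\<Sigma>_\<Phi>|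
  into |\<Sigma>_\<Lambda>|.\<close>

lemma card_perm_cosets:
  assumes "refines \<Phi> \<Lambda>"
  shows "card (block_perms \<Phi>) * card (perm_cosets \<Lambda> \<Phi>) = card (block_perms \<Lambda>)"
proof -
  have P: "is_partition \<Phi>" "is_partition \<Lambda>" using assms by (simp_all add: refines_iff)
  have U: "\<Union> (perm_cosets \<Lambda> \<Phi>) = block_perms \<Lambda>"
    using perm_coset_self[OF P(1)] perm_coset_subset[OF assms] by (auto simp: perm_cosets_eq)
  have "card (block_perms \<Phi>) * card (perm_cosets \<Lambda> \<Phi>) = card (\<Union> (perm_cosets \<Lambda> \<Phi>))"
  proof (rule card_partition)
    show "finite (perm_cosets \<Lambda> \<Phi>)" "finite (\<Union> (perm_cosets \<Lambda> \<Phi>))"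
      using P by (simp_all add: finite_perm_cosets U finite_block_perms)
    show "card c = card (block_perms \<Phi>)" if c: "c \<in> perm_cosets \<Lambda> \<Phi>" for c
    proof -
      obtain \<sigma> where \<sigma>: "\<sigma> \<in> block_perms \<Lambda>" "c = perm_coset \<Phi> \<sigma>"
        using c by (auto simp: perm_cosets_eq)
      have "inj \<sigma>" using \<sigma>(1) block_perms_permutes permutes_inj by blast
      then have "inj_on (\<lambda>\<tau>. \<sigma> \<circ> \<tau>) (block_perms \<Phi>)"
        by (auto simp: inj_on_def inj_def fun_eq_iff)
      moreover have "c = (\<lambda>\<tau>. \<sigma> \<circ> \<tau>) ` block_perms \<Phi>"
        by (auto simp: \<sigma>(2) perm_coset_def)
      ultimately show ?thesis by (simp add: card_image)
    qed
    show "c \<inter> c' = {}" if "c \<in> perm_cosets \<Lambda> \<Phi>" "c' \<in> perm_cosets \<Lambda> \<Phi>" "c \<noteq> c'" for c c'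
    proof -
      obtain \<sigma> \<sigma>' where "c = perm_coset \<Phi> \<sigma>" "c' = perm_coset \<Phi> \<sigma>'"
        using \<open>c \<in> perm_cosets \<Lambda> \<Phi>\<close> \<open>c' \<in> perm_cosets \<Lambda> \<Phi>\<close> by (auto simp: perm_cosets_eq)
      then show ?thesis
        using \<open>c \<noteq> c'\<close> perm_coset_eq[OF P(1)] by blast
    qed
  qed
  then show ?thesis by (simp add: U)
qed

section \<open>Finite sums over double cosets\<close>

context comm_monoid
begin

lemma finprod_swap:
  assumes "finite A" "finite B" "\<And>a b. a \<in> A \<Longrightarrow> b \<in> B \<Longrightarrow> f a b \<in> carrier G"
  shows "(\<Otimes>a\<in>A. \<Otimes>b\<in>B. f a b) = (\<Otimes>b\<in>B. \<Otimes>a\<in>A. f a b)"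
  using assms(1,3)
proof (induction A rule: finite_induct)
  case empty
  then show ?case by simp
next
  case (insert x F)
  have "(\<Otimes>a\<in>insert x F. \<Otimes>b\<in>B. f a b) = (\<Otimes>b\<in>B. f x b) \<otimes> (\<Otimes>b\<in>B. \<Otimes>a\<in>F. f a b)"
    using insert by (subst finprod_insert) (auto simp: Pi_iff intro!: finprod_closed)
  also have "\<dots> = (\<Otimes>b\<in>B. f x b \<otimes> (\<Otimes>a\<in>F. f a b))"
    using insert.prems by (intro finprod_multf[symmetric]) (auto intro!: finprod_closed)
  also have "\<dots> = (\<Otimes>b\<in>B. \<Otimes>a\<in>insert x F. f a b)"
    by (rule finprod_cong'[OF refl]) (use insert in \<open>auto simp: Pi_iff intro!: finprod_closed\<close>)
  finally show ?case .
qed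

lemma finprod_filter:
  assumes "finite A" "\<And>a. a \<in> A \<Longrightarrow> P a \<Longrightarrow> f a \<in> carrier G"
  shows "(\<Otimes>a\<in>{a \<in> A. P a}. f a) = (\<Otimes>a\<in>A. if P a then f a else \<one>)"
  using assms by (intro finprod_mono_neutral_cong_left) auto

text \<open>The range of the inner index depends on the outer one. Padding with \<one> makes the
  index set a rectangle, on which the sums can be exchanged.\<close>

lemma finprod_swap_filter:
  assumes "finite A" "finite B"
    and "\<And>a b. a \<in> A \<Longrightarrow> b \<in> B \<Longrightarrow> P a b \<Longrightarrow> f a b \<in> carrier G"
  shows "(\<Otimes>a\<in>A. \<Otimes>b\<in>{b \<in> B. P a b}. f a b) = (\<Otimes>b\<in>B. \<Otimes>a\<in>{a \<in> A. P a b}. f a b)"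
proof -
  have "(\<Otimes>a\<in>A. \<Otimes>b\<in>{b \<in> B. P a b}. f a b) = (\<Otimes>a\<in>A. \<Otimes>b\<in>B. if P a b then f a b else \<one>)"
    by (rule finprod_cong'[OF refl]) (use assms finprod_filter[OF assms(2)] in \<open>auto intro!: finprod_closed\<close>)
  also have "\<dots> = (\<Otimes>b\<in>B. \<Otimes>a\<in>A. if P a b then f a b else \<one>)"
    using assms by (intro finprod_swap) auto
  also have "\<dots> = (\<Otimes>b\<in>B. \<Otimes>a\<in>{a \<in> A. P a b}. f a b)"
    by (rule finprod_cong'[OF refl]) (use assms finprod_filter[OF assms(1)] in \<open>auto intro!: finprod_closed\<close>)
  finally show ?thesis .
qed

lemma finprod_bij_betw:
  assumes "bij_betw h A B" "f \<in> B \<rightarrow> carrier G"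
  shows "(\<Otimes>a\<in>A. f (h a)) = (\<Otimes>b\<in>B. f b)"
  using finprod_reindex[of f h A] assms by (auto simp: bij_betw_def)

lemma finprod_cartesian_product:
  assumes "finite A" "finite B" "\<And>a b. a \<in> A \<Longrightarrow> b \<in> B \<Longrightarrow> f (a, b) \<in> carrier G"
  shows "(\<Otimes>a\<in>A. \<Otimes>b\<in>B. f (a, b)) = (\<Otimes>p\<in>A \<times> B. f p)"
  using assms(1,3)
proof (induction A rule: finite_induct)
  case empty
  then show ?case by simp
next
  case (insert x F)
  have "(\<Otimes>b\<in>B. f (x, b)) = (\<Otimes>p\<in>{x} \<times> B. f p)"
  proof -
    have "bij_betw (Pair x) B ({x} \<times> B)"
      by (auto simp: bij_betw_def inj_on_def)
    then show ?thesis
      by (rule finprod_bij_betw) (use insert.prems in auto)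
  qed
  moreover have "(\<Otimes>a\<in>F. \<Otimes>b\<in>B. f (a, b)) = (\<Otimes>p\<in>F \<times> B. f p)"
    using insert by blast
  moreover have "(\<Otimes>a\<in>insert x F. \<Otimes>b\<in>B. f (a, b)) = (\<Otimes>b\<in>B. f (x, b)) \<otimes> (\<Otimes>a\<in>F. \<Otimes>b\<in>B. f (a, b))"
    using insert by (intro finprod_insert) (auto intro!: finprod_closed)
  moreover have "(\<Otimes>p\<in>{x} \<times> B \<union> F \<times> B. f p) = (\<Otimes>p\<in>{x} \<times> B. f p) \<otimes> (\<Otimes>p\<in>F \<times> B. f p)"
    by (rule finprod_Un_disjoint) (use insert assms(2) in auto)
  moreover have "insert x F \<times> B = {x} \<times> B \<union> F \<times> B"
    by auto
  ultimately show ?case by simp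
qed

text \<open>The coset count shared by the two compatibilities with transfers: that d kills proper
  transfers, and that the map on PD multiplies by the index. Each coset \<sigma>\<Sigma> contributes
  one full copy of the sum over the refinements of \<Psi>. It is stated multiplicatively and applied
  to the additive monoid of K.\<close>

lemma finprod_double_cosets:
  assumes f: "morphism \<Psi> \<Lambda> f" and g: "g \<in> refinements \<Psi> \<rightarrow> carrier G"
  shows "(\<Otimes>\<Gamma>\<in>refinements \<Lambda>.
      \<Otimes>D\<in>{D \<in> double_cosets \<Gamma> \<Lambda> (transport f \<Psi>). refines \<Gamma> (transport (representative D \<circ> f) \<Psi>)}.
        g (transport_back (pts \<Psi>) (representative D \<circ> f) \<Gamma>)) =
    (\<Otimes>\<Gamma>\<in>refinements \<Psi>. g \<Gamma>) [^] perm_index \<Psi> \<Lambda> f"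
proof -
  define \<Phi> where "\<Phi> = transport f \<Psi>"
  have \<Phi>: "refines \<Phi> \<Lambda>" and P: "is_partition \<Lambda>" "is_partition \<Psi>"
    using f by (auto simp: \<Phi>_def morphism_refines_transport morphism_def)
  define h where "h C = representative C \<circ> f" for C
  define C\<^sub>\<Lambda> where "C\<^sub>\<Lambda> = perm_cosets \<Lambda> \<Phi>"
  have h: "inj_on (h C) (pts \<Psi>)" "refines (transport (h C) \<Psi>) \<Lambda>" if "C \<in> C\<^sub>\<Lambda>" for C
  proof -
    have r: "representative C \<in> block_perms \<Lambda>"
      using that representative_perm_cosets[OF \<Phi>] by (simp add: C\<^sub>\<Lambda>_def)
    show "inj_on (h C) (pts \<Psi>)"
      unfolding h_def using f r by (intro comp_inj_on) (auto simp: morphism_inj_on block_perms_inj_on)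
    show "refines (transport (h C) \<Psi>) \<Lambda>"
      using block_perms_transport_refines[OF \<Phi> r] by (simp add: \<Phi>_def h_def transport_transport)
  qed
  \<comment> \<open>For a fixed coset the condition on \<Gamma> selects exactly the refinements of
    (\<sigma>f)\<Psi>. Transport along \<sigma>f identifies them with the refinements of \<Psi>, so
    the sum is the same for every coset.\<close>
  have inner: "(\<Otimes>\<Gamma>\<in>{\<Gamma> \<in> refinements \<Lambda>. refines \<Gamma> (transport (h C) \<Psi>)}. g (transport_back (pts \<Psi>) (h C) \<Gamma>)) =
      (\<Otimes>\<Gamma>\<in>refinements \<Psi>. g \<Gamma>)" and
    closed: "\<And>\<Gamma>. refines \<Gamma> (transport (h C) \<Psi>) \<Longrightarrow> g (transport_back (pts \<Psi>) (h C) \<Gamma>) \<in> carrier G"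
    if "C \<in> C\<^sub>\<Lambda>" for C
  proof -
    note bij = bij_betw_refinements_transport[OF P(2) h(1)[OF that]]
    have tb: "transport_back (pts \<Psi>) (h C) (transport (h C) \<Gamma>) = \<Gamma>" if "\<Gamma> \<in> refinements \<Psi>" for \<Gamma>
      using that h(1)[OF \<open>C \<in> C\<^sub>\<Lambda>\<close>]
      by (auto simp: transport_back_def refinements_def refines_iff transport_inv_into)
    have S: "{\<Gamma> \<in> refinements \<Lambda>. refines \<Gamma> (transport (h C) \<Psi>)} = refinements (transport (h C) \<Psi>)"
      using h(2)[OF that] refines_trans by (auto simp: refinements_def)
    have cl: "g (transport_back (pts \<Psi>) (h C) \<Gamma>) \<in> carrier G" if "\<Gamma> \<in> refinements (transport (h C) \<Psi>)" for \<Gamma>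
    proof -
      obtain \<Gamma>' where "\<Gamma>' \<in> refinements \<Psi>" "\<Gamma> = transport (h C) \<Gamma>'"
        using \<open>\<Gamma> \<in> refinements (transport (h C) \<Psi>)\<close> bij by (auto simp: bij_betw_def)
      then show ?thesis
        using tb g by auto
    qed
    then show "g (transport_back (pts \<Psi>) (h C) \<Gamma>) \<in> carrier G" if "refines \<Gamma> (transport (h C) \<Psi>)" for \<Gamma>
      using that by (simp add: refinements_def)
    have "(\<Otimes>\<Gamma>\<in>refinements (transport (h C) \<Psi>). g (transport_back (pts \<Psi>) (h C) \<Gamma>)) =
        (\<Otimes>\<Gamma>\<in>refinements \<Psi>. g (transport_back (pts \<Psi>) (h C) (transport (h C) \<Gamma>)))"
      using cl by (intro finprod_bij_betw[OF bij, symmetric]) auto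
    also have "\<dots> = (\<Otimes>\<Gamma>\<in>refinements \<Psi>. g \<Gamma>)"
      by (rule finprod_cong'[OF refl]) (use g tb in auto)
    finally show "(\<Otimes>\<Gamma>\<in>{\<Gamma> \<in> refinements \<Lambda>. refines \<Gamma> (transport (h C) \<Psi>)}.
        g (transport_back (pts \<Psi>) (h C) \<Gamma>)) = (\<Otimes>\<Gamma>\<in>refinements \<Psi>. g \<Gamma>)"
      by (simp add: S)
  qed
  \<comment> \<open>Double cosets depend on \<Gamma>, while the left cosets replacing them form one
    fixed set cut down by a condition. This is what permits the exchange of the two sums.\<close>
  have sets: "{D \<in> double_cosets \<Gamma> \<Lambda> \<Phi>. refines \<Gamma> (transport (h D) \<Psi>)} =
      {C \<in> C\<^sub>\<Lambda>. refines \<Gamma> (transport (h C) \<Psi>)}" if "\<Gamma> \<in> refinements \<Lambda>" for \<Gamma>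
    using double_cosets_refining_eq_perm_cosets[OF _ \<Phi>, of \<Gamma>] that
    by (simp add: C\<^sub>\<Lambda>_def h_def \<Phi>_def transport_transport refinements_def)
  have "(\<Otimes>\<Gamma>\<in>refinements \<Lambda>. \<Otimes>D\<in>{D \<in> double_cosets \<Gamma> \<Lambda> \<Phi>. refines \<Gamma> (transport (h D) \<Psi>)}.
        g (transport_back (pts \<Psi>) (h D) \<Gamma>)) =
      (\<Otimes>\<Gamma>\<in>refinements \<Lambda>. \<Otimes>C\<in>{C \<in> C\<^sub>\<Lambda>. refines \<Gamma> (transport (h C) \<Psi>)}.
        g (transport_back (pts \<Psi>) (h C) \<Gamma>))"
    by (rule finprod_cong'[OF refl]) (use closed in \<open>auto simp: sets intro!: finprod_closed\<close>)
  also have "\<dots> = (\<Otimes>C\<in>C\<^sub>\<Lambda>. \<Otimes>\<Gamma>\<in>{\<Gamma> \<in> refinements \<Lambda>. refines \<Gamma> (transport (h C) \<Psi>)}.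
        g (transport_back (pts \<Psi>) (h C) \<Gamma>))"
    using closed P
    by (intro finprod_swap_filter) (auto simp: finite_refinements C\<^sub>\<Lambda>_def finite_perm_cosets)
  also have "\<dots> = (\<Otimes>C\<in>C\<^sub>\<Lambda>. \<Otimes>\<Gamma>\<in>refinements \<Psi>. g \<Gamma>)"
    by (rule finprod_cong'[OF refl]) (use inner g in \<open>auto intro!: finprod_closed\<close>)
  also have "\<dots> = (\<Otimes>\<Gamma>\<in>refinements \<Psi>. g \<Gamma>) [^] card C\<^sub>\<Lambda>"
    using g by (intro finprod_const) auto
  finally show ?thesis
    by (simp add: h_def \<Phi>_def C\<^sub>\<Lambda>_def perm_index_def)
qed

end

text \<open>For monoids, membership in \<open>hom\<close> does not give preservation of \<one>,
  hence the separate assumption; for groups it is automatic.\<close>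

lemma finprod_hom:
  assumes "comm_monoid G" "comm_monoid H" "h \<in> hom G H" "h \<one>\<^bsub>G\<^esub> = \<one>\<^bsub>H\<^esub>" "f \<in> A \<rightarrow> carrier G"
  shows "h (finprod G f A) = finprod H (\<lambda>a. h (f a)) A"
proof -
  interpret G: comm_monoid G by fact
  interpret H: comm_monoid H by fact
  show ?thesis
    using assms(5)
  proof (induction A rule: infinite_finite_induct)
    case (insert a A)
    then show ?case
      using assms(3) by (simp add: Pi_iff hom_mult Group.hom_in_carrier)
  qed (use assms(4) in auto)
qed

section \<open>Refinements and block permutations of disjoint unions\<close>

lemma pts_disj_union [simp]: "pts (\<Lambda> \<squnion>\<^sub>P \<Omega>) = InL ` pts \<Lambda> \<union> InR ` pts \<Omega>"
  and eqv_disj_union: "eqv (\<Lambda> \<squnion>\<^sub>P \<Omega>) = map_prod InL InL ` eqv \<Lambda> \<union> map_prod InR InR ` eqv \<Omega>"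
  by (simp_all add: disj_union_def)

lemma eqv_disj_union_iff [simp]:
  "(InL a, InL a') \<in> eqv (\<Lambda> \<squnion>\<^sub>P \<Omega>) \<longleftrightarrow> (a, a') \<in> eqv \<Lambda>"
  "(InR b, InR b') \<in> eqv (\<Lambda> \<squnion>\<^sub>P \<Omega>) \<longleftrightarrow> (b, b') \<in> eqv \<Omega>"
  "(InL a, InR b) \<notin> eqv (\<Lambda> \<squnion>\<^sub>P \<Omega>)"
  "(InR b, InL a) \<notin> eqv (\<Lambda> \<squnion>\<^sub>P \<Omega>)"
  by (auto simp: eqv_disj_union)

lemma left_part_disj_union [simp]: "left_part (\<Lambda> \<squnion>\<^sub>P \<Omega>) = \<Lambda>"
  and right_part_disj_union [simp]: "right_part (\<Lambda> \<squnion>\<^sub>P \<Omega>) = \<Omega>"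
  by (auto simp: left_part_def right_part_def intro!: partn.expand)

lemma is_partition_empty: "is_partition empty_partn"
  by (simp add: empty_partn_def is_partition_def equiv_def refl_on_def sym_def trans_def)

lemma is_partition_disj_union:
  assumes "is_partition \<Lambda>" "is_partition \<Omega>"
  shows "is_partition (\<Lambda> \<squnion>\<^sub>P \<Omega>)"
proof (rule is_partitionI)
  note P = is_partition_eqv[OF assms(1)] is_partition_eqv[OF assms(2)]
  show "finite (pts (\<Lambda> \<squnion>\<^sub>P \<Omega>))"
    using P by simp
  show "eqv (\<Lambda> \<squnion>\<^sub>P \<Omega>) \<subseteq> pts (\<Lambda> \<squnion>\<^sub>P \<Omega>) \<times> pts (\<Lambda> \<squnion>\<^sub>P \<Omega>)"
    using P by (auto simp: eqv_disj_union)
  show "(x, x) \<in> eqv (\<Lambda> \<squnion>\<^sub>P \<Omega>)" if "x \<in> pts (\<Lambda> \<squnion>\<^sub>P \<Omega>)" for x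
    using that partition_refl[OF assms(1)] partition_refl[OF assms(2)] by auto
  show "(y, x) \<in> eqv (\<Lambda> \<squnion>\<^sub>P \<Omega>)" if "(x, y) \<in> eqv (\<Lambda> \<squnion>\<^sub>P \<Omega>)" for x y
    using that partition_sym[OF assms(1)] partition_sym[OF assms(2)]
    by (cases x; cases y) (auto simp: eqv_disj_union)
  show "(x, z) \<in> eqv (\<Lambda> \<squnion>\<^sub>P \<Omega>)"
    if xy: "(x, y) \<in> eqv (\<Lambda> \<squnion>\<^sub>P \<Omega>)" and yz: "(y, z) \<in> eqv (\<Lambda> \<squnion>\<^sub>P \<Omega>)" for x y z
  proof (cases y)
    case (Atom u)
    then show ?thesis using xy by (auto simp: eqv_disj_union)
  next
    case (InL b)
    then obtain a c where "x = InL a" "z = InL c"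
      using xy yz by (auto simp: eqv_disj_union)
    then show ?thesis
      using InL xy yz partition_trans[OF assms(1), of a b c] by simp
  next
    case (InR b)
    then obtain a c where "x = InR a" "z = InR c"
      using xy yz by (auto simp: eqv_disj_union)
    then show ?thesis
      using InR xy yz partition_trans[OF assms(2), of a b c] by simp
  qed
qed

lemma refines_disj_union:
  "refines \<Gamma> \<Lambda> \<Longrightarrow> refines \<Theta> \<Omega> \<Longrightarrow> refines (\<Gamma> \<squnion>\<^sub>P \<Theta>) (\<Lambda> \<squnion>\<^sub>P \<Omega>)"
  by (auto simp: refines_iff is_partition_disj_union eqv_disj_union)

text \<open>No block of the disjoint union meets both summands, so no related pair of a refinement
  mixes the tags \<open>InL\<close> and \<open>InR\<close>, and the refinement splits.\<close>

lemma refines_disj_unionE: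
  assumes "refines \<Delta> (\<Lambda> \<squnion>\<^sub>P \<Omega>)" "is_partition \<Lambda>" "is_partition \<Omega>"
  shows "refines (left_part \<Delta>) \<Lambda>" "refines (right_part \<Delta>) \<Omega>"
    "left_part \<Delta> \<squnion>\<^sub>P right_part \<Delta> = \<Delta>"
proof -
  have \<Delta>: "is_partition \<Delta>" "pts \<Delta> = pts (\<Lambda> \<squnion>\<^sub>P \<Omega>)" "eqv \<Delta> \<subseteq> eqv (\<Lambda> \<squnion>\<^sub>P \<Omega>)"
    using assms by (simp_all add: refines_iff)
  have pts: "pts (left_part \<Delta>) = pts \<Lambda>" "pts (right_part \<Delta>) = pts \<Omega>"
    using \<Delta>(2) by (auto simp: left_part_def right_part_def)
  have eqv: "eqv (left_part \<Delta>) \<subseteq> eqv \<Lambda>" "eqv (right_part \<Delta>) \<subseteq> eqv \<Omega>"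
    using \<Delta>(3) by (force simp: left_part_def right_part_def eqv_disj_union)+
  have "is_partition (left_part \<Delta>)"
  proof (rule is_partitionI)
    show "finite (pts (left_part \<Delta>))"
      "eqv (left_part \<Delta>) \<subseteq> pts (left_part \<Delta>) \<times> pts (left_part \<Delta>)"
      using pts eqv is_partition_eqv[OF assms(2)] by auto
  qed (use \<Delta>(1) in \<open>auto simp: left_part_def
      intro: partition_refl dest: partition_sym partition_trans\<close>)
  then show "refines (left_part \<Delta>) \<Lambda>"
    using pts eqv assms by (simp add: refines_iff)
  have "is_partition (right_part \<Delta>)"
  proof (rule is_partitionI)
    show "finite (pts (right_part \<Delta>))"
      "eqv (right_part \<Delta>) \<subseteq> pts (right_part \<Delta>) \<times> pts (right_part \<Delta>)"
      using pts eqv is_partition_eqv[OF assms(3)] by auto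
  qed (use \<Delta>(1) in \<open>auto simp: right_part_def
      intro: partition_refl dest: partition_sym partition_trans\<close>)
  then show "refines (right_part \<Delta>) \<Omega>"
    using pts eqv assms by (simp add: refines_iff)
  have "eqv (left_part \<Delta> \<squnion>\<^sub>P right_part \<Delta>) = eqv \<Delta>"
    using \<Delta>(3) by (fastforce simp: left_part_def right_part_def eqv_disj_union)
  then show "left_part \<Delta> \<squnion>\<^sub>P right_part \<Delta> = \<Delta>"
    using pts \<Delta>(2) by (intro partn.expand) simp
qed

lemma bij_betw_disj_union_refinements:
  assumes "is_partition \<Lambda>" "is_partition \<Omega>"
  shows "bij_betw (\<lambda>(\<Gamma>, \<Theta>). \<Gamma> \<squnion>\<^sub>P \<Theta>) (refinements \<Lambda> \<times> refinements \<Omega>) (refinements (\<Lambda> \<squnion>\<^sub>P \<Omega>))"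
  by (rule bij_betw_byWitness[where f' = "\<lambda>\<Delta>. (left_part \<Delta>, right_part \<Delta>)"])
    (use assms in \<open>auto simp: refinements_def refines_disj_union refines_disj_unionE\<close>)

text \<open>The distributive law, after refinements of the union are identified with pairs of
  refinements. It serves both the multiplicativity of d and that of the map on PD.\<close>

lemma (in cring) finsum_refinements_disj_union:
  assumes "is_partition \<Lambda>" "is_partition \<Omega>"
    and f: "f \<in> refinements \<Lambda> \<rightarrow> carrier R" and g: "g \<in> refinements \<Omega> \<rightarrow> carrier R"
  shows "(\<Oplus>\<Delta>\<in>refinements (\<Lambda> \<squnion>\<^sub>P \<Omega>). f (left_part \<Delta>) \<otimes> g (right_part \<Delta>)) =
    (\<Oplus>\<Gamma>\<in>refinements \<Lambda>. f \<Gamma>) \<otimes> (\<Oplus>\<Theta>\<in>refinements \<Omega>. g \<Theta>)"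
proof -
  have "(\<Oplus>\<Gamma>\<in>refinements \<Lambda>. f \<Gamma>) \<otimes> (\<Oplus>\<Theta>\<in>refinements \<Omega>. g \<Theta>) =
      (\<Oplus>\<Gamma>\<in>refinements \<Lambda>. f \<Gamma> \<otimes> (\<Oplus>\<Theta>\<in>refinements \<Omega>. g \<Theta>))"
    by (rule finsum_ldistr[OF finite_refinements finsum_closed[OF g] f])
  also have "\<dots> = (\<Oplus>\<Gamma>\<in>refinements \<Lambda>. \<Oplus>\<Theta>\<in>refinements \<Omega>. f \<Gamma> \<otimes> g \<Theta>)"
    by (rule finsum_cong'[OF refl])
      (use f g in \<open>auto simp: Pi_iff finsum_rdistr finite_refinements intro!: finsum_closed\<close>)
  also have "\<dots> = (\<Oplus>p\<in>refinements \<Lambda> \<times> refinements \<Omega>. f (fst p) \<otimes> g (snd p))"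
    using add.finprod_cartesian_product[of "refinements \<Lambda>" "refinements \<Omega>"
        "\<lambda>p. f (fst p) \<otimes> g (snd p)"] f g
    by (simp add: finite_refinements Pi_iff)
  also have "\<dots> = (\<Oplus>p\<in>refinements \<Lambda> \<times> refinements \<Omega>.
      (\<lambda>\<Delta>. f (left_part \<Delta>) \<otimes> g (right_part \<Delta>)) ((\<lambda>(\<Gamma>, \<Theta>). \<Gamma> \<squnion>\<^sub>P \<Theta>) p))"
    by (rule finsum_cong'[OF refl]) (use f g in \<open>auto simp: Pi_iff\<close>)
  also have "\<dots> = (\<Oplus>\<Delta>\<in>refinements (\<Lambda> \<squnion>\<^sub>P \<Omega>). f (left_part \<Delta>) \<otimes> g (right_part \<Delta>))"
    by (rule add.finprod_bij_betw[OF bij_betw_disj_union_refinements[OF assms(1,2)]])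
      (use f g refines_disj_unionE[OF _ assms(1,2)] in \<open>auto simp: refinements_def Pi_iff\<close>)
  finally show ?thesis by simp
qed

lemma map_disj_union_id: "map_disj_union id id = id"
proof
  show "map_disj_union id id x = id x" for x :: "'u point"
    by (cases x) auto
qed

text \<open>A block permutation moves a point only within its block, and every block lies in one
  summand. So it respects the tags and splits into its two restrictions.\<close>

lemma bij_betw_disj_union_block_perms:
  assumes "is_partition \<Lambda>" "is_partition \<Omega>"
  shows "bij_betw (\<lambda>(\<sigma>, \<tau>). map_disj_union \<sigma> \<tau>) (block_perms \<Lambda> \<times> block_perms \<Omega>)
    (block_perms (\<Lambda> \<squnion>\<^sub>P \<Omega>))"
  unfolding bij_betw_def
proof (intro conjI subset_antisym subsetI)
  show "inj_on (\<lambda>(\<sigma>, \<tau>). map_disj_union \<sigma> \<tau>) (block_perms \<Lambda> \<times> block_perms \<Omega>)"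
  proof (rule inj_onI, clarify)
    fix \<sigma> \<tau> \<sigma>' \<tau>' :: "'a point \<Rightarrow> 'a point"
    assume "map_disj_union \<sigma> \<tau> = map_disj_union \<sigma>' \<tau>'"
    then have "map_disj_union \<sigma> \<tau> (InL x) = map_disj_union \<sigma>' \<tau>' (InL x)"
      "map_disj_union \<sigma> \<tau> (InR x) = map_disj_union \<sigma>' \<tau>' (InR x)" for x
      by simp_all
    then show "\<sigma> = \<sigma>' \<and> \<tau> = \<tau>'"
      by (simp add: fun_eq_iff)
  qed
next
  fix \<rho> assume "\<rho> \<in> (\<lambda>(\<sigma>, \<tau>). map_disj_union \<sigma> \<tau>) ` (block_perms \<Lambda> \<times> block_perms \<Omega>)"
  then obtain \<sigma> \<tau> where \<sigma>: "\<sigma> \<in> block_perms \<Lambda>" and \<tau>: "\<tau> \<in> block_perms \<Omega>"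
    and \<rho>: "\<rho> = map_disj_union \<sigma> \<tau>" by auto
  note perm = block_perms_permutes[OF \<sigma>] block_perms_permutes[OF \<tau>]
  have "\<exists>!x. \<rho> x = y" for y
  proof (cases y)
    case (Atom u)
    have "\<rho> x = y \<longleftrightarrow> x = Atom u" for x by (cases x) (auto simp: \<rho> Atom)
    then show ?thesis by simp
  next
    case (InL a)
    have "\<rho> x = y \<longleftrightarrow> x = InL (inv' \<sigma> a)" for x
      using permutes_inverses[OF perm(1)] by (cases x) (auto simp: \<rho> InL)
    then show ?thesis by simp
  next
    case (InR b)
    have "\<rho> x = y \<longleftrightarrow> x = InR (inv' \<tau> b)" for x
      using permutes_inverses[OF perm(2)] by (cases x) (auto simp: \<rho> InR)
    then show ?thesis by simp
  qed
  moreover have "\<rho> x = x" if "x \<notin> pts (\<Lambda> \<squnion>\<^sub>P \<Omega>)" for x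
    using that perm by (cases x) (auto simp: \<rho> permutes_def)
  moreover have "(\<rho> x, x) \<in> eqv (\<Lambda> \<squnion>\<^sub>P \<Omega>)" if "x \<in> pts (\<Lambda> \<squnion>\<^sub>P \<Omega>)" for x
    using that block_perms_eqv[OF \<sigma>] block_perms_eqv[OF \<tau>] by (auto simp: \<rho>)
  ultimately show "\<rho> \<in> block_perms (\<Lambda> \<squnion>\<^sub>P \<Omega>)"
    by (simp add: block_perms_def permutes_def)
next
  fix \<rho> assume \<rho>: "\<rho> \<in> block_perms (\<Lambda> \<squnion>\<^sub>P \<Omega>)"
  note perm = block_perms_permutes[OF \<rho>]
  have fixed: "\<rho> x = x" if "x \<notin> pts (\<Lambda> \<squnion>\<^sub>P \<Omega>)" for x
    using perm that by (rule permutes_not_in)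
  \<comment> \<open>\<open>untag\<close> only strips a tag; that the tag is the expected one is the
    content of \<open>L\<close> and \<open>R\<close>, by related pairs on the points and by
    fixedness off them.\<close>
  define \<sigma> where "\<sigma> a = untag (\<rho> (InL a))" for a
  define \<tau> where "\<tau> b = untag (\<rho> (InR b))" for b
  have L: "\<rho> (InL a) = InL (\<sigma> a)" for a
  proof (cases "a \<in> pts \<Lambda>")
    case True
    then have "(\<rho> (InL a), InL a) \<in> eqv (\<Lambda> \<squnion>\<^sub>P \<Omega>)"
      using block_perms_eqv[OF \<rho>, of "InL a"] by simp
    then show ?thesis by (auto simp: eqv_disj_union \<sigma>_def)
  next
    case False
    then show ?thesis using fixed[of "InL a"] by (auto simp: \<sigma>_def image_iff)
  qed
  have R: "\<rho> (InR b) = InR (\<tau> b)" for b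
  proof (cases "b \<in> pts \<Omega>")
    case True
    then have "(\<rho> (InR b), InR b) \<in> eqv (\<Lambda> \<squnion>\<^sub>P \<Omega>)"
      using block_perms_eqv[OF \<rho>, of "InR b"] by simp
    then show ?thesis by (auto simp: eqv_disj_union \<tau>_def)
  next
    case False
    then show ?thesis using fixed[of "InR b"] by (auto simp: \<tau>_def image_iff)
  qed
  have A: "\<rho> (Atom u) = Atom u" for u
    using fixed by auto
  have surj: "\<exists>x. \<rho> x = y" and inj: "\<rho> x = \<rho> x' \<Longrightarrow> x = x'" for x x' y
    using perm unfolding permutes_def by blast+
  have "\<exists>!a. \<sigma> a = c" for c
  proof -
    obtain x where "\<rho> x = InL c" using surj by blast
    then obtain a where "\<sigma> a = c" by (cases x) (auto simp: A L R)
    moreover have "a = a'" if "\<sigma> a = \<sigma> a'" for a a'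
      using that inj[of "InL a" "InL a'"] by (simp add: L)
    ultimately show ?thesis by metis
  qed
  moreover have "\<sigma> a = a" if "a \<notin> pts \<Lambda>" for a
    using that fixed[of "InL a"] L[of a] by (auto simp: image_iff)
  moreover have "(\<sigma> a, a) \<in> eqv \<Lambda>" if "a \<in> pts \<Lambda>" for a
    using that block_perms_eqv[OF \<rho>, of "InL a"] by (simp add: L)
  ultimately have \<sigma>: "\<sigma> \<in> block_perms \<Lambda>"
    by (simp add: block_perms_def permutes_def)
  have "\<exists>!b. \<tau> b = c" for c
  proof -
    obtain x where "\<rho> x = InR c" using surj by blast
    then obtain b where "\<tau> b = c" by (cases x) (auto simp: A L R)
    moreover have "b = b'" if "\<tau> b = \<tau> b'" for b b'
      using that inj[of "InR b" "InR b'"] by (simp add: R)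
    ultimately show ?thesis by metis
  qed
  moreover have "\<tau> b = b" if "b \<notin> pts \<Omega>" for b
    using that fixed[of "InR b"] R[of b] by (auto simp: image_iff)
  moreover have "(\<tau> b, b) \<in> eqv \<Omega>" if "b \<in> pts \<Omega>" for b
    using that block_perms_eqv[OF \<rho>, of "InR b"] by (simp add: R)
  ultimately have \<tau>: "\<tau> \<in> block_perms \<Omega>"
    by (simp add: block_perms_def permutes_def)
  have "\<rho> = map_disj_union \<sigma> \<tau>"
  proof
    show "\<rho> x = map_disj_union \<sigma> \<tau> x" for x
      by (cases x) (auto simp: A L R)
  qed
  then show "\<rho> \<in> (\<lambda>(\<sigma>, \<tau>). map_disj_union \<sigma> \<tau>) ` (block_perms \<Lambda> \<times> block_perms \<Omega>)"
    using \<sigma> \<tau> by auto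
qed

lemma card_block_perms_disj_union:
  assumes "is_partition \<Lambda>" "is_partition \<Omega>"
  shows "card (block_perms (\<Lambda> \<squnion>\<^sub>P \<Omega>)) = card (block_perms \<Lambda>) * card (block_perms \<Omega>)"
  using bij_betw_same_card[OF bij_betw_disj_union_block_perms[OF assms]]
  by (simp add: card_cartesian_product)

text \<open>This normalizes the unit: the factor |\<Sigma>| at the empty partition is 1.\<close>

lemma card_block_perms_empty: "card (block_perms (empty_partn :: 'x partn)) = 1"
proof -
  have "block_perms (empty_partn :: 'x partn) = {id}"
    by (auto simp: block_perms_def empty_partn_def)
  then show ?thesis by simp
qed

section \<open>The Moebius inverse of the augmentation\<close>

text \<open>The conditional repeats the range of summation, which the termination proof would not see
  otherwise.\<close>

function moebius_aug :: "('u, 'a) pfunctor \<Rightarrow> 'k ring \<Rightarrow> ('u point partn \<Rightarrow> 'a \<Rightarrow> 'k) \<Rightarrow>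
    'u point partn \<Rightarrow> 'a \<Rightarrow> 'k" where
  "moebius_aug R K \<epsilon> \<Gamma> a = [card (block_perms \<Gamma>)] \<cdot>\<^bsub>K\<^esub> \<epsilon> \<Gamma> a \<ominus>\<^bsub>K\<^esub>
     (\<Oplus>\<^bsub>K\<^esub>\<Delta>\<in>{\<Delta>. strictly_refines \<Delta> \<Gamma>}.
        if strictly_refines \<Delta> \<Gamma> then moebius_aug R K \<epsilon> \<Delta> (res R \<Delta> \<Gamma> id a) else \<zero>\<^bsub>K\<^esub>)"
  by auto
termination
  by (relation "measure (\<lambda>(R, K, \<epsilon>, \<Gamma>, a). card (eqv \<Gamma>))") (auto intro: strictly_refines_card)

declare moebius_aug.simps [simp del]

context partition_functor
begin

lemma res_closed: "morphism \<Lambda> \<Omega> f \<Longrightarrow> x \<in> carrier (obj M \<Omega>) \<Longrightarrow> res M \<Lambda> \<Omega> f x \<in> carrier (obj M \<Lambda>)"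
  using res_hom hom_in_carrier by metis

lemma tr_closed: "morphism \<Lambda> \<Omega> f \<Longrightarrow> x \<in> carrier (obj M \<Lambda>) \<Longrightarrow> tr M \<Lambda> \<Omega> f x \<in> carrier (obj M \<Omega>)"
  using tr_hom hom_in_carrier by metis

text \<open>Transfers along isomorphisms are restrictions along their inverses, so this is
  functoriality of restriction.\<close>

lemma res_tr_iso:
  assumes f: "isomorphism \<Gamma> \<Gamma>' f" and \<Delta>: "refines \<Delta> \<Gamma>" and x: "x \<in> carrier (obj M \<Gamma>)"
  shows "res M (transport f \<Delta>) \<Gamma>' id (tr M \<Gamma> \<Gamma>' f x) =
    tr M \<Delta> (transport f \<Delta>) f (res M \<Delta> \<Gamma> id x)"
proof -
  have m: "morphism \<Gamma> \<Gamma>' f" and \<Gamma>': "\<Gamma>' = transport f \<Gamma>" and mi: "morphism \<Gamma>' \<Gamma> (inv_into (pts \<Gamma>) f)"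
    using f isomorphism_imp_transport by (auto simp: isomorphism_def)
  note inj = morphism_inj_on[OF m]
  have pts: "pts \<Delta> = pts \<Gamma>" and P: "is_partition \<Delta>"
    using \<Delta> by (simp_all add: refines_iff)
  have f\<Delta>: "isomorphism \<Delta> (transport f \<Delta>) f"
    using P inj pts by (intro isomorphism_transport) auto
  then have mi': "morphism (transport f \<Delta>) \<Delta> (inv_into (pts \<Gamma>) f)"
    by (simp add: isomorphism_def pts)
  have r: "refines (transport f \<Delta>) \<Gamma>'"
    using refines_transport[OF \<Delta> inj] by (simp add: \<Gamma>')
  have "res M (transport f \<Delta>) \<Gamma>' id (tr M \<Gamma> \<Gamma>' f x) =
      res M (transport f \<Delta>) \<Gamma>' id (res M \<Gamma>' \<Gamma> (inv_into (pts \<Gamma>) f) x)"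
    using tr_iso[OF f x] by simp
  also have "\<dots> = res M (transport f \<Delta>) \<Gamma> (inv_into (pts \<Gamma>) f) x"
    using res_comp[OF refines_morphism[OF r] mi x] by simp
  also have "\<dots> = res M (transport f \<Delta>) \<Delta> (inv_into (pts \<Gamma>) f) (res M \<Delta> \<Gamma> id x)"
    using res_comp[OF mi' refines_morphism[OF \<Delta>] x] by simp
  also have "\<dots> = tr M \<Delta> (transport f \<Delta>) f (res M \<Delta> \<Gamma> id x)"
    using tr_iso[OF f\<Delta> res_closed[OF refines_morphism[OF \<Delta>] x]] by (simp add: pts)
  finally show ?thesis .
qed

end

locale augmentation = R: lax_symmetric_monoidal R + K: cring K
  for R :: "('u, 'a) pfunctor" and K :: "'k ring" (structure) +
  fixes \<epsilon> :: "'u point partn \<Rightarrow> 'a \<Rightarrow> 'k"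
  assumes aug: "transfer_monoidal_map R (dual_const_pf K) \<epsilon>"
begin

abbreviation d :: "'u point partn \<Rightarrow> 'a \<Rightarrow> 'k" where
  "d \<equiv> moebius_aug R K \<epsilon>"

lemma aug_hom: "is_partition \<Lambda> \<Longrightarrow> \<epsilon> \<Lambda> \<in> hom (obj R \<Lambda>) (add_monoid K)"
  using aug by (simp add: transfer_monoidal_map_def dual_const_pf_def)

lemma aug_closed: "is_partition \<Lambda> \<Longrightarrow> x \<in> carrier (obj R \<Lambda>) \<Longrightarrow> \<epsilon> \<Lambda> x \<in> carrier K"
  using hom_in_carrier[OF aug_hom] by simp

lemma aug_tr: "morphism \<Lambda> \<Omega> f \<Longrightarrow> x \<in> carrier (obj R \<Lambda>) \<Longrightarrow> \<epsilon> \<Omega> (tr R \<Lambda> \<Omega> f x) = \<epsilon> \<Lambda> x"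
  using aug by (simp add: transfer_monoidal_map_def dual_const_pf_def)

lemma aug_ext:
  "is_partition \<Lambda> \<Longrightarrow> is_partition \<Omega> \<Longrightarrow> x \<in> carrier (obj R \<Lambda>) \<Longrightarrow> y \<in> carrier (obj R \<Omega>) \<Longrightarrow>
    \<epsilon> (\<Lambda> \<squnion>\<^sub>P \<Omega>) (ext R \<Lambda> \<Omega> x y) = \<epsilon> \<Lambda> x \<otimes> \<epsilon> \<Omega> y"
  using aug by (simp add: transfer_monoidal_map_def dual_const_pf_def)

lemma aug_unt: "\<epsilon> empty_partn (unt R) = \<one>"
  using aug by (simp add: transfer_monoidal_map_def dual_const_pf_def)

lemma res_refines_closed:
  "refines \<Delta> \<Gamma> \<Longrightarrow> a \<in> carrier (obj R \<Gamma>) \<Longrightarrow> res R \<Delta> \<Gamma> id a \<in> carrier (obj R \<Delta>)"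
  using R.res_closed refines_morphism by blast

lemma moebius_closed: "is_partition \<Gamma> \<Longrightarrow> a \<in> carrier (obj R \<Gamma>) \<Longrightarrow> d \<Gamma> a \<in> carrier K"
proof (induction \<Gamma> arbitrary: a rule: strict_refinement_induct)
  case (1 \<Gamma>)
  have "(\<lambda>\<Delta>. if strictly_refines \<Delta> \<Gamma> then d \<Delta> (res R \<Delta> \<Gamma> id a) else \<zero>)
      \<in> {\<Delta>. strictly_refines \<Delta> \<Gamma>} \<rightarrow> carrier K"
  proof clarsimp
    fix \<Delta> assume \<Delta>: "strictly_refines \<Delta> \<Gamma>"
    note \<Delta>' = strictly_refines_imp[OF \<Delta>]
    show "d \<Delta> (res R \<Delta> \<Gamma> id a) \<in> carrier K"
      using 1(1)[OF \<Delta> refines_is_partition(1)[OF \<Delta>'] res_refines_closed[OF \<Delta>' 1(3)]] .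
  qed
  then show ?case
    using 1 by (subst moebius_aug.simps) (simp add: aug_closed)
qed

lemma moebius_res_closed:
  "refines \<Delta> \<Gamma> \<Longrightarrow> a \<in> carrier (obj R \<Gamma>) \<Longrightarrow> d \<Delta> (res R \<Delta> \<Gamma> id a) \<in> carrier K"
  by (intro moebius_closed res_refines_closed refines_is_partition(1))

lemma moebius_rec:
  assumes "is_partition \<Gamma>" "a \<in> carrier (obj R \<Gamma>)"
  shows "d \<Gamma> a = [card (block_perms \<Gamma>)] \<cdot> \<epsilon> \<Gamma> a \<ominus>
    (\<Oplus>\<Delta>\<in>{\<Delta>. strictly_refines \<Delta> \<Gamma>}. d \<Delta> (res R \<Delta> \<Gamma> id a))"
proof -
  have "(\<Oplus>\<Delta>\<in>{\<Delta>. strictly_refines \<Delta> \<Gamma>}.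
      if strictly_refines \<Delta> \<Gamma> then d \<Delta> (res R \<Delta> \<Gamma> id a) else \<zero>) =
    (\<Oplus>\<Delta>\<in>{\<Delta>. strictly_refines \<Delta> \<Gamma>}. d \<Delta> (res R \<Delta> \<Gamma> id a))"
    by (rule K.finsum_cong'[OF refl])
      (use assms in \<open>auto simp: strictly_refines_imp moebius_res_closed\<close>)
  then show ?thesis
    by (subst moebius_aug.simps) simp
qed

lemma finsum_refinements:
  assumes "is_partition \<Gamma>" "\<And>\<Delta>. refines \<Delta> \<Gamma> \<Longrightarrow> g \<Delta> \<in> carrier K"
  shows "(\<Oplus>\<Delta>\<in>refinements \<Gamma>. g \<Delta>) = g \<Gamma> \<oplus> (\<Oplus>\<Delta>\<in>{\<Delta>. strictly_refines \<Delta> \<Gamma>}. g \<Delta>)"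
  unfolding refinements_eq[OF assms(1)]
  by (rule K.finsum_insert)
    (use assms finite_strict_refinements in \<open>auto dest: strictly_refines_imp simp: refines_refl strictly_refines_def[of \<Gamma> \<Gamma>]\<close>)

text \<open>The recursion with its strict part moved to the other side; the summand at \<Gamma> is
  d_\<Gamma>(a), because restriction along the identity is the identity. In this form the recursion
  enters the vanishing on transfers, multiplicativity and the unit.\<close>

lemma moebius_sum:
  assumes "is_partition \<Gamma>" "a \<in> carrier (obj R \<Gamma>)"
  shows "(\<Oplus>\<Delta>\<in>refinements \<Gamma>. d \<Delta> (res R \<Delta> \<Gamma> id a)) = [card (block_perms \<Gamma>)] \<cdot> \<epsilon> \<Gamma> a"
proof -
  have "(\<Oplus>\<Delta>\<in>refinements \<Gamma>. d \<Delta> (res R \<Delta> \<Gamma> id a)) =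
      d \<Gamma> a \<oplus> (\<Oplus>\<Delta>\<in>{\<Delta>. strictly_refines \<Delta> \<Gamma>}. d \<Delta> (res R \<Delta> \<Gamma> id a))"
    using finsum_refinements[OF assms(1) moebius_res_closed[OF _ assms(2)]] assms
    by (simp add: R.res_id)
  moreover have "(\<Oplus>\<Delta>\<in>{\<Delta>. strictly_refines \<Delta> \<Gamma>}. d \<Delta> (res R \<Delta> \<Gamma> id a)) \<in> carrier K"
    using assms by (auto simp: strictly_refines_imp moebius_res_closed intro!: K.finsum_closed)
  ultimately show ?thesis
    using assms by (simp add: moebius_rec[OF assms] aug_closed K.minus_eq K.a_assoc K.l_neg)
qed

text \<open>By recursion, as restrictions, \<epsilon> and integer multiples are all
  additive.\<close>

lemma moebius_add:
  "is_partition \<Gamma> \<Longrightarrow> a \<in> carrier (obj R \<Gamma>) \<Longrightarrow> b \<in> carrier (obj R \<Gamma>) \<Longrightarrow>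
    d \<Gamma> (a \<otimes>\<^bsub>obj R \<Gamma>\<^esub> b) = d \<Gamma> a \<oplus> d \<Gamma> b"
proof (induction \<Gamma> arbitrary: a b rule: strict_refinement_induct)
  case (1 \<Gamma>)
  interpret obj: comm_group "obj R \<Gamma>" using 1(2) by (rule R.obj_comm_group)
  let ?S = "{\<Delta>. strictly_refines \<Delta> \<Gamma>}"
  have cl: "(\<lambda>\<Delta>. d \<Delta> (res R \<Delta> \<Gamma> id c)) \<in> ?S \<rightarrow> carrier K" if "c \<in> carrier (obj R \<Gamma>)" for c
    using that by (auto simp: strictly_refines_imp moebius_res_closed)
  have "(\<Oplus>\<Delta>\<in>?S. d \<Delta> (res R \<Delta> \<Gamma> id (a \<otimes>\<^bsub>obj R \<Gamma>\<^esub> b))) =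
      (\<Oplus>\<Delta>\<in>?S. d \<Delta> (res R \<Delta> \<Gamma> id a) \<oplus> d \<Delta> (res R \<Delta> \<Gamma> id b))"
  proof (rule K.finsum_cong'[OF refl])
    show "d \<Delta> (res R \<Delta> \<Gamma> id (a \<otimes>\<^bsub>obj R \<Gamma>\<^esub> b)) = d \<Delta> (res R \<Delta> \<Gamma> id a) \<oplus> d \<Delta> (res R \<Delta> \<Gamma> id b)"
      if "\<Delta> \<in> ?S" for \<Delta>
    proof -
      have \<Delta>: "strictly_refines \<Delta> \<Gamma>" "refines \<Delta> \<Gamma>"
        using that strictly_refines_imp by auto
      then show ?thesis
        using 1 hom_mult[OF R.res_hom[OF refines_morphism[OF \<Delta>(2)]]]
        by (simp add: refines_is_partition(1)[OF \<Delta>(2)] res_refines_closed[OF \<Delta>(2)])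
    qed
  qed (use 1 cl in \<open>simp add: Pi_iff\<close>)
  also have "\<dots> = (\<Oplus>\<Delta>\<in>?S. d \<Delta> (res R \<Delta> \<Gamma> id a)) \<oplus> (\<Oplus>\<Delta>\<in>?S. d \<Delta> (res R \<Delta> \<Gamma> id b))"
    using 1 cl by (intro K.finsum_addf) auto
  finally have sum: "(\<Oplus>\<Delta>\<in>?S. d \<Delta> (res R \<Delta> \<Gamma> id (a \<otimes>\<^bsub>obj R \<Gamma>\<^esub> b))) = \<dots>" .
  have minus: "(x \<oplus> y) \<ominus> (z \<oplus> w) = (x \<ominus> z) \<oplus> (y \<ominus> w)"
    if "x \<in> carrier K" "y \<in> carrier K" "z \<in> carrier K" "w \<in> carrier K" for x y z w
    using that by (simp add: K.minus_eq K.minus_add K.a_ac)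
  have "[n] \<cdot> \<epsilon> \<Gamma> (a \<otimes>\<^bsub>obj R \<Gamma>\<^esub> b) = [n] \<cdot> \<epsilon> \<Gamma> a \<oplus> [n] \<cdot> \<epsilon> \<Gamma> b" for n :: nat
    using hom_mult[OF aug_hom[OF 1(2)] 1(3,4)] 1(2-4) by (simp add: aug_closed K.add.nat_pow_distrib)
  then show ?case
    unfolding moebius_rec[OF 1(2) obj.m_closed[OF 1(3,4)]] moebius_rec[OF 1(2,3)]
      moebius_rec[OF 1(2,4)] sum
    using K.finsum_closed[OF cl] 1 by (simp add: minus aug_closed)
qed

lemma moebius_hom: "is_partition \<Gamma> \<Longrightarrow> d \<Gamma> \<in> hom (obj R \<Gamma>) (add_monoid K)"
  by (auto simp: hom_def moebius_closed moebius_add)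

text \<open>Every ingredient of the recursion is invariant under isomorphisms: |\<Sigma>_\<Gamma>|
  by conjugation, \<epsilon> by its compatibility with transfers, and the strict part because f
  transports strict refinements to strict refinements and \<open>res_tr_iso\<close> moves the
  transfer past the restriction.\<close>

lemma moebius_tr_iso:
  "isomorphism \<Gamma> \<Gamma>' f \<Longrightarrow> a \<in> carrier (obj R \<Gamma>) \<Longrightarrow> d \<Gamma>' (tr R \<Gamma> \<Gamma>' f a) = d \<Gamma> a"
proof (induction \<Gamma> arbitrary: \<Gamma>' a rule: strict_refinement_induct)
  case (1 \<Gamma>)
  note f = 1(2) and a = 1(3)
  have m: "morphism \<Gamma> \<Gamma>' f" and \<Gamma>': "\<Gamma>' = transport f \<Gamma>"
    using f isomorphism_imp_transport by (auto simp: isomorphism_def)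
  have P: "is_partition \<Gamma>" "is_partition \<Gamma>'"
    using m by (auto simp: morphism_def)
  note inj = morphism_inj_on[OF m]
  have bij: "bij_betw (transport f) (refinements \<Gamma>) (refinements \<Gamma>')"
    unfolding \<Gamma>' by (rule bij_betw_refinements_transport[OF P(1) inj])
  have "bij_betw (transport f) (refinements \<Gamma> - {\<Gamma>}) (refinements \<Gamma>' - {\<Gamma>'})"
    unfolding \<Gamma>' using bij[unfolded \<Gamma>'] P(1)
    by (intro bij_betw_DiffI) (auto simp: refinements_def refines_refl bij_betw_def)
  moreover have "refinements \<Psi> - {\<Psi>} = {\<Delta>. strictly_refines \<Delta> \<Psi>}" for \<Psi> :: "'u point partn"
    by (auto simp: refinements_def strictly_refines_def)
  ultimately have bij': "bij_betw (transport f) {\<Delta>. strictly_refines \<Delta> \<Gamma>} {\<Delta>. strictly_refines \<Delta> \<Gamma>'}"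
    by simp
  have a': "tr R \<Gamma> \<Gamma>' f a \<in> carrier (obj R \<Gamma>')"
    using m a by (rule R.tr_closed)
  have "(\<Oplus>\<Delta>\<in>{\<Delta>. strictly_refines \<Delta> \<Gamma>'}. d \<Delta> (res R \<Delta> \<Gamma>' id (tr R \<Gamma> \<Gamma>' f a))) =
      (\<Oplus>\<Delta>\<in>{\<Delta>. strictly_refines \<Delta> \<Gamma>}. d (transport f \<Delta>) (res R (transport f \<Delta>) \<Gamma>' id (tr R \<Gamma> \<Gamma>' f a)))"
    using a' by (intro K.add.finprod_bij_betw[OF bij', symmetric])
      (auto simp: strictly_refines_imp moebius_res_closed)
  also have "\<dots> = (\<Oplus>\<Delta>\<in>{\<Delta>. strictly_refines \<Delta> \<Gamma>}. d \<Delta> (res R \<Delta> \<Gamma> id a))"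
  proof (rule K.finsum_cong'[OF refl])
    fix \<Delta> assume "\<Delta> \<in> {\<Delta>. strictly_refines \<Delta> \<Gamma>}"
    then have \<Delta>: "strictly_refines \<Delta> \<Gamma>" "refines \<Delta> \<Gamma>"
      using strictly_refines_imp by auto
    have "isomorphism \<Delta> (transport f \<Delta>) f"
      using \<Delta> inj by (intro isomorphism_transport) (auto simp: refines_iff)
    then show "d (transport f \<Delta>) (res R (transport f \<Delta>) \<Gamma>' id (tr R \<Gamma> \<Gamma>' f a)) = d \<Delta> (res R \<Delta> \<Gamma> id a)"
      using 1(1)[OF \<Delta>(1)] R.res_tr_iso[OF f \<Delta>(2) a] res_refines_closed[OF \<Delta>(2) a] by simp
  qed (use a in \<open>auto simp: strictly_refines_imp moebius_res_closed\<close>)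
  moreover have "card (block_perms \<Gamma>') = card (block_perms \<Gamma>)"
    using card_block_perms_isomorphism_le[OF f] card_block_perms_isomorphism_le[OF isomorphism_inv[OF f]]
    by simp
  ultimately show ?case
    using aug_tr[OF m a] by (simp add: moebius_rec[OF P(1) a] moebius_rec[OF P(2) a'])
qed

end

section \<open>Vanishing on proper transfers, and multiplicativity\<close>

context augmentation
begin

lemma hom_finprod_finsum:
  assumes "comm_group G" "h \<in> hom G (add_monoid K)" "f \<in> A \<rightarrow> carrier G"
  shows "h (finprod G f A) = (\<Oplus>a\<in>A. h (f a))"
proof -
  have "h \<one>\<^bsub>G\<^esub> = \<one>\<^bsub>add_monoid K\<^esub>"
    using assms K.a_group by (intro hom_one) (auto simp: comm_group_def)
  then show ?thesis
    using assms finprod_hom[of G "add_monoid K" h f A] K.a_comm_monoid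
    by (simp add: finsum_def comm_group_def)
qed

text \<open>By the double coset formula, the strict part of the defining sum at a transferred element
  is the full sum at the original one, counted once for each coset.\<close>

lemma moebius_tr_strict:
  "strictly_refines \<Omega> \<Gamma> \<Longrightarrow> b \<in> carrier (obj R \<Omega>) \<Longrightarrow> d \<Gamma> (tr R \<Omega> \<Gamma> id b) = \<zero>"
proof (induction \<Gamma> arbitrary: \<Omega> b rule: strict_refinement_induct)
  case (1 \<Gamma>)
  note b = 1(3)
  have \<Omega>: "refines \<Omega> \<Gamma>" and P: "is_partition \<Omega>" "is_partition \<Gamma>" "pts \<Omega> = pts \<Gamma>"
    using strictly_refines_imp[OF 1(2)] by (auto simp: refines_iff)
  define c where "c = tr R \<Omega> \<Gamma> id b"
  have c: "c \<in> carrier (obj R \<Gamma>)"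
    unfolding c_def by (rule R.tr_closed[OF refines_morphism[OF \<Omega>] b])
  define g where "g \<Delta> = d \<Delta> (res R \<Delta> \<Omega> id b)" for \<Delta>
  have g: "g \<in> refinements \<Omega> \<rightarrow> carrier K"
    using b by (auto simp: g_def refinements_def moebius_res_closed)
  define DC where "DC \<Delta> = {D \<in> double_cosets \<Delta> \<Gamma> \<Omega>. refines \<Delta> (transport (representative D) \<Omega>)}" for \<Delta>
  \<comment> \<open>The contribution of the double cosets with \<Delta> \<le> \<sigma>\<Omega>. It
    is defined for \<Delta> = \<Gamma> as well, since \<open>finprod_double_cosets\<close> sums over
    all refinements of \<Gamma> while the recursion sums only over strict ones.\<close>
  define S where "S \<Delta> = (\<Oplus>D\<in>DC \<Delta>. g (transport_back (pts \<Omega>) (representative D) \<Delta>))" for \<Delta>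
  have rep: "representative D \<in> block_perms \<Gamma>" "inj_on (representative D) A"
    "representative D ` pts \<Gamma> = pts \<Gamma>"
    if "D \<in> double_cosets \<Delta> \<Gamma> \<Omega>" "refines \<Delta> \<Gamma>" for D \<Delta> A
    using representative_double_cosets(1)[OF that(2) \<Omega> that(1)]
    by (auto simp: block_perms_inj_on block_perms_permutes permutes_image)
  have tb_closed: "g (transport_back (pts \<Omega>) (representative D) \<Delta>) \<in> carrier K"
    if D: "D \<in> DC \<Delta>" and \<Delta>: "refines \<Delta> \<Gamma>" for D \<Delta>
  proof -
    have D': "D \<in> double_cosets \<Delta> \<Gamma> \<Omega>" "refines \<Delta> (transport (representative D) \<Omega>)"
      using D by (auto simp: DC_def)
    obtain \<Delta>' where "\<Delta>' \<in> refinements \<Omega>" "\<Delta> = transport (representative D) \<Delta>'"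
      using bij_betw_refinements_transport[OF P(1) rep(2)[OF D'(1) \<Delta>]] D'(2)
      by (auto simp: bij_betw_def refinements_def)
    then show ?thesis
      using g rep(2)[OF D'(1) \<Delta>]
      by (auto simp: transport_back_def transport_inv_into refinements_def refines_iff)
  qed
  have S_closed: "S \<Delta> \<in> carrier K" if "refines \<Delta> \<Gamma>" for \<Delta>
    unfolding S_def using tb_closed[OF _ that] by (intro K.finsum_closed) auto
  have S: "d \<Delta> (res R \<Delta> \<Gamma> id c) = S \<Delta>" if s: "strictly_refines \<Delta> \<Gamma>" for \<Delta>
  proof -
    note \<Delta> = strictly_refines_imp[OF s]
    have P\<Delta>: "is_partition \<Delta>" "pts \<Delta> = pts \<Gamma>"
      using \<Delta> by (auto simp: refines_iff)
    define G where "G D = common_refinement \<Delta> (transport (representative D) \<Omega>)" for D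
    define L where "L D = common_refinement (transport_back (pts \<Gamma>) (representative D) \<Delta>) \<Omega>" for D
    define w where "w D = tr R (L D) (G D) (representative D) (res R (L D) \<Omega> id b)" for D
    have G: "refines (G D) \<Delta>" and L: "refines (L D) \<Omega>"
      and iso: "isomorphism (L D) (G D) (representative D)"
      and L_eq: "transport_back (pts \<Omega>) (representative D) (G D) = L D"
      if "D \<in> double_cosets \<Delta> \<Gamma> \<Omega>" for D
    proof -
      note r = rep[OF that \<Delta>]
      let ?\<sigma> = "representative D"
      have P\<sigma>: "is_partition (transport ?\<sigma> \<Omega>)" "pts (transport ?\<sigma> \<Omega>) = pts \<Gamma>"
        using r P by (auto simp: is_partition_transport)
      have PB: "is_partition (transport_back (pts \<Gamma>) ?\<sigma> \<Delta>)"
        "pts (transport_back (pts \<Gamma>) ?\<sigma> \<Delta>) = pts \<Gamma>"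
        using r P\<Delta> inv_into_image_cancel[OF r(2), of "pts \<Gamma>" "pts \<Gamma>"]
        by (auto simp: transport_back_def inj_on_inv_into intro!: is_partition_transport)
      show "refines (G D) \<Delta>"
        unfolding G_def using P\<Delta> P\<sigma> by (intro refines_common_refinement) auto
      show L: "refines (L D) \<Omega>"
        unfolding L_def using PB P by (intro refines_common_refinement) auto
      \<comment> \<open>As \<sigma>(\<sigma>^-1 \<Delta> \<inter> \<Omega>) = \<Delta> \<inter>
        \<sigma>\<Omega>, the middle map in the double coset formula is an isomorphism, along which
        d is invariant.\<close>
      have GL: "G D = transport ?\<sigma> (L D)"
        unfolding G_def L_def using PB P P\<Delta> r transport_transport_back[of \<Delta> ?\<sigma> "pts \<Gamma>"]
        by (subst transport_common_refinement) auto
      show "isomorphism (L D) (G D) ?\<sigma>"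
        unfolding GL using L r by (intro isomorphism_transport) (auto simp: refines_iff)
      show "transport_back (pts \<Omega>) ?\<sigma> (G D) = L D"
        unfolding GL transport_back_def using L r
        by (intro transport_inv_into) (auto simp: refines_iff)
    qed
    have resb: "res R (L D) \<Omega> id b \<in> carrier (obj R (L D))"
      and w: "w D \<in> carrier (obj R (G D))"
      and trw: "tr R (G D) \<Delta> id (w D) \<in> carrier (obj R \<Delta>)"
      if "D \<in> double_cosets \<Delta> \<Gamma> \<Omega>" for D
    proof -
      show 1: "res R (L D) \<Omega> id b \<in> carrier (obj R (L D))"
        by (rule res_refines_closed[OF L[OF that] b])
      show 2: "w D \<in> carrier (obj R (G D))"
        unfolding w_def using iso[OF that] 1 by (auto simp: isomorphism_def intro: R.tr_closed)
      show "tr R (G D) \<Delta> id (w D) \<in> carrier (obj R \<Delta>)"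
        by (rule R.tr_closed[OF refines_morphism[OF G[OF that]] 2])
    qed
    have "d \<Delta> (res R \<Delta> \<Gamma> id c) =
        d \<Delta> (finprod (obj R \<Delta>) (\<lambda>D. tr R (G D) \<Delta> id (w D)) (double_cosets \<Delta> \<Gamma> \<Omega>))"
      unfolding c_def R.double_coset_formula[OF \<Delta> \<Omega> b] by (simp add: Let_def G_def L_def w_def)
    also have "\<dots> = (\<Oplus>D\<in>double_cosets \<Delta> \<Gamma> \<Omega>. d \<Delta> (tr R (G D) \<Delta> id (w D)))"
      using P\<Delta> trw by (intro hom_finprod_finsum R.obj_comm_group moebius_hom) auto
    also have "\<dots> = S \<Delta>"
      unfolding S_def
    proof (rule K.add.finprod_mono_neutral_cong_right)
      show "finite (double_cosets \<Delta> \<Gamma> \<Omega>)"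
        using P by (simp add: finite_double_cosets)
      show "DC \<Delta> \<subseteq> double_cosets \<Delta> \<Gamma> \<Omega>"
        by (auto simp: DC_def)
      show "(\<lambda>D. d \<Delta> (tr R (G D) \<Delta> id (w D))) \<in> double_cosets \<Delta> \<Gamma> \<Omega> \<rightarrow> carrier K"
        using trw P\<Delta> by (auto intro: moebius_closed)
      \<comment> \<open>Here \<Delta> \<inter> \<sigma>\<Omega> is strictly finer than \<Delta>, so
        the term is a proper transfer into \<Delta> < \<Gamma> and the induction hypothesis at
        \<Delta> kills it.\<close>
      show "d \<Delta> (tr R (G D) \<Delta> id (w D)) = \<zero>" if D: "D \<in> double_cosets \<Delta> \<Gamma> \<Omega> - DC \<Delta>" for D
      proof -
        have D': "D \<in> double_cosets \<Delta> \<Gamma> \<Omega>" "\<not> refines \<Delta> (transport (representative D) \<Omega>)"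
          using D by (auto simp: DC_def)
        have "is_partition (transport (representative D) \<Omega>)"
          using P rep[OF D'(1) \<Delta>] by (simp add: is_partition_transport)
        then have "G D \<noteq> \<Delta>"
          using common_refinement_eq_imp[of \<Delta> "transport (representative D) \<Omega>"] P\<Delta> D' P rep[OF D'(1) \<Delta>]
          by (auto simp: G_def)
        then have "strictly_refines (G D) \<Delta>"
          using G[OF D'(1)] by (simp add: strictly_refines_def)
        then show ?thesis
          using 1(1)[OF s] w[OF D'(1)] by blast
      qed
      \<comment> \<open>Here \<Delta> \<inter> \<sigma>\<Omega> = \<Delta>: the outer transfer is
        the identity, and isomorphism invariance pulls the value back to \<sigma>^-1
        \<Delta>.\<close>
      show "d \<Delta> (tr R (G D) \<Delta> id (w D)) = g (transport_back (pts \<Omega>) (representative D) \<Delta>)"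
        if D: "D \<in> DC \<Delta>" for D
      proof -
        have D': "D \<in> double_cosets \<Delta> \<Gamma> \<Omega>" "refines \<Delta> (transport (representative D) \<Omega>)"
          using D by (auto simp: DC_def)
        have G\<Delta>: "G D = \<Delta>"
          unfolding G_def by (rule common_refinement_absorb[OF D'(2)])
        have "tr R (G D) \<Delta> id (w D) = w D"
          using w[OF D'(1)] P\<Delta> by (simp add: G\<Delta> R.tr_id)
        moreover have "d (G D) (w D) = d (L D) (res R (L D) \<Omega> id b)"
          unfolding w_def by (rule moebius_tr_iso[OF iso[OF D'(1)] resb[OF D'(1)]])
        ultimately show ?thesis
          using L_eq[OF D'(1)] by (simp add: G\<Delta> g_def)
      qed
    qed
    finally show ?thesis .
  qed
  \<comment> \<open>The sum is empty: \<sigma>\<Omega> has at most as many related pairs as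
    \<Omega>, hence fewer than \<Gamma>, and cannot be refined by \<Gamma>.\<close>
  have "S \<Gamma> = \<zero>"
  proof -
    have "DC \<Gamma> = {}"
    proof (rule equals0I)
      fix D assume "D \<in> DC \<Gamma>"
      then have D: "D \<in> double_cosets \<Gamma> \<Gamma> \<Omega>" "refines \<Gamma> (transport (representative D) \<Omega>)"
        by (auto simp: DC_def)
      have "card (eqv \<Gamma>) \<le> card (eqv (transport (representative D) \<Omega>))"
        using D(2) is_partition_eqv(2) by (auto simp: refines_iff intro: card_mono)
      also have "\<dots> \<le> card (eqv \<Omega>)"
        using is_partition_eqv(2)[OF P(1)] by (simp add: eqv_transport card_image_le)
      finally show False
        using strictly_refines_card[OF 1(2)] by simp
    qed
    then show ?thesis by (simp add: S_def)
  qed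
  moreover have "(\<Oplus>\<Delta>\<in>refinements \<Gamma>. S \<Delta>) = [perm_index \<Omega> \<Gamma> id] \<cdot> (\<Oplus>\<Delta>\<in>refinements \<Omega>. g \<Delta>)"
    using K.add.finprod_double_cosets[OF refines_morphism[OF \<Omega>] g]
    by (simp add: S_def DC_def transport_id)
  moreover have "(\<Oplus>\<Delta>\<in>refinements \<Omega>. g \<Delta>) = [card (block_perms \<Omega>)] \<cdot> \<epsilon> \<Omega> b"
    unfolding g_def by (rule moebius_sum[OF P(1) b])
  \<comment> \<open>Lagrange absorbs the index into |\<Sigma>_\<Gamma>|, and \<epsilon> takes the
    same value at b and at its transfer c.\<close>
  moreover have "[perm_index \<Omega> \<Gamma> id] \<cdot> ([card (block_perms \<Omega>)] \<cdot> \<epsilon> \<Omega> b) =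
      [card (block_perms \<Gamma>)] \<cdot> \<epsilon> \<Gamma> c"
    using card_perm_cosets[OF \<Omega>] aug_tr[OF refines_morphism[OF \<Omega>] b] aug_closed[OF P(1) b]
    by (simp add: K.add.nat_pow_pow perm_index_def transport_id c_def)
  moreover have "(\<Oplus>\<Delta>\<in>refinements \<Gamma>. S \<Delta>) = S \<Gamma> \<oplus> (\<Oplus>\<Delta>\<in>{\<Delta>. strictly_refines \<Delta> \<Gamma>}. S \<Delta>)"
    using S_closed by (intro finsum_refinements[OF P(2)])
  moreover have "(\<Oplus>\<Delta>\<in>{\<Delta>. strictly_refines \<Delta> \<Gamma>}. S \<Delta>) \<in> carrier K"
    using S_closed strictly_refines_imp by (intro K.finsum_closed) auto
  moreover have "(\<Oplus>\<Delta>\<in>{\<Delta>. strictly_refines \<Delta> \<Gamma>}. d \<Delta> (res R \<Delta> \<Gamma> id c)) =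
      (\<Oplus>\<Delta>\<in>{\<Delta>. strictly_refines \<Delta> \<Gamma>}. S \<Delta>)"
    by (rule K.finsum_cong'[OF refl]) (use S S_closed strictly_refines_imp in auto)
  \<comment> \<open>The strict part at c is the whole of |\<Sigma>_\<Gamma>| \<epsilon>_\<Gamma>(c),
    so nothing is left for d_\<Gamma>(c).\<close>
  ultimately have "d \<Gamma> c = \<zero>"
    using moebius_rec[OF P(2) c] aug_closed[OF P(2) c] by (simp add: K.minus_eq K.r_neg)
  then show ?case
    unfolding c_def .
qed

lemma ext_closed:
  assumes "is_partition \<Lambda>" "is_partition \<Omega>" "x \<in> carrier (obj R \<Lambda>)" "y \<in> carrier (obj R \<Omega>)"
  shows "ext R \<Lambda> \<Omega> x y \<in> carrier (obj R (\<Lambda> \<squnion>\<^sub>P \<Omega>))"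
  using hom_in_carrier[OF R.ext_left_hom[OF assms(1,2,4)] assms(3)] .

text \<open>Both sides are top summands of sums over the refinements of the union. The full sums
  agree because |\<Sigma>| and \<epsilon> are multiplicative, and the strict summands agree by
  induction because external products commute with restrictions; hence the top summands
  agree.\<close>

lemma moebius_ext:
  "is_partition \<Gamma> \<Longrightarrow> is_partition \<Theta> \<Longrightarrow> x \<in> carrier (obj R \<Gamma>) \<Longrightarrow> y \<in> carrier (obj R \<Theta>) \<Longrightarrow>
    d (\<Gamma> \<squnion>\<^sub>P \<Theta>) (ext R \<Gamma> \<Theta> x y) = d \<Gamma> x \<otimes> d \<Theta> y"
\<comment> \<open>The induction runs over the union and not over a factor, as a strict refinement of
  the union may leave one of its two parts unchanged.\<close>
proof (induction "\<Gamma> \<squnion>\<^sub>P \<Theta>" arbitrary: \<Gamma> \<Theta> x y rule: strict_refinement_induct)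
  case (1 \<Gamma> \<Theta>)
  note P = 1(2,3) and x = 1(4) and y = 1(5)
  note e = ext_closed[OF P x y] and PU = is_partition_disj_union[OF P]
  let ?S = "{\<Delta>. strictly_refines \<Delta> (\<Gamma> \<squnion>\<^sub>P \<Theta>)}"
  define F where "F \<Delta> = d (left_part \<Delta>) (res R (left_part \<Delta>) \<Gamma> id x) \<otimes>
      d (right_part \<Delta>) (res R (right_part \<Delta>) \<Theta> id y)" for \<Delta>
  have F_closed: "F \<Delta> \<in> carrier K" if "refines \<Delta> (\<Gamma> \<squnion>\<^sub>P \<Theta>)" for \<Delta>
    using refines_disj_unionE[OF that P] x y by (simp add: F_def moebius_res_closed)
  have F: "d \<Delta> (res R \<Delta> (\<Gamma> \<squnion>\<^sub>P \<Theta>) id (ext R \<Gamma> \<Theta> x y)) = F \<Delta>"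
    if s: "strictly_refines \<Delta> (\<Gamma> \<squnion>\<^sub>P \<Theta>)" for \<Delta>
  proof -
    note l = refines_disj_unionE[OF strictly_refines_imp[OF s] P]
    let ?l = "left_part \<Delta>" and ?r = "right_part \<Delta>"
    have "res R \<Delta> (\<Gamma> \<squnion>\<^sub>P \<Theta>) id (ext R \<Gamma> \<Theta> x y) =
        ext R ?l ?r (res R ?l \<Gamma> id x) (res R ?r \<Theta> id y)"
      using R.ext_res[OF refines_morphism[OF l(1)] refines_morphism[OF l(2)] x y]
      by (simp add: l(3) map_disj_union_id)
    then show ?thesis
      using 1(1)[OF _ refines_is_partition(1)[OF l(1)] refines_is_partition(1)[OF l(2)]
          res_refines_closed[OF l(1) x] res_refines_closed[OF l(2) y]] s
      by (simp add: F_def l(3))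
  qed
  have "(\<Oplus>\<Delta>\<in>refinements (\<Gamma> \<squnion>\<^sub>P \<Theta>). F \<Delta>) =
      ([card (block_perms \<Gamma>)] \<cdot> \<epsilon> \<Gamma> x) \<otimes> ([card (block_perms \<Theta>)] \<cdot> \<epsilon> \<Theta> y)"
    unfolding F_def moebius_sum[OF P(1) x, symmetric] moebius_sum[OF P(2) y, symmetric]
    by (rule K.finsum_refinements_disj_union[OF P])
      (use x y in \<open>auto simp: refinements_def moebius_res_closed\<close>)
  also have "\<dots> = [card (block_perms (\<Gamma> \<squnion>\<^sub>P \<Theta>))] \<cdot> \<epsilon> (\<Gamma> \<squnion>\<^sub>P \<Theta>) (ext R \<Gamma> \<Theta> x y)"
    using aug_closed[OF P(1) x] aug_closed[OF P(2) y]
    by (simp add: card_block_perms_disj_union[OF P] aug_ext[OF P x y] K.add_pow_ldistr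
        K.add_pow_rdistr K.add.nat_pow_pow mult.commute)
  finally have "[card (block_perms (\<Gamma> \<squnion>\<^sub>P \<Theta>))] \<cdot> \<epsilon> (\<Gamma> \<squnion>\<^sub>P \<Theta>) (ext R \<Gamma> \<Theta> x y) =
      F (\<Gamma> \<squnion>\<^sub>P \<Theta>) \<oplus> (\<Oplus>\<Delta>\<in>?S. F \<Delta>)"
    using finsum_refinements[OF PU F_closed] by simp
  moreover have "(\<Oplus>\<Delta>\<in>?S. d \<Delta> (res R \<Delta> (\<Gamma> \<squnion>\<^sub>P \<Theta>) id (ext R \<Gamma> \<Theta> x y))) = (\<Oplus>\<Delta>\<in>?S. F \<Delta>)"
    by (rule K.finsum_cong'[OF refl]) (use F F_closed strictly_refines_imp in auto)
  moreover have "(\<Oplus>\<Delta>\<in>?S. F \<Delta>) \<in> carrier K"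
    using F_closed strictly_refines_imp by (intro K.finsum_closed) auto
  moreover have "F (\<Gamma> \<squnion>\<^sub>P \<Theta>) = d \<Gamma> x \<otimes> d \<Theta> y"
    using P x y by (simp add: F_def R.res_id)
  ultimately show ?case
    using moebius_rec[OF PU e] P x y
    by (simp add: K.minus_eq K.a_assoc K.r_neg moebius_closed)
qed

end

section \<open>The induced map on PD\<close>

text \<open>The map induced by d on a quotient, evaluated at a chosen element of the coset.
  Independence of the choice is \<open>dbar_eq\<close>.\<close>

definition moebius_bar :: "('u, 'a) pfunctor \<Rightarrow> 'k ring \<Rightarrow> ('u point partn \<Rightarrow> 'a \<Rightarrow> 'k) \<Rightarrow>
    'u point partn \<Rightarrow> 'a set \<Rightarrow> 'k" where
  "moebius_bar R K \<epsilon> \<Gamma> A = moebius_aug R K \<epsilon> \<Gamma> (SOME a. a \<in> A)"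

definition PD_aug :: "('u, 'a) pfunctor \<Rightarrow> 'k ring \<Rightarrow> ('u point partn \<Rightarrow> 'a \<Rightarrow> 'k) \<Rightarrow>
    'u point partn \<Rightarrow> ('u point partn \<Rightarrow> 'a set) \<Rightarrow> 'k" where
  "PD_aug R K \<epsilon> \<Lambda> x = (\<Oplus>\<^bsub>K\<^esub>\<Gamma>\<in>refinements \<Lambda>. moebius_bar R K \<epsilon> \<Gamma> (x \<Gamma>))"

text \<open>If d is constant on a nonempty set, the choice is immaterial. This evaluates the map on
  the unions in \<open>bar_ext\<close> and \<open>PD_map\<close> without first showing that they are
  single cosets.\<close>

lemma moebius_bar_eqI:
  assumes "A \<noteq> {}" "\<And>a. a \<in> A \<Longrightarrow> moebius_aug R K \<epsilon> \<Gamma> a = k"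
  shows "moebius_bar R K \<epsilon> \<Gamma> A = k"
  using assms some_in_eq unfolding moebius_bar_def by blast

section \<open>The quotients by proper transfers\<close>

context partition_functor
begin

lemma tr_ideal_generators:
  "is_partition \<Gamma> \<Longrightarrow> (\<Union>\<Omega>\<in>{\<Omega>. strictly_refines \<Omega> \<Gamma>}. tr M \<Omega> \<Gamma> id ` carrier (obj M \<Omega>)) \<subseteq> carrier (obj M \<Gamma>)"
  using tr_closed refines_morphism strictly_refines_imp by blast

lemma subgroup_tr_ideal: "is_partition \<Gamma> \<Longrightarrow> subgroup (tr_ideal M \<Gamma>) (obj M \<Gamma>)"
  unfolding tr_ideal_def
  using obj_comm_group[of \<Gamma>] tr_ideal_generators[of \<Gamma>]
  by (simp add: comm_group_def group.generate_is_subgroup)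

lemma normal_tr_ideal: "is_partition \<Gamma> \<Longrightarrow> tr_ideal M \<Gamma> \<lhd> obj M \<Gamma>"
  by (simp add: comm_group.normal_iff_subgroup obj_comm_group subgroup_tr_ideal)

lemma comm_group_bar: "is_partition \<Gamma> \<Longrightarrow> comm_group (bar M \<Gamma>)"
  unfolding bar_def by (simp add: comm_group.abelian_FactGroup obj_comm_group subgroup_tr_ideal)

lemma carrier_bar: "carrier (bar M \<Gamma>) = bar_proj M \<Gamma> ` carrier (obj M \<Gamma>)"
  by (simp add: bar_def carrier_FactGroup bar_proj_def)

lemma bar_proj_self:
  assumes "is_partition \<Gamma>" "a \<in> carrier (obj M \<Gamma>)"
  shows "a \<in> bar_proj M \<Gamma> a"
proof -
  interpret comm_group "obj M \<Gamma>" using assms(1) by (rule obj_comm_group)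
  show ?thesis
    unfolding bar_proj_def by (rule rcos_self[OF assms(2) subgroup_tr_ideal[OF assms(1)]])
qed

lemma bar_projE:
  assumes "b \<in> bar_proj M \<Gamma> a"
  obtains i where "i \<in> tr_ideal M \<Gamma>" "b = i \<otimes>\<^bsub>obj M \<Gamma>\<^esub> a"
  using assms by (auto simp: bar_proj_def r_coset_def)

lemma tr_ideal_closed: "is_partition \<Gamma> \<Longrightarrow> i \<in> tr_ideal M \<Gamma> \<Longrightarrow> i \<in> carrier (obj M \<Gamma>)"
  using subgroup.mem_carrier subgroup_tr_ideal by metis

lemma bar_proj_closed:
  assumes "is_partition \<Gamma>" "a \<in> carrier (obj M \<Gamma>)" "b \<in> bar_proj M \<Gamma> a"
  shows "b \<in> carrier (obj M \<Gamma>)"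
proof -
  interpret comm_group "obj M \<Gamma>" using assms(1) by (rule obj_comm_group)
  show ?thesis
    using assms by (auto elim!: bar_projE simp: tr_ideal_closed)
qed

lemma bar_mem_closed:
  "is_partition \<Gamma> \<Longrightarrow> A \<in> carrier (bar M \<Gamma>) \<Longrightarrow> a \<in> A \<Longrightarrow> a \<in> carrier (obj M \<Gamma>)"
  by (auto simp: carrier_bar bar_proj_closed)

lemma bar_nonempty: "is_partition \<Gamma> \<Longrightarrow> A \<in> carrier (bar M \<Gamma>) \<Longrightarrow> A \<noteq> {}"
  using bar_proj_self by (fastforce simp: carrier_bar)

text \<open>Transfer along f after transfer along \<Omega> < \<Gamma> equals transfer along
  f\<Omega> < \<Gamma>' after an isomorphism, and transport by f preserves strictness. So generators
  go to generators, and the image of a generated subgroup is generated by the images.\<close>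

lemma tr_iso_tr_ideal:
  assumes f: "isomorphism \<Gamma> \<Gamma>' f"
  shows "tr M \<Gamma> \<Gamma>' f ` tr_ideal M \<Gamma> \<subseteq> tr_ideal M \<Gamma>'"
proof -
  have m: "morphism \<Gamma> \<Gamma>' f" and P: "is_partition \<Gamma>" "is_partition \<Gamma>'"
    using f by (auto simp: isomorphism_def morphism_def)
  note \<Gamma>' = isomorphism_imp_transport[OF f] and inj = morphism_inj_on[OF m]
  interpret tr: group_hom "obj M \<Gamma>" "obj M \<Gamma>'" "tr M \<Gamma> \<Gamma>' f"
    using obj_comm_group[OF P(1)] obj_comm_group[OF P(2)] tr_hom[OF m]
    by (simp add: group_hom_def group_hom_axioms_def comm_group_def)
  have "tr M \<Gamma> \<Gamma>' f (tr M \<Omega> \<Gamma> id b) \<in> tr_ideal M \<Gamma>'"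
    if s: "strictly_refines \<Omega> \<Gamma>" and b: "b \<in> carrier (obj M \<Omega>)" for \<Omega> b
  proof -
    note \<Omega> = strictly_refines_imp[OF s]
    have P\<Omega>: "is_partition \<Omega>" "pts \<Omega> = pts \<Gamma>"
      using \<Omega> by (auto simp: refines_iff)
    have "transport f \<Omega> \<noteq> \<Gamma>'"
    proof
      assume "transport f \<Omega> = \<Gamma>'"
      then have "transport (inv_into (pts \<Gamma>) f) (transport f \<Omega>) =
          transport (inv_into (pts \<Gamma>) f) (transport f \<Gamma>)"
        by (simp add: \<Gamma>')
      then have "\<Omega> = \<Gamma>"
        using P P\<Omega> inj by (simp add: transport_inv_into)
      then show False
        using s by (simp add: strictly_refines_def)
    qed
    then have s': "strictly_refines (transport f \<Omega>) \<Gamma>'"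
      using refines_transport[OF \<Omega> inj] \<Gamma>' by (simp add: strictly_refines_def)
    have f\<Omega>: "morphism \<Omega> (transport f \<Omega>) f"
      using isomorphism_transport[of \<Omega> f] P\<Omega> inj by (simp add: isomorphism_def)
    have "tr M \<Gamma> \<Gamma>' f (tr M \<Omega> \<Gamma> id b) = tr M \<Omega> \<Gamma>' f b"
      using tr_comp[OF refines_morphism[OF \<Omega>] m b] by simp
    also have "\<dots> = tr M (transport f \<Omega>) \<Gamma>' id (tr M \<Omega> (transport f \<Omega>) f b)"
      using tr_comp[OF f\<Omega> refines_morphism[OF strictly_refines_imp[OF s']] b] by simp
    finally show ?thesis
      using s' tr_closed[OF f\<Omega> b] unfolding tr_ideal_def by (auto intro!: generate.incl)
  qed
  then show ?thesis
    unfolding tr_ideal_def[of M \<Gamma>] tr.generate_img[OF tr_ideal_generators[OF P(1)], symmetric]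
    by (intro tr.H.generate_subgroup_incl[OF _ subgroup_tr_ideal[OF P(2)]]) auto
qed

text \<open>All representatives in A have images in the same coset, by
  \<open>tr_iso_tr_ideal\<close>, so the union defining \<open>bar_tr\<close> is that single
  coset.\<close>

lemma bar_tr_closed:
  assumes f: "isomorphism \<Gamma> \<Gamma>' f" and A: "A \<in> carrier (bar M \<Gamma>)"
  shows "bar_tr M \<Gamma> \<Gamma>' f A \<in> carrier (bar M \<Gamma>')"
proof -
  have m: "morphism \<Gamma> \<Gamma>' f" and P: "is_partition \<Gamma>" "is_partition \<Gamma>'"
    using f by (auto simp: isomorphism_def morphism_def)
  interpret obj': comm_group "obj M \<Gamma>'" using P(2) by (rule obj_comm_group)
  obtain a where a: "a \<in> carrier (obj M \<Gamma>)" "A = bar_proj M \<Gamma> a"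
    using A by (auto simp: carrier_bar)
  have fa: "tr M \<Gamma> \<Gamma>' f a \<in> carrier (obj M \<Gamma>')"
    by (rule tr_closed[OF m a(1)])
  have "bar_proj M \<Gamma>' (tr M \<Gamma> \<Gamma>' f b) = bar_proj M \<Gamma>' (tr M \<Gamma> \<Gamma>' f a)" if b: "b \<in> A" for b
  proof -
    obtain i where i: "i \<in> tr_ideal M \<Gamma>" "b = i \<otimes>\<^bsub>obj M \<Gamma>\<^esub> a"
      using b a(2) by (auto elim: bar_projE)
    have "tr M \<Gamma> \<Gamma>' f b = tr M \<Gamma> \<Gamma>' f i \<otimes>\<^bsub>obj M \<Gamma>'\<^esub> tr M \<Gamma> \<Gamma>' f a"
      using hom_mult[OF tr_hom[OF m] tr_ideal_closed[OF P(1) i(1)] a(1)] i(2) by simp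
    moreover have "tr M \<Gamma> \<Gamma>' f i \<in> tr_ideal M \<Gamma>'"
      using tr_iso_tr_ideal[OF f] i(1) by auto
    ultimately have "tr M \<Gamma> \<Gamma>' f b \<in> bar_proj M \<Gamma>' (tr M \<Gamma> \<Gamma>' f a)"
      by (auto simp: bar_proj_def r_coset_def)
    then show ?thesis
      unfolding bar_proj_def
      using obj'.repr_independence[OF _ fa subgroup_tr_ideal[OF P(2)]] by simp
  qed
  then have "bar_tr M \<Gamma> \<Gamma>' f A = bar_proj M \<Gamma>' (tr M \<Gamma> \<Gamma>' f a)"
    using bar_nonempty[OF P(1) A] by (auto simp: bar_tr_def)
  then show ?thesis
    using fa by (simp add: carrier_bar)
qed

end

section \<open>Descent of d to the quotients\<close>

context augmentation
begin

abbreviation dbar :: "'u point partn \<Rightarrow> 'a set \<Rightarrow> 'k" where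
  "dbar \<equiv> moebius_bar R K \<epsilon>"

text \<open>The kernel of d_\<Gamma> is a subgroup and contains the generators of I_\<Gamma> by
  \<open>moebius_tr_strict\<close>.\<close>

lemma moebius_tr_ideal:
  assumes P: "is_partition \<Gamma>" and i: "i \<in> tr_ideal R \<Gamma>"
  shows "d \<Gamma> i = \<zero>"
proof -
  interpret d: group_hom "obj R \<Gamma>" "add_monoid K" "d \<Gamma>"
    using R.obj_comm_group[OF P] moebius_hom[OF P] K.a_group
    by (simp add: group_hom_def group_hom_axioms_def comm_group_def)
  have "tr_ideal R \<Gamma> \<subseteq> kernel (obj R \<Gamma>) (add_monoid K) (d \<Gamma>)"
    unfolding tr_ideal_def
    by (rule d.G.generate_subgroup_incl[OF _ d.subgroup_kernel])
      (use R.tr_ideal_generators[OF P] moebius_tr_strict in \<open>auto simp: kernel_def\<close>)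
  then show ?thesis
    using i by (auto simp: kernel_def)
qed

lemma moebius_bar_proj:
  assumes P: "is_partition \<Gamma>" and a: "a \<in> carrier (obj R \<Gamma>)" and b: "b \<in> bar_proj R \<Gamma> a"
  shows "d \<Gamma> b = d \<Gamma> a"
proof -
  obtain i where i: "i \<in> tr_ideal R \<Gamma>" "b = i \<otimes>\<^bsub>obj R \<Gamma>\<^esub> a"
    using b by (rule R.bar_projE)
  then show ?thesis
    using moebius_add[OF P R.tr_ideal_closed[OF P i(1)] a] moebius_tr_ideal[OF P i(1)]
      moebius_closed[OF P a] by simp
qed

lemma dbar_proj: "is_partition \<Gamma> \<Longrightarrow> a \<in> carrier (obj R \<Gamma>) \<Longrightarrow> dbar \<Gamma> (bar_proj R \<Gamma> a) = d \<Gamma> a"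
  using R.bar_proj_self by (blast intro: moebius_bar_eqI moebius_bar_proj)

text \<open>Elements of one coset differ by an element of I_\<Gamma>, where d_\<Gamma> is zero, so
  any element computes the induced map.\<close>

lemma dbar_eq:
  assumes P: "is_partition \<Gamma>" and A: "A \<in> carrier (bar R \<Gamma>)" "a \<in> A"
  shows "dbar \<Gamma> A = d \<Gamma> a"
  using A dbar_proj[OF P] moebius_bar_proj[OF P] by (auto simp: R.carrier_bar)

lemma dbar_closed: "is_partition \<Gamma> \<Longrightarrow> A \<in> carrier (bar R \<Gamma>) \<Longrightarrow> dbar \<Gamma> A \<in> carrier K"
  by (auto simp: R.carrier_bar dbar_proj moebius_closed)

lemma dbar_hom:
  assumes P: "is_partition \<Gamma>"
  shows "dbar \<Gamma> \<in> hom (bar R \<Gamma>) (add_monoid K)"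
proof (rule homI)
  interpret obj: comm_group "obj R \<Gamma>" using P by (rule R.obj_comm_group)
  show "dbar \<Gamma> A \<in> carrier (add_monoid K)" if "A \<in> carrier (bar R \<Gamma>)" for A
    using dbar_closed[OF P that] by simp
  show "dbar \<Gamma> (A \<otimes>\<^bsub>bar R \<Gamma>\<^esub> B) = dbar \<Gamma> A \<otimes>\<^bsub>add_monoid K\<^esub> dbar \<Gamma> B"
    if AB: "A \<in> carrier (bar R \<Gamma>)" "B \<in> carrier (bar R \<Gamma>)" for A B
  proof -
    obtain a b where a: "a \<in> carrier (obj R \<Gamma>)" "A = bar_proj R \<Gamma> a"
      and b: "b \<in> carrier (obj R \<Gamma>)" "B = bar_proj R \<Gamma> b"
      using AB by (auto simp: R.carrier_bar)
    have "A \<otimes>\<^bsub>bar R \<Gamma>\<^esub> B = bar_proj R \<Gamma> (a \<otimes>\<^bsub>obj R \<Gamma>\<^esub> b)"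
      using normal.rcos_sum[OF R.normal_tr_ideal[OF P] a(1) b(1)]
      by (simp add: bar_def bar_proj_def a(2) b(2))
    then show ?thesis
      using P a b by (simp add: dbar_proj moebius_add)
  qed
qed

text \<open>The transfer of any a in A is an element of the image coset, so evaluating there reduces
  the claim to the isomorphism invariance of d.\<close>

lemma dbar_tr:
  assumes f: "isomorphism \<Gamma> \<Gamma>' f" and A: "A \<in> carrier (bar R \<Gamma>)"
  shows "dbar \<Gamma>' (bar_tr R \<Gamma> \<Gamma>' f A) = dbar \<Gamma> A"
proof -
  have m: "morphism \<Gamma> \<Gamma>' f" and P: "is_partition \<Gamma>" "is_partition \<Gamma>'"
    using f by (auto simp: isomorphism_def morphism_def)
  obtain a where a: "a \<in> A"
    using R.bar_nonempty[OF P(1) A] by auto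
  have a': "a \<in> carrier (obj R \<Gamma>)"
    by (rule R.bar_mem_closed[OF P(1) A a])
  have "tr R \<Gamma> \<Gamma>' f a \<in> bar_tr R \<Gamma> \<Gamma>' f A"
    using a R.bar_proj_self[OF P(2) R.tr_closed[OF m a']] by (auto simp: bar_tr_def)
  then show ?thesis
    using dbar_eq[OF P(2) R.bar_tr_closed[OF f A]] dbar_eq[OF P(1) A a] moebius_tr_iso[OF f a'] by simp
qed

lemma dbar_ext:
  assumes P: "is_partition \<Gamma>" "is_partition \<Theta>" and A: "A \<in> carrier (bar R \<Gamma>)" and B: "B \<in> carrier (bar R \<Theta>)"
  shows "dbar (\<Gamma> \<squnion>\<^sub>P \<Theta>) (bar_ext R \<Gamma> \<Theta> A B) = dbar \<Gamma> A \<otimes> dbar \<Theta> B"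
proof (rule moebius_bar_eqI)
  note PU = is_partition_disj_union[OF P]
  note cl = R.bar_mem_closed[OF P(1) A] R.bar_mem_closed[OF P(2) B]
  obtain a b where "a \<in> A" "b \<in> B"
    using R.bar_nonempty[OF P(1) A] R.bar_nonempty[OF P(2) B] by auto
  then show "bar_ext R \<Gamma> \<Theta> A B \<noteq> {}"
    using R.bar_proj_self[OF PU ext_closed[OF P cl]] unfolding bar_ext_def by blast
  fix c assume "c \<in> bar_ext R \<Gamma> \<Theta> A B"
  then obtain a b where ab: "a \<in> A" "b \<in> B" "c \<in> bar_proj R (\<Gamma> \<squnion>\<^sub>P \<Theta>) (ext R \<Gamma> \<Theta> a b)"
    by (auto simp: bar_ext_def)
  then show "d (\<Gamma> \<squnion>\<^sub>P \<Theta>) c = dbar \<Gamma> A \<otimes> dbar \<Theta> B"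
    using moebius_bar_proj[OF PU ext_closed[OF P cl] ab(3)] moebius_ext[OF P cl]
      dbar_eq[OF P(1) A ab(1)] dbar_eq[OF P(2) B ab(2)] by simp
qed

section \<open>The map on PD and its compatibilities\<close>

abbreviation E :: "'u point partn \<Rightarrow> ('u point partn \<Rightarrow> 'a set) \<Rightarrow> 'k" where
  "E \<equiv> PD_aug R K \<epsilon>"

lemma PD_component:
  "x \<in> carrier (PD_obj R \<Lambda>) \<Longrightarrow> refines \<Gamma> \<Lambda> \<Longrightarrow> x \<Gamma> \<in> carrier (bar R \<Gamma>)"
  by (auto simp: PD_obj_def PD_sum_def refinements_def PiE_iff)

lemma dbar_component:
  "x \<in> carrier (PD_obj R \<Lambda>) \<Longrightarrow> refines \<Gamma> \<Lambda> \<Longrightarrow> dbar \<Gamma> (x \<Gamma>) \<in> carrier K"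
  using PD_component dbar_closed refines_is_partition(1) by blast

lemma PD_aug_hom: "E \<Lambda> \<in> hom (PD_obj R \<Lambda>) (add_monoid K)"
proof (rule homI)
  show "E \<Lambda> x \<in> carrier (add_monoid K)" if "x \<in> carrier (PD_obj R \<Lambda>)" for x
    using that by (auto simp: PD_aug_def refinements_def dbar_component intro!: K.finsum_closed)
  show "E \<Lambda> (x \<otimes>\<^bsub>PD_obj R \<Lambda>\<^esub> y) = E \<Lambda> x \<otimes>\<^bsub>add_monoid K\<^esub> E \<Lambda> y"
    if x: "x \<in> carrier (PD_obj R \<Lambda>)" and y: "y \<in> carrier (PD_obj R \<Lambda>)" for x y
  proof -
    have "E \<Lambda> (x \<otimes>\<^bsub>PD_obj R \<Lambda>\<^esub> y) = (\<Oplus>\<Gamma>\<in>refinements \<Lambda>. dbar \<Gamma> (x \<Gamma>) \<oplus> dbar \<Gamma> (y \<Gamma>))"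
      unfolding PD_aug_def
    proof (rule K.finsum_cong'[OF refl])
      fix \<Gamma> assume "\<Gamma> \<in> refinements \<Lambda>"
      then have \<Gamma>: "refines \<Gamma> \<Lambda>" by (simp add: refinements_def)
      then have "(x \<otimes>\<^bsub>PD_obj R \<Lambda>\<^esub> y) \<Gamma> = x \<Gamma> \<otimes>\<^bsub>bar R \<Gamma>\<^esub> y \<Gamma>"
        by (simp add: PD_obj_def PD_sum_def refinements_def)
      then show "dbar \<Gamma> ((x \<otimes>\<^bsub>PD_obj R \<Lambda>\<^esub> y) \<Gamma>) = dbar \<Gamma> (x \<Gamma>) \<oplus> dbar \<Gamma> (y \<Gamma>)"
        using hom_mult[OF dbar_hom[OF refines_is_partition(1)[OF \<Gamma>]] PD_component[OF x \<Gamma>] PD_component[OF y \<Gamma>]]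
        by simp
    qed (use x y in \<open>auto simp: refinements_def dbar_component\<close>)
    also have "\<dots> = E \<Lambda> x \<oplus> E \<Lambda> y"
      unfolding PD_aug_def
      by (rule K.finsum_addf) (use x y in \<open>auto simp: refinements_def dbar_component\<close>)
    finally show ?thesis by simp
  qed
qed

text \<open>Applied to a component of the transfer, the induced d passes through the sum and removes
  each isomorphism \<sigma>f. What remains involves only components of x at refinements of \<Psi>,
  each counted once per coset.\<close>

lemma PD_aug_tr:
  assumes f: "morphism \<Psi> \<Lambda> f" and x: "x \<in> carrier (PD_obj R \<Psi>)"
  shows "E \<Lambda> (PD_tr R \<Psi> \<Lambda> f x) = [perm_index \<Psi> \<Lambda> f] \<cdot> E \<Psi> x"
proof -
  define DC where "DC \<Gamma> = {D \<in> double_cosets \<Gamma> \<Lambda> (transport f \<Psi>).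
      refines \<Gamma> (transport (representative D \<circ> f) \<Psi>)}" for \<Gamma>
  define h where "h D = representative D \<circ> f" for D
  \<comment> \<open>This is (\<sigma>f)^-1 \<Gamma>, with the inverse taken on the points of \<Psi>;
    for the double cosets in \<open>DC\<close> it refines \<Psi>.\<close>
  define B where "B \<Gamma> D = transport_back (pts \<Psi>) (h D) \<Gamma>" for \<Gamma> D
  have P: "is_partition \<Psi>"
    using f by (simp add: morphism_def)
  have B: "refines (B \<Gamma> D) \<Psi>" "isomorphism (B \<Gamma> D) \<Gamma> (h D)"
    if \<Gamma>: "refines \<Gamma> \<Lambda>" and D: "D \<in> DC \<Gamma>" for \<Gamma> D
  proof -
    have D': "D \<in> double_cosets \<Gamma> \<Lambda> (transport f \<Psi>)" "refines \<Gamma> (transport (h D) \<Psi>)"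
      using D by (auto simp: DC_def h_def)
    have "representative D \<in> block_perms \<Lambda>"
      by (rule representative_double_cosets(1)[OF \<Gamma> morphism_refines_transport[OF f] D'(1)])
    then have inj: "inj_on (h D) (pts \<Psi>)"
      unfolding h_def using f by (intro comp_inj_on) (auto simp: morphism_inj_on block_perms_inj_on)
    obtain \<Gamma>' where \<Gamma>': "refines \<Gamma>' \<Psi>" "\<Gamma> = transport (h D) \<Gamma>'"
      using bij_betw_refinements_transport[OF P inj] D'(2)
      by (auto simp: bij_betw_def refinements_def)
    have inj': "inj_on (h D) (pts \<Gamma>')"
      using inj \<Gamma>'(1) by (simp add: refines_iff)
    have "B \<Gamma> D = \<Gamma>'"
      unfolding B_def transport_back_def \<Gamma>'(2) using \<Gamma>'(1) inj
      by (intro transport_inv_into) (auto simp: refines_iff)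
    then show "refines (B \<Gamma> D) \<Psi>" "isomorphism (B \<Gamma> D) \<Gamma> (h D)"
      using \<Gamma>' isomorphism_transport[OF refines_is_partition(1)[OF \<Gamma>'(1)] inj'] by auto
  qed
  have "dbar \<Gamma> (PD_tr R \<Psi> \<Lambda> f x \<Gamma>) = (\<Oplus>D\<in>DC \<Gamma>. dbar (B \<Gamma> D) (x (B \<Gamma> D)))"
    if "\<Gamma> \<in> refinements \<Lambda>" for \<Gamma>
  proof -
    have \<Gamma>: "refines \<Gamma> \<Lambda>" and P\<Gamma>: "is_partition \<Gamma>"
      using that by (auto simp: refinements_def refines_iff)
    have cl: "bar_tr R (B \<Gamma> D) \<Gamma> (h D) (x (B \<Gamma> D)) \<in> carrier (bar R \<Gamma>)" if "D \<in> DC \<Gamma>" for D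
      using B[OF \<Gamma> that] PD_component[OF x] R.bar_tr_closed by blast
    have "dbar \<Gamma> (PD_tr R \<Psi> \<Lambda> f x \<Gamma>) =
        dbar \<Gamma> (finprod (bar R \<Gamma>) (\<lambda>D. bar_tr R (B \<Gamma> D) \<Gamma> (h D) (x (B \<Gamma> D))) (DC \<Gamma>))"
      using that by (simp add: PD_tr_def DC_def B_def h_def Let_def)
    also have "\<dots> = (\<Oplus>D\<in>DC \<Gamma>. dbar \<Gamma> (bar_tr R (B \<Gamma> D) \<Gamma> (h D) (x (B \<Gamma> D))))"
      using P\<Gamma> cl by (intro hom_finprod_finsum R.comm_group_bar dbar_hom) auto
    also have "\<dots> = (\<Oplus>D\<in>DC \<Gamma>. dbar (B \<Gamma> D) (x (B \<Gamma> D)))"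
      by (rule K.finsum_cong'[OF refl])
        (use B[OF \<Gamma>] x in \<open>auto simp: dbar_tr PD_component dbar_component\<close>)
    finally show ?thesis .
  qed
  then have "E \<Lambda> (PD_tr R \<Psi> \<Lambda> f x) = (\<Oplus>\<Gamma>\<in>refinements \<Lambda>. \<Oplus>D\<in>DC \<Gamma>. dbar (B \<Gamma> D) (x (B \<Gamma> D)))"
    unfolding PD_aug_def using B x
    by (intro K.finsum_cong'[OF refl])
      (auto simp: refinements_def dbar_component intro!: K.finsum_closed)
  also have "\<dots> = [perm_index \<Psi> \<Lambda> f] \<cdot> E \<Psi> x"
    using K.add.finprod_double_cosets[OF f, of "\<lambda>\<Gamma>. dbar \<Gamma> (x \<Gamma>)"] x
    by (simp add: PD_aug_def DC_def B_def h_def Pi_iff refinements_def dbar_component)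
  finally show ?thesis .
qed

text \<open>The component at a refinement is the product of the components at its two parts, so
  multiplicativity of the induced d and the distributive law suffice.\<close>

lemma PD_aug_ext:
  assumes P: "is_partition \<Lambda>" "is_partition \<Omega>"
    and x: "x \<in> carrier (PD_obj R \<Lambda>)" and y: "y \<in> carrier (PD_obj R \<Omega>)"
  shows "E (\<Lambda> \<squnion>\<^sub>P \<Omega>) (PD_ext R \<Lambda> \<Omega> x y) = E \<Lambda> x \<otimes> E \<Omega> y"
proof -
  have "E (\<Lambda> \<squnion>\<^sub>P \<Omega>) (PD_ext R \<Lambda> \<Omega> x y) =
      (\<Oplus>\<Delta>\<in>refinements (\<Lambda> \<squnion>\<^sub>P \<Omega>).
        dbar (left_part \<Delta>) (x (left_part \<Delta>)) \<otimes> dbar (right_part \<Delta>) (y (right_part \<Delta>)))"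
    unfolding PD_aug_def
  proof (rule K.finsum_cong'[OF refl])
    show "(\<lambda>\<Delta>. dbar (left_part \<Delta>) (x (left_part \<Delta>)) \<otimes> dbar (right_part \<Delta>) (y (right_part \<Delta>)))
        \<in> refinements (\<Lambda> \<squnion>\<^sub>P \<Omega>) \<rightarrow> carrier K"
      using x y refines_disj_unionE[OF _ P] by (auto simp: refinements_def dbar_component)
    fix \<Delta> assume "\<Delta> \<in> refinements (\<Lambda> \<squnion>\<^sub>P \<Omega>)"
    then have \<Delta>: "refines \<Delta> (\<Lambda> \<squnion>\<^sub>P \<Omega>)"
      by (simp add: refinements_def)
    note l = refines_disj_unionE[OF \<Delta> P]
    show "dbar \<Delta> (PD_ext R \<Lambda> \<Omega> x y \<Delta>) =
        dbar (left_part \<Delta>) (x (left_part \<Delta>)) \<otimes> dbar (right_part \<Delta>) (y (right_part \<Delta>))"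
      using dbar_ext[OF refines_is_partition(1)[OF l(1)] refines_is_partition(1)[OF l(2)]
          PD_component[OF x l(1)] PD_component[OF y l(2)]] \<Delta>
      by (simp add: PD_ext_def refinements_def l(3))
  qed
  also have "\<dots> = E \<Lambda> x \<otimes> E \<Omega> y"
    unfolding PD_aug_def
    by (rule K.finsum_refinements_disj_union[OF P, of "\<lambda>\<Gamma>. dbar \<Gamma> (x \<Gamma>)" "\<lambda>\<Theta>. dbar \<Theta> (y \<Theta>)"])
      (use x y in \<open>auto simp: refinements_def dbar_component\<close>)
  finally show ?thesis .
qed

text \<open>The components of the unit are the classes of the restrictions of z, so its value is
  literally the left-hand side of \<open>moebius_sum\<close>.\<close>

lemma PD_aug_unit:
  assumes P: "is_partition \<Lambda>" and z: "z \<in> carrier (obj R \<Lambda>)"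
  shows "E \<Lambda> (PD_unit R \<Lambda> z) = [card (block_perms \<Lambda>)] \<cdot> \<epsilon> \<Lambda> z"
proof -
  have "E \<Lambda> (PD_unit R \<Lambda> z) = (\<Oplus>\<Gamma>\<in>refinements \<Lambda>. d \<Gamma> (res R \<Gamma> \<Lambda> id z))"
    unfolding PD_aug_def
  proof (rule K.finsum_cong'[OF refl])
    fix \<Gamma> assume "\<Gamma> \<in> refinements \<Lambda>"
    then show "dbar \<Gamma> (PD_unit R \<Lambda> z \<Gamma>) = d \<Gamma> (res R \<Gamma> \<Lambda> id z)"
      using dbar_proj[OF refines_is_partition(1) res_refines_closed[OF _ z]]
      by (simp add: PD_unit_def refinements_def)
  qed (use z in \<open>auto simp: refinements_def moebius_res_closed\<close>)
  then show ?thesis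
    using moebius_sum[OF P z] by simp
qed

text \<open>The unit element of PD(R) is the image of that of R under the unit map at the empty
  partition, so the value there is |\<Sigma>| times \<epsilon>(1), both equal to 1.\<close>

lemma PD_aug_transfer_monoidal: "transfer_monoidal_map (PD R) (const_pf K) E"
  using PD_aug_hom PD_aug_tr PD_aug_ext PD_aug_unit[OF is_partition_empty R.unt_closed]
  by (simp add: transfer_monoidal_map_def PD_def const_pf_def card_block_perms_empty aug_unt)

end

section \<open>Naturality in the functor, the ring and the augmentation\<close>

text \<open>Since \<kappa> preserves integer multiples, sums and differences, and \<phi> commutes
  with restrictions, both sides satisfy the same recursion.\<close>

lemma moebius_aug_natural:
  assumes "augmentation R K \<epsilon>" "augmentation R' K' \<epsilon>'"
    and \<phi>: "lsm_pfunctor_map R R' \<phi>" and \<kappa>: "\<kappa> \<in> ring_hom K K'"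
    and nat: "\<And>\<Lambda> z. is_partition \<Lambda> \<Longrightarrow> z \<in> carrier (obj R \<Lambda>) \<Longrightarrow> \<kappa> (\<epsilon> \<Lambda> z) = \<epsilon>' \<Lambda> (\<phi> \<Lambda> z)"
  shows "is_partition \<Gamma> \<Longrightarrow> a \<in> carrier (obj R \<Gamma>) \<Longrightarrow>
    \<kappa> (moebius_aug R K \<epsilon> \<Gamma> a) = moebius_aug R' K' \<epsilon>' \<Gamma> (\<phi> \<Gamma> a)"
proof (induction \<Gamma> arbitrary: a rule: strict_refinement_induct)
  case (1 \<Gamma>)
  interpret A: augmentation R K \<epsilon> by fact
  interpret A': augmentation R' K' \<epsilon>' by fact
  interpret \<kappa>: ring_hom_cring K K' \<kappa>
    using \<kappa> A.K.cring_axioms A'.K.cring_axioms by (simp add: ring_hom_cring_def ring_hom_cring_axioms_def)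
  let ?S = "{\<Delta>. strictly_refines \<Delta> \<Gamma>}"
  have \<phi>_closed: "\<phi> \<Lambda> z \<in> carrier (obj R' \<Lambda>)"
    if "is_partition \<Lambda>" "z \<in> carrier (obj R \<Lambda>)" for \<Lambda> z
    using that \<phi> hom_in_carrier[of "\<phi> \<Lambda>"]
    by (auto simp: lsm_pfunctor_map_def transfer_monoidal_map_def)
  have \<kappa>_pow: "\<kappa> ([n] \<cdot>\<^bsub>K\<^esub> k) = [n] \<cdot>\<^bsub>K'\<^esub> \<kappa> k" if "k \<in> carrier K" for n :: nat and k
    using that by (induction n) (simp_all add: A.K.add.nat_pow_Suc A'.K.add.nat_pow_Suc)
  have summand: "\<kappa> (A.d \<Delta> (res R \<Delta> \<Gamma> id a)) = A'.d \<Delta> (res R' \<Delta> \<Gamma> id (\<phi> \<Gamma> a))"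
    if s: "strictly_refines \<Delta> \<Gamma>" for \<Delta>
  proof -
    note \<Delta> = strictly_refines_imp[OF s]
    \<comment> \<open>Naturality needs \<phi> to respect restrictions, although \<epsilon> need not:
      the recursion restricts before it applies \<epsilon>.\<close>
    have "\<phi> \<Delta> (res R \<Delta> \<Gamma> id a) = res R' \<Delta> \<Gamma> id (\<phi> \<Gamma> a)"
      using \<phi> refines_morphism[OF \<Delta>] 1(3) by (simp add: lsm_pfunctor_map_def)
    then show ?thesis
      using 1(1)[OF s refines_is_partition(1)[OF \<Delta>] A.res_refines_closed[OF \<Delta> 1(3)]] by simp
  qed
  have cl: "(\<lambda>\<Delta>. A.d \<Delta> (res R \<Delta> \<Gamma> id a)) \<in> ?S \<rightarrow> carrier K"
    "(\<lambda>\<Delta>. A'.d \<Delta> (res R' \<Delta> \<Gamma> id (\<phi> \<Gamma> a))) \<in> ?S \<rightarrow> carrier K'"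
    using 1(3) \<phi>_closed[OF 1(2,3)]
    by (auto simp: strictly_refines_imp A.moebius_res_closed A'.moebius_res_closed)
  have "(\<Oplus>\<^bsub>K'\<^esub>\<Delta>\<in>?S. \<kappa> (A.d \<Delta> (res R \<Delta> \<Gamma> id a))) =
      (\<Oplus>\<^bsub>K'\<^esub>\<Delta>\<in>?S. A'.d \<Delta> (res R' \<Delta> \<Gamma> id (\<phi> \<Gamma> a)))"
    by (rule A'.K.finsum_cong'[OF refl cl(2)]) (simp add: summand)
  then have "\<kappa> (\<Oplus>\<^bsub>K\<^esub>\<Delta>\<in>?S. A.d \<Delta> (res R \<Delta> \<Gamma> id a)) =
      (\<Oplus>\<^bsub>K'\<^esub>\<Delta>\<in>?S. A'.d \<Delta> (res R' \<Delta> \<Gamma> id (\<phi> \<Gamma> a)))"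
    using \<kappa>.hom_finsum[OF cl(1)] by (simp add: comp_def)
  then show ?case
    unfolding A.moebius_rec[OF 1(2,3)] A'.moebius_rec[OF 1(2) \<phi>_closed[OF 1(2,3)]]
    using A.K.finsum_closed[OF cl(1)] A.aug_closed[OF 1(2,3)] nat[OF 1(2,3)]
    by (simp add: A.K.minus_eq A'.K.minus_eq \<kappa>_pow)
qed

text \<open>The set \<open>PD_map\<close> puts at \<Gamma> is a union of cosets of the elements
  \<phi>(a), with a running through x_\<Gamma>. By \<open>moebius_aug_natural\<close>, d' is
  constant on it with value \<kappa> of the induced d at x_\<Gamma>; then \<kappa> passes through
  the finite sum.\<close>

lemma PD_aug_natural:
  assumes "augmentation R K \<epsilon>" "augmentation R' K' \<epsilon>'"
    and \<phi>: "lsm_pfunctor_map R R' \<phi>" and \<kappa>: "\<kappa> \<in> ring_hom K K'"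
    and nat: "\<And>\<Lambda> z. is_partition \<Lambda> \<Longrightarrow> z \<in> carrier (obj R \<Lambda>) \<Longrightarrow> \<kappa> (\<epsilon> \<Lambda> z) = \<epsilon>' \<Lambda> (\<phi> \<Lambda> z)"
    and x: "x \<in> carrier (PD_obj R \<Lambda>)"
  shows "\<kappa> (PD_aug R K \<epsilon> \<Lambda> x) = PD_aug R' K' \<epsilon>' \<Lambda> (PD_map R' \<phi> \<Lambda> x)"
proof -
  interpret A: augmentation R K \<epsilon> by fact
  interpret A': augmentation R' K' \<epsilon>' by fact
  interpret \<kappa>: ring_hom_cring K K' \<kappa>
    using \<kappa> A.K.cring_axioms A'.K.cring_axioms by (simp add: ring_hom_cring_def ring_hom_cring_axioms_def)
  have comp: "A'.dbar \<Gamma> (PD_map R' \<phi> \<Lambda> x \<Gamma>) = \<kappa> (A.dbar \<Gamma> (x \<Gamma>))" if "\<Gamma> \<in> refinements \<Lambda>" for \<Gamma>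
  proof -
    have \<Gamma>: "refines \<Gamma> \<Lambda>" and P: "is_partition \<Gamma>"
      using that by (auto simp: refinements_def refines_iff)
    note x\<Gamma> = A.PD_component[OF x \<Gamma>]
    have \<phi>_closed: "\<phi> \<Gamma> a \<in> carrier (obj R' \<Gamma>)" if "a \<in> x \<Gamma>" for a
      using A.R.bar_mem_closed[OF P x\<Gamma> that] P \<phi> hom_in_carrier[of "\<phi> \<Gamma>"]
      by (auto simp: lsm_pfunctor_map_def transfer_monoidal_map_def)
    have eq: "PD_map R' \<phi> \<Lambda> x \<Gamma> = (\<Union>a\<in>x \<Gamma>. bar_proj R' \<Gamma> (\<phi> \<Gamma> a))"
      using that by (simp add: PD_map_def)
    show ?thesis
      unfolding eq
    proof (rule moebius_bar_eqI)
      show "(\<Union>a\<in>x \<Gamma>. bar_proj R' \<Gamma> (\<phi> \<Gamma> a)) \<noteq> {}"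
        using A.R.bar_nonempty[OF P x\<Gamma>] A'.R.bar_proj_self[OF P \<phi>_closed] by fastforce
      fix b assume "b \<in> (\<Union>a\<in>x \<Gamma>. bar_proj R' \<Gamma> (\<phi> \<Gamma> a))"
      then obtain a where a: "a \<in> x \<Gamma>" "b \<in> bar_proj R' \<Gamma> (\<phi> \<Gamma> a)" by blast
      have "A'.d \<Gamma> b = A'.d \<Gamma> (\<phi> \<Gamma> a)"
        by (rule A'.moebius_bar_proj[OF P \<phi>_closed[OF a(1)] a(2)])
      also have "\<dots> = \<kappa> (A.d \<Gamma> a)"
        using moebius_aug_natural[OF assms(1-4) nat P A.R.bar_mem_closed[OF P x\<Gamma> a(1)]] by simp
      also have "\<dots> = \<kappa> (A.dbar \<Gamma> (x \<Gamma>))"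
        by (simp add: A.dbar_eq[OF P x\<Gamma> a(1)])
      finally show "A'.d \<Gamma> b = \<kappa> (A.dbar \<Gamma> (x \<Gamma>))" .
    qed
  qed
  have cl: "(\<lambda>\<Gamma>. A.dbar \<Gamma> (x \<Gamma>)) \<in> refinements \<Lambda> \<rightarrow> carrier K"
    using x by (auto simp: refinements_def A.dbar_component)
  have "PD_aug R' K' \<epsilon>' \<Lambda> (PD_map R' \<phi> \<Lambda> x) = (\<Oplus>\<^bsub>K'\<^esub>\<Gamma>\<in>refinements \<Lambda>. \<kappa> (A.dbar \<Gamma> (x \<Gamma>)))"
    unfolding PD_aug_def
    by (rule A'.K.finsum_cong'[OF refl]) (use comp cl in \<open>auto simp: Pi_iff\<close>)
  also have "\<dots> = \<kappa> (PD_aug R K \<epsilon> \<Lambda> x)"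
    unfolding PD_aug_def using \<kappa>.hom_finsum[OF cl] by (simp add: comp_def)
  finally show ?thesis by simp
qed

text \<open>The word "canonically" is made precise in two ways: one operation is fixed before any
  data are given, and it is natural for pairs (\<phi>, \<kappa>) that are compatible with the
  augmentations. The witness is the Moebius sum \<open>PD_aug\<close>.\<close>

theorem proposition14p2:
  "\<exists>E :: ('u, 'a) pfunctor \<Rightarrow> 'k ring \<Rightarrow> ('u point partn \<Rightarrow> 'a \<Rightarrow> 'k) \<Rightarrow>
        'u point partn \<Rightarrow> ('u point partn \<Rightarrow> 'a set) \<Rightarrow> 'k.
     (\<forall>R K \<epsilon>. lax_symmetric_monoidal R \<longrightarrow> cring K \<longrightarrow>
        transfer_monoidal_map R (dual_const_pf K) \<epsilon> \<longrightarrow>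
        transfer_monoidal_map (PD R) (const_pf K) (E R K \<epsilon>) \<and>
        (\<forall>\<Lambda>. is_partition \<Lambda> \<longrightarrow> (\<forall>z \<in> carrier (obj R \<Lambda>).
           E R K \<epsilon> \<Lambda> (PD_unit R \<Lambda> z) = [card (block_perms \<Lambda>)] \<cdot>\<^bsub>K\<^esub> \<epsilon> \<Lambda> z))) \<and>
     (\<forall>R K \<epsilon> R' K' \<epsilon>' \<phi> \<kappa>.
        lax_symmetric_monoidal R \<longrightarrow> cring K \<longrightarrow>
        transfer_monoidal_map R (dual_const_pf K) \<epsilon> \<longrightarrow>
        lax_symmetric_monoidal R' \<longrightarrow> cring K' \<longrightarrow>
        transfer_monoidal_map R' (dual_const_pf K') \<epsilon>' \<longrightarrow>
        lsm_pfunctor_map R R' \<phi> \<longrightarrow> \<kappa> \<in> ring_hom K K' \<longrightarrow>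
        (\<forall>\<Lambda>. is_partition \<Lambda> \<longrightarrow> (\<forall>z \<in> carrier (obj R \<Lambda>). \<kappa> (\<epsilon> \<Lambda> z) = \<epsilon>' \<Lambda> (\<phi> \<Lambda> z))) \<longrightarrow>
        (\<forall>\<Lambda>. is_partition \<Lambda> \<longrightarrow> (\<forall>x \<in> carrier (obj (PD R) \<Lambda>).
           \<kappa> (E R K \<epsilon> \<Lambda> x) = E R' K' \<epsilon>' \<Lambda> (PD_map R' \<phi> \<Lambda> x))))"
proof (intro exI[of _ PD_aug] conjI allI impI ballI)
  fix R :: "('u, 'a) pfunctor" and K :: "'k ring" and \<epsilon> :: "'u point partn \<Rightarrow> 'a \<Rightarrow> 'k"
  assume "lax_symmetric_monoidal R" "cring K" "transfer_monoidal_map R (dual_const_pf K) \<epsilon>"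
  then interpret augmentation R K \<epsilon>
    by (simp add: augmentation_def augmentation_axioms_def)
  show "transfer_monoidal_map (PD R) (const_pf K) E"
    by (rule PD_aug_transfer_monoidal)
  show "E \<Lambda> (PD_unit R \<Lambda> z) = [card (block_perms \<Lambda>)] \<cdot>\<^bsub>K\<^esub> \<epsilon> \<Lambda> z"
    if "is_partition \<Lambda>" "z \<in> carrier (obj R \<Lambda>)" for \<Lambda> z
    using that by (rule PD_aug_unit)
next
  fix R R' :: "('u, 'a) pfunctor" and K K' :: "'k ring"
    and \<epsilon> \<epsilon>' :: "'u point partn \<Rightarrow> 'a \<Rightarrow> 'k" and \<phi> \<kappa> \<Lambda> x
  assume "lax_symmetric_monoidal R" "cring K" "transfer_monoidal_map R (dual_const_pf K) \<epsilon>"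
    "lax_symmetric_monoidal R'" "cring K'" "transfer_monoidal_map R' (dual_const_pf K') \<epsilon>'"
    and *: "lsm_pfunctor_map R R' \<phi>" "\<kappa> \<in> ring_hom K K'"
    and nat: "\<forall>\<Lambda>. is_partition \<Lambda> \<longrightarrow> (\<forall>z \<in> carrier (obj R \<Lambda>). \<kappa> (\<epsilon> \<Lambda> z) = \<epsilon>' \<Lambda> (\<phi> \<Lambda> z))"
    and x: "x \<in> carrier (obj (PD R) \<Lambda>)"
  then have "augmentation R K \<epsilon>" "augmentation R' K' \<epsilon>'"
    by (simp_all add: augmentation_def augmentation_axioms_def)
  then show "\<kappa> (PD_aug R K \<epsilon> \<Lambda> x) = PD_aug R' K' \<epsilon>' \<Lambda> (PD_map R' \<phi> \<Lambda> x)"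
    by (rule PD_aug_natural[OF _ _ *]) (use nat x in \<open>auto simp: PD_def\<close>)
qed

end
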